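(* Let $n\ge3$ and $m\ge2$ be integers, and consider Algorithm 3 (with Algorithm 2 as a subroutine) described in the context. 1. Algorithm 3 can be implemented, using Algorithm 2 as a subroutine, so that it succeeds in every run and its output is as stated. That is, its steps can always be carried out, and the resulting SDP $(P)$, with dual $(D)$, and the matrices $X^*,Z^*,\bar X,\bar Z,Y_1,\dots,Y_\ell$ satisfy: $(P)$ fails strict complementarity with $(D)$; $X^*$ is a maximum rank optimal solution of $(P)$ and $Z^*$ is a maximum rank optimal solution of $(D)$; $\bar X$ is positive definite and feasible in $(P)$ and $\bar Z$ is positive definite and feasible in $(D)$ (so both $(P)$ and $(D)$ satisfy Slater's condition); $b_1=\dots=b_k=0$; $(Z^*,A_1,\dots,A_k)$ is a regular facial reduction sequence which reduces $\mathcal S^n_+$ to $\begin{pmatrix}0&0\\0&\oplus_r\end{pmatrix}$; $\langle A_i,Y_j\rangle=\langle C,Y_j\rangle=0$ for all $i=1,\dots,m$ and $j=1,\dots,\ell$; and $(X^*,Y_1,\dots,Y_\ell)$ is a regular facial reduction sequence which reduces $\mathcal S^n_+$ to $\begin{pmatrix}\oplus_s&0\\0&0\end{pmatrix}$. 2. Suppose $(P)$ is an SDP with $m$ constraints (with linearly independent constraint matrices) over $\mathcal S^n_+$ which fails strict complementarity with its dual $(D)$, but both $(P)$ and $(D)$ satisfy Slater's condition. Then $(P)$ is obtained as a reformulation of some possible output of Algorithm 3.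
   Context: Notation. $\mathcal S^n$ is the space of $n\times n$ real symmetric matrices, $\mathcal S^n_+$ the cone of positive semidefinite (psd) ones, $\langle S,T\rangle=\mathrm{trace}(ST)$, and $S\preceq T$ means $T-S$ is psd. $[n]=\{1,\dots,n\}$. For a matrix $M$ and $R,S\subseteq[n]$, $M(R,S)$ is the submatrix with rows $R$ and columns $S$, called the $(R,S)$ block, and $M(R)=M(R,R)$. Changing the $(R,S)$ block of a symmetric matrix always means changing the $(S,R)$ block accordingly. SDP pair. $(P)$: $\inf\langle C,X\rangle$ s.t. $\langle A_i,X\rangle=b_i$ $(i=1,\dots,m)$, $X\succeq0$; $(D)$: $\sup\langle b,y\rangle$ s.t. $\sum_{i}y_iA_i\preceq C$; here $A_i,C\in\mathcal S^n$, $b\in\mathbb R^m$. A matrix $Z$ is feasible (optimal) in $(D)$ if there is $y$ feasible (optimal) in $(D)$ with $Z=C-\sum_i y_iA_i\succeq0$. $(P)$ (respectively $(D)$) satisfies Slater's condition if it has a positive definite feasible $X$ (respectively $Z$). A maximum rank optimal solution is an optimal solution of largest rank. A pair of optimal solutions means $X$ feasible in $(P)$ and $Z$ feasible in $(D)$ with $\langle X,Z\rangle=0$ (so both are optimal, and $\mathrm{rank}\,X+\mathrm{rank}\,Z\le n$). $(P)$ fails strict complementarity with $(D)$ if such pairs exist, and for a pair of maximum rank optimal solutions $X,Z$ one has $\mathrm{rank}\,X+\mathrm{rank}\,Z<n$. Reformulation. A reformulation of $(P)$ is any SDP obtained from it by finitely many of the following operations, in any order: (a) rotating by an invertible matrix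 $T$, i.e. replacing every $A_i$ by $T^\top A_iT$ and $C$ by $T^\top CT$; (b) exchanging two equations; (c) for some $i$ and $y\in\mathbb R^m$ with $y_i\ne0$, replacing $\langle A_i,X\rangle=b_i$ by $\langle\sum_t y_tA_t,X\rangle=\langle b,y\rangle$. Regular facial reduction sequence. A sequence $(Y_1,\dots,Y_t)$ in $\mathcal S^n$ is a regular facial reduction sequence for $\mathcal S^n_+$ with structure $(R_1,\dots,R_t)$ if $R_1,\dots,R_t\subseteq[n]$ are pairwise disjoint and for every $i$: $Y_i(R_i)$ is diagonal positive definite, and all entries of $Y_i([n]\setminus(R_1\cup\dots\cup R_{i-1}))$ outside the block $Y_i(R_i)$ are zero (entries in rows or columns indexed by $R_1\cup\dots\cup R_{i-1}$ are arbitrary). It reduces $\mathcal S^n_+$ to $\mathcal S^n_+\cap Y_1^\perp\cap\dots\cap Y_t^\perp$. $\begin{pmatrix}0&0\\0&\oplus_r\end{pmatrix}$ and $\begin{pmatrix}\oplus_s&0\\0&0\end{pmatrix}$ denote the sets of matrices in $\mathcal S^n_+$ in which only the lower right $r\times r$ block, respectively only the upper left $s\times s$ block, may be nonzero. Algorithm 3 (input: integers $n\ge3$, $m\ge2$; output: the SDP $(P)$, and $X^*,Z^*,\bar X,\bar Z,Y_1,\dots,Y_\ell$). Step 1. Choose (a) positive integers $r,s$ with $r+s<n$, $k,\ell\in\{1,\dots,n-r-s\}$ with $k<m$; (b) positive definite matrices $\bar X,\bar Z\in\mathcal S^n$. Step 2. Choose $X^*=\begin{pmatrix}0&0&0\\0&0&0\\0&0&\Lambda\end{pmatrix}$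 and $Z^*=\begin{pmatrix}\Gamma&0&0\\0&0&0\\0&0&0\end{pmatrix}$ with $\Lambda,\Gamma$ diagonal positive definite of order $r$ and $s$, respectively, such that $\langle\bar X-X^*,\bar Z-Z^*\rangle=0$. Define $\Delta X=\bar X-X^*$, $\Delta Z=\bar Z-Z^*$. Step 3. Choose $A_1,\dots,A_k$ and $Y_1,\dots,Y_\ell$ so that $(Z^*,A_1,\dots,A_k)$ is a regular facial reduction sequence which reduces $\mathcal S^n_+$ to $\begin{pmatrix}0&0\\0&\oplus_r\end{pmatrix}$ and $(X^*,Y_1,\dots,Y_\ell)$ is a regular facial reduction sequence which reduces $\mathcal S^n_+$ to $\begin{pmatrix}\oplus_s&0\\0&0\end{pmatrix}$. Let $(P_0,\dots,P_k)$ and $(Q_0,\dots,Q_\ell)$ be their respective structures. Step 4. (a) Use Algorithm 2 to ensure $\langle A_i,Y_j\rangle=0$ for $i=1,\dots,k$, $j=1,\dots,\ell$. (b) Adjust $A_i(P_0)$ for $i=1,\dots,k$ and $Y_j(Q_0)$ for $j=1,\dots,\ell$ so that afterwards $\langle A_i,\Delta X\rangle=0$ and $\langle Y_j,\Delta Z\rangle=0$ for all $i=1,\dots,k$, $j=1,\dots,\ell$. Step 5. Let $A_{k+1}=\Delta Z$. Then choose $A_{k+2},\dots,A_m\in\mathcal S^n$ with zero inner product with $\Delta X,Y_1,\dots,Y_\ell$. Step 6. Set $b_i=\langle A_i,X^*\rangle$ for $i=1,\dots,m$ and $C=Z^*+\sum_{i=1}^m y_iA_i$ for some $y\in\mathbb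 R^m$. Algorithm 2 (Base Equations Algorithm; input: the sequences from Step 3). For $i=1,\dots,k$: adjust the $(P_{i-1},Q_0)$ block of $A_i,Y_1,\dots,Y_\ell$ so that $\langle A_i,Y_j\rangle=0$ for all $j=1,\dots,\ell$. "Possible output" means an output for some sequence of choices in these steps, where the adjusted blocks may be any that satisfy the required equations. In Step 3, the sets in the structures of $(Z^*,A_1,\dots,A_k)$ and $(X^*,Y_1,\dots,Y_\ell)$ are taken to be nonempty. *)

theory Defs
  imports "HOL-Analysis.Analysis"
begin

(* The index set {1,...,n} is a finite linearly ordered type 'n; the order is used only to say
   which indices belong to the upper left and to the lower right diagonal blocks. *)

type_synonym 'n sqmat = "real^'n^'n"

definition sym_mat :: "'n::finite sqmat \<Rightarrow> bool" where
  "sym_mat M \<longleftrightarrow> transpose M = M"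

definition psd :: "'n::finite sqmat \<Rightarrow> bool" where
  "psd M \<longleftrightarrow> sym_mat M \<and> (\<forall>x. 0 \<le> x \<bullet> (M *v x))"

definition pos_def :: "'n::finite sqmat \<Rightarrow> bool" where
  "pos_def M \<longleftrightarrow> sym_mat M \<and> (\<forall>x. x \<noteq> 0 \<longrightarrow> 0 < x \<bullet> (M *v x))"

definition mat_inner :: "'n::finite sqmat \<Rightarrow> 'n sqmat \<Rightarrow> real" where
  "mat_inner S T = trace (S ** T)"


subsection \<open>Blocks\<close>

(* Submatrices are not separate objects: a principal submatrix M(R) is M acting on the vectors
   supported in R. *)
definition diag_pd_block :: "'n::finite sqmat \<Rightarrow> 'n set \<Rightarrow> bool" where
  "diag_pd_block M R \<longleftrightarrow>
     (\<forall>a\<in>R. \<forall>b\<in>R. a \<noteq> b \<longrightarrow> M $ a $ b = 0) \<and>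
     (\<forall>x. (\<forall>a. a \<notin> R \<longrightarrow> x $ a = 0) \<and> x \<noteq> 0 \<longrightarrow> 0 < x \<bullet> (M *v x))"

definition supported_on :: "'n::finite sqmat \<Rightarrow> 'n set \<Rightarrow> bool" where
  "supported_on M R \<longleftrightarrow> (\<forall>a b. \<not> (a \<in> R \<and> b \<in> R) \<longrightarrow> M $ a $ b = 0)"

definition upper_left :: "nat \<Rightarrow> 'n::{finite,linorder} set" where
  "upper_left s = {a. card {c. c \<le> a} \<le> s}"

definition lower_right :: "nat \<Rightarrow> 'n::{finite,linorder} set" where
  "lower_right r = {a. card {c. a \<le> c} \<le> r}"

definition psd_face :: "'n::finite set \<Rightarrow> 'n sqmat set" where
  "psd_face R = {X. psd X \<and> supported_on X R}"

(* M' arises from the symmetric matrix M by changing its (R,S) block, and accordingly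
   its (S,R) block *)
definition adjusts_block :: "'n::finite sqmat \<Rightarrow> 'n sqmat \<Rightarrow> 'n set \<Rightarrow> 'n set \<Rightarrow> bool" where
  "adjusts_block M M' R S \<longleftrightarrow> sym_mat M' \<and>
     (\<forall>a b. \<not> (a \<in> R \<and> b \<in> S) \<and> \<not> (a \<in> S \<and> b \<in> R) \<longrightarrow> M' $ a $ b = M $ a $ b)"


subsection \<open>Regular facial reduction sequences\<close>

definition regular_fr_structure :: "'n::finite sqmat list \<Rightarrow> 'n set list \<Rightarrow> bool" where
  "regular_fr_structure Ys Rs \<longleftrightarrow>
     length Ys = length Rs \<and>
     (\<forall>Y\<in>set Ys. sym_mat Y) \<and>
     (\<forall>i<length Rs. \<forall>j<i. Rs ! i \<inter> Rs ! j = {}) \<and>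
     (\<forall>i<length Ys. diag_pd_block (Ys ! i) (Rs ! i) \<and>
        (\<forall>a b. a \<notin> \<Union>(set (take i Rs)) \<and> b \<notin> \<Union>(set (take i Rs)) \<and>
               \<not> (a \<in> Rs ! i \<and> b \<in> Rs ! i) \<longrightarrow> Ys ! i $ a $ b = 0))"

definition regular_fr :: "'n::finite sqmat list \<Rightarrow> bool" where
  "regular_fr Ys \<longleftrightarrow> (\<exists>Rs. regular_fr_structure Ys Rs)"

definition reduced_face :: "'n::finite sqmat list \<Rightarrow> 'n sqmat set" where
  "reduced_face Ys = {X. psd X \<and> (\<forall>Y\<in>set Ys. mat_inner Y X = 0)}"


subsection \<open>Semidefinite programs\<close>

(* The equation <A,X> = b is the pair (A,b). *)
record ('n::finite) sdp =
  equations :: "('n sqmat \<times> real) list"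
  objective :: "'n sqmat"

definition is_sdp :: "'n::finite sdp \<Rightarrow> bool" where
  "is_sdp P \<longleftrightarrow> (\<forall>(A, b)\<in>set (equations P). sym_mat A) \<and> sym_mat (objective P)"

definition feasible_P :: "'n::finite sdp \<Rightarrow> 'n sqmat \<Rightarrow> bool" where
  "feasible_P P X \<longleftrightarrow> psd X \<and> (\<forall>(A, b)\<in>set (equations P). mat_inner A X = b)"

definition optimal_P :: "'n::finite sdp \<Rightarrow> 'n sqmat \<Rightarrow> bool" where
  "optimal_P P X \<longleftrightarrow> feasible_P P X \<and>
     (\<forall>X'. feasible_P P X' \<longrightarrow> mat_inner (objective P) X \<le> mat_inner (objective P) X')"

(* The linear combination, with coefficients y, of the left hand sides and of the right hand
   sides of the equations; only the values of y below the number of equations matter. *)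
definition comb_lhs :: "'n::finite sdp \<Rightarrow> (nat \<Rightarrow> real) \<Rightarrow> 'n sqmat" where
  "comb_lhs P y = (\<Sum>i<length (equations P). y i *\<^sub>R fst (equations P ! i))"

definition comb_rhs :: "'n::finite sdp \<Rightarrow> (nat \<Rightarrow> real) \<Rightarrow> real" where
  "comb_rhs P y = (\<Sum>i<length (equations P). y i * snd (equations P ! i))"

definition dual_feasible :: "'n::finite sdp \<Rightarrow> (nat \<Rightarrow> real) \<Rightarrow> bool" where
  "dual_feasible P y \<longleftrightarrow> psd (objective P - comb_lhs P y)"

definition dual_optimal :: "'n::finite sdp \<Rightarrow> (nat \<Rightarrow> real) \<Rightarrow> bool" where
  "dual_optimal P y \<longleftrightarrow> dual_feasible P y \<and>
     (\<forall>y'. dual_feasible P y' \<longrightarrow> comb_rhs P y' \<le> comb_rhs P y)"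

definition feasible_D :: "'n::finite sdp \<Rightarrow> 'n sqmat \<Rightarrow> bool" where
  "feasible_D P Z \<longleftrightarrow> (\<exists>y. dual_feasible P y \<and> Z = objective P - comb_lhs P y)"

definition optimal_D :: "'n::finite sdp \<Rightarrow> 'n sqmat \<Rightarrow> bool" where
  "optimal_D P Z \<longleftrightarrow> (\<exists>y. dual_optimal P y \<and> Z = objective P - comb_lhs P y)"

definition slater_P :: "'n::finite sdp \<Rightarrow> bool" where
  "slater_P P \<longleftrightarrow> (\<exists>X. feasible_P P X \<and> pos_def X)"

definition slater_D :: "'n::finite sdp \<Rightarrow> bool" where
  "slater_D P \<longleftrightarrow> (\<exists>Z. feasible_D P Z \<and> pos_def Z)"

definition max_rank_optimal_P :: "'n::finite sdp \<Rightarrow> 'n sqmat \<Rightarrow> bool" where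
  "max_rank_optimal_P P X \<longleftrightarrow> optimal_P P X \<and> (\<forall>X'. optimal_P P X' \<longrightarrow> rank X' \<le> rank X)"

definition max_rank_optimal_D :: "'n::finite sdp \<Rightarrow> 'n sqmat \<Rightarrow> bool" where
  "max_rank_optimal_D P Z \<longleftrightarrow> optimal_D P Z \<and> (\<forall>Z'. optimal_D P Z' \<longrightarrow> rank Z' \<le> rank Z)"

definition optimal_pair :: "'n::finite sdp \<Rightarrow> 'n sqmat \<Rightarrow> 'n sqmat \<Rightarrow> bool" where
  "optimal_pair P X Z \<longleftrightarrow> feasible_P P X \<and> feasible_D P Z \<and> mat_inner X Z = 0"

definition fails_strict_complementarity :: "'n::finite sdp \<Rightarrow> bool" where
  "fails_strict_complementarity P \<longleftrightarrow>
     (\<exists>X Z. optimal_pair P X Z \<and> max_rank_optimal_P P X \<and> max_rank_optimal_D P Z \<and>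
            rank X + rank Z < CARD('n))"

definition independent_constraints :: "'n::finite sdp \<Rightarrow> bool" where
  "independent_constraints P \<longleftrightarrow>
     distinct (map fst (equations P)) \<and> independent (set (map fst (equations P)))"


subsection \<open>Reformulations\<close>

inductive reform_step :: "'n::finite sdp \<Rightarrow> 'n sdp \<Rightarrow> bool" where
  rotate: "invertible T \<Longrightarrow>
     reform_step P \<lparr>equations = map (\<lambda>(A, b). (transpose T ** A ** T, b)) (equations P),
                    objective = transpose T ** objective P ** T\<rparr>"
| exchange: "i < length (equations P) \<Longrightarrow> j < length (equations P) \<Longrightarrow>
     reform_step P (P\<lparr>equations :=
       (equations P)[i := equations P ! j, j := equations P ! i]\<rparr>)"
| combine: "i < length (equations P) \<Longrightarrow> y i \<noteq> 0 \<Longrightarrow>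
     reform_step P (P\<lparr>equations := (equations P)[i := (comb_lhs P y, comb_rhs P y)]\<rparr>)"

definition reformulation_of :: "'n::finite sdp \<Rightarrow> 'n sdp \<Rightarrow> bool" where
  "reformulation_of P' P \<longleftrightarrow> reform_step\<^sup>*\<^sup>* P P'"


subsection \<open>The algorithm as a nondeterministic transition system\<close>

(* The entries Amat i (i in {1..m}), Ymat j (j in {1..len_Y}), Pset i (i in {0..len_A}),
   Qset j (j in {0..len_Y}), bvec i (i in {1..m}) carry the data; all others are irrelevant. *)
record ('n::finite) alg_state =
  size_r :: nat
  size_s :: nat
  len_A :: nat
  len_Y :: nat
  Xbar :: "'n sqmat"
  Zbar :: "'n sqmat"
  Xstar :: "'n sqmat"
  Zstar :: "'n sqmat"
  Amat :: "nat \<Rightarrow> 'n sqmat"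
  Ymat :: "nat \<Rightarrow> 'n sqmat"
  Pset :: "nat \<Rightarrow> 'n set"
  Qset :: "nat \<Rightarrow> 'n set"
  bvec :: "nat \<Rightarrow> real"
  Cmat :: "'n sqmat"

definition Delta_X :: "'n::finite alg_state \<Rightarrow> 'n sqmat" where
  "Delta_X \<sigma> = Xbar \<sigma> - Xstar \<sigma>"

definition Delta_Z :: "'n::finite alg_state \<Rightarrow> 'n sqmat" where
  "Delta_Z \<sigma> = Zbar \<sigma> - Zstar \<sigma>"

definition seq_A :: "'n::finite alg_state \<Rightarrow> 'n sqmat list" where
  "seq_A \<sigma> = Zstar \<sigma> # map (Amat \<sigma>) [1..<Suc (len_A \<sigma>)]"

definition seq_Y :: "'n::finite alg_state \<Rightarrow> 'n sqmat list" where
  "seq_Y \<sigma> = Xstar \<sigma> # map (Ymat \<sigma>) [1..<Suc (len_Y \<sigma>)]"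

(* Program counter: BaseEq i means that i iterations of the base equations subroutine
   have been completed. *)
datatype stage = Start | Done1 | Done2 | BaseEq nat | Done4 | Done5 | Finished

inductive alg_step ::
  "nat \<Rightarrow> stage \<times> 'n::{finite,linorder} alg_state \<Rightarrow> stage \<times> 'n alg_state \<Rightarrow> bool"
  for m :: nat
where
  step1: "\<lbrakk>0 < r; 0 < s; r + s < CARD('n);
           k \<in> {1..CARD('n) - r - s}; l \<in> {1..CARD('n) - r - s}; k < m;
           pos_def X; pos_def Z\<rbrakk> \<Longrightarrow>
     alg_step m (Start, \<sigma> :: 'n alg_state)
       (Done1, \<sigma>\<lparr>size_r := r, size_s := s, len_A := k, len_Y := l, Xbar := X, Zbar := Z\<rparr>)"
| step2: "\<lbrakk>diag_pd_block X (lower_right (size_r \<sigma>)); supported_on X (lower_right (size_r \<sigma>));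
           diag_pd_block Z (upper_left (size_s \<sigma>)); supported_on Z (upper_left (size_s \<sigma>));
           mat_inner (Xbar \<sigma> - X) (Zbar \<sigma> - Z) = 0\<rbrakk> \<Longrightarrow>
     alg_step m (Done1, \<sigma>) (Done2, \<sigma>\<lparr>Xstar := X, Zstar := Z\<rparr>)"
| step3: "\<lbrakk>\<sigma>' = \<sigma>\<lparr>Amat := A, Ymat := Y, Pset := P, Qset := Q\<rparr>;
           regular_fr_structure (seq_A \<sigma>') (map P [0..<Suc (len_A \<sigma>)]);
           \<forall>i\<in>{0..len_A \<sigma>}. P i \<noteq> {};
           reduced_face (seq_A \<sigma>') = psd_face (lower_right (size_r \<sigma>));
           regular_fr_structure (seq_Y \<sigma>') (map Q [0..<Suc (len_Y \<sigma>)]);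
           \<forall>j\<in>{0..len_Y \<sigma>}. Q j \<noteq> {};
           reduced_face (seq_Y \<sigma>') = psd_face (upper_left (size_s \<sigma>))\<rbrakk> \<Longrightarrow>
     alg_step m (Done2, \<sigma>) (BaseEq 0, \<sigma>')"
| base_equations: "\<lbrakk>i \<in> {1..len_A \<sigma>};
           adjusts_block (Amat \<sigma> i) A (Pset \<sigma> (i - 1)) (Qset \<sigma> 0);
           \<forall>j\<in>{1..len_Y \<sigma>}. adjusts_block (Ymat \<sigma> j) (Y j) (Pset \<sigma> (i - 1)) (Qset \<sigma> 0);
           \<forall>j\<in>{1..len_Y \<sigma>}. mat_inner A (Y j) = 0\<rbrakk> \<Longrightarrow>
     alg_step m (BaseEq (i - 1), \<sigma>) (BaseEq i, \<sigma>\<lparr>Amat := (Amat \<sigma>)(i := A), Ymat := Y\<rparr>)"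
| step4b: "\<lbrakk>\<forall>i\<in>{1..len_A \<sigma>}. adjusts_block (Amat \<sigma> i) (A i) (Pset \<sigma> 0) (Pset \<sigma> 0) \<and>
                             mat_inner (A i) (Delta_X \<sigma>) = 0;
            \<forall>j\<in>{1..len_Y \<sigma>}. adjusts_block (Ymat \<sigma> j) (Y j) (Qset \<sigma> 0) (Qset \<sigma> 0) \<and>
                             mat_inner (Y j) (Delta_Z \<sigma>) = 0\<rbrakk> \<Longrightarrow>
     alg_step m (BaseEq (len_A \<sigma>), \<sigma>) (Done4, \<sigma>\<lparr>Amat := A, Ymat := Y\<rparr>)"
| step5: "\<lbrakk>\<forall>i\<in>{1..len_A \<sigma>}. A i = Amat \<sigma> i;
           A (len_A \<sigma> + 1) = Delta_Z \<sigma>;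
           \<forall>i\<in>{len_A \<sigma> + 2..m}. sym_mat (A i) \<and> mat_inner (A i) (Delta_X \<sigma>) = 0 \<and>
              (\<forall>j\<in>{1..len_Y \<sigma>}. mat_inner (A i) (Ymat \<sigma> j) = 0)\<rbrakk> \<Longrightarrow>
     alg_step m (Done4, \<sigma>) (Done5, \<sigma>\<lparr>Amat := A\<rparr>)"
| step6: "\<lbrakk>\<forall>i\<in>{1..m}. b i = mat_inner (Amat \<sigma> i) (Xstar \<sigma>);
           C = Zstar \<sigma> + (\<Sum>i = 1..m. y i *\<^sub>R Amat \<sigma> i)\<rbrakk> \<Longrightarrow>
     alg_step m (Done5, \<sigma>) (Finished, \<sigma>\<lparr>bvec := b, Cmat := C\<rparr>)"

(* A partial run; the initial contents of the state are arbitrary. *)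
definition reachable :: "nat \<Rightarrow> stage \<times> 'n::{finite,linorder} alg_state \<Rightarrow> bool" where
  "reachable m c \<longleftrightarrow> (\<exists>\<sigma>0. (alg_step m)\<^sup>*\<^sup>* (Start, \<sigma>0) c)"

definition possible_output :: "nat \<Rightarrow> 'n::{finite,linorder} alg_state \<Rightarrow> bool" where
  "possible_output m \<sigma> \<longleftrightarrow> reachable m (Finished, \<sigma>)"

definition output_sdp :: "nat \<Rightarrow> 'n::{finite,linorder} alg_state \<Rightarrow> 'n sdp" where
  "output_sdp m \<sigma> =
     \<lparr>equations = map (\<lambda>i. (Amat \<sigma> i, bvec \<sigma> i)) [1..<Suc m], objective = Cmat \<sigma>\<rparr>"

end

theory Submission
  imports Defs
begin

text \<open>
  Part 1 rests on an invariant of the runs. The adjustment of the block \<open>(P\<^bsub>i-1\<^esub>, Q\<^sub>0)\<close> of the \<open>Y\<^sub>j\<close> does not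
  affect the earlier equations \<open>\<langle>A\<^sub>h, Y\<^sub>j\<rangle> = 0\<close>, \<open>h < i\<close>, because \<open>A\<^sub>h\<close> vanishes on this block; in turn any
  entry of the block can be used to enforce the new equations. Optimality and the ranks of \<open>X\<^sup>*\<close> and \<open>Z\<^sup>*\<close>
  follow because every optimal solution lies in the face cut out by the corresponding sequence.

  For part 2 a rotation makes a pair of maximum rank optimal solutions diagonal. By a theorem of the
  alternative, the combinations of the \<open>A\<^sub>i\<close> with right hand side \<open>0\<close> contain, as long as the face is larger than
  the one spanned by the optimal solutions, a matrix that is psd and nonzero on the current face;
  diagonalizing it on the current index set and iterating gives \<open>A\<^sub>1, \<dots>, A\<^sub>k\<close>. The matrices \<open>Y\<^sub>j\<close> are found in
  the same way in the orthogonal complement of \<open>Z\<^sup>*\<close> and all \<open>A\<^sub>i\<close>. Both sequences have to be regular in the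
  same coordinates: the second diagonalization therefore only uses orthogonal rotations inside the levels
  of the first structure and eliminations from lower to higher levels, as in a block Cholesky factorization.
  These preserve the first sequence once its diagonal blocks are scaled to identities. A Steinitz
  exchange finally turns \<open>A\<^sub>1, \<dots>, A\<^sub>k\<close> and \<open>\<Delta>Z\<close> into the first \<open>k + 1\<close> equations.
\<close>

section \<open>Symmetric and positive semidefinite matrices\<close>

text \<open>The two sequences of part 2 transform contragrediently: inner products survive only if
  the \<open>Y\<close> side is moved by \<open>T\<close> and the \<open>A\<close> side by the
  transposed inverse. Subtracting multiples of a row from rows of higher level on the
  \<open>Y\<close> side thus acts on the \<open>A\<close> side as a triangular matrix that keeps the
  levels \<open>\<ge> i\<close> among themselves, and these are all that regularity of
  \<open>A\<^sub>i\<close> looks at. A rotation inside a level keeps a diagonal block in general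
  only if it is a multiple of the identity; hence the scaling. Facial reduction progresses because
  the matrix found is orthogonal to a solution that is positive definite on its index set: it
  vanishes there and must be nonzero on the undecided indices. The cones involved contain more than
  optimal solutions; adding a multiple of the known solution and rescaling restores feasibility, and
  on the primal side the combinations with right hand side \<open>0\<close> make this possible. As
  reformulation steps are reversible, the output is built from the given program; the run producing
  it starts in a state that already holds the final data, so that all adjustments are
  trivial.\<close>

lemma sym_matD: "sym_mat M \<Longrightarrow> M $ a $ b = M $ b $ a"
  unfolding sym_mat_def by (metis (no_types) transpose_def vec_lambda_beta)

lemma sym_matI: "(\<And>a b. M $ a $ b = M $ b $ a) \<Longrightarrow> sym_mat M"
  unfolding sym_mat_def by (simp add: transpose_def vec_eq_iff)

lemma sym_mat_iff: "sym_mat M \<longleftrightarrow> (\<forall>a b. M $ a $ b = M $ b $ a)"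
  using sym_matD sym_matI by blast

lemma subspace_sym_mat: "subspace {M. sym_mat M}"
  unfolding subspace_def by (auto simp: sym_mat_iff)

lemmas sym_mat_intros =
  subspace_add[OF subspace_sym_mat, simplified] subspace_diff[OF subspace_sym_mat, simplified]
  subspace_scale[OF subspace_sym_mat, simplified]

lemma sym_mat_sum: "(\<And>i. i \<in> I \<Longrightarrow> sym_mat (f i)) \<Longrightarrow> sym_mat (\<Sum>i\<in>I. f i)"
  using subspace_sum[OF subspace_sym_mat, of I f] by simp

lemma inner_mat: "(S :: 'n::finite sqmat) \<bullet> T = (\<Sum>a\<in>UNIV. \<Sum>b\<in>UNIV. S $ a $ b * T $ a $ b)"
  by (simp add: inner_vec_def)

lemma mat_inner_eq_inner: "sym_mat T \<Longrightarrow> mat_inner S T = S \<bullet> T"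
  unfolding mat_inner_def trace_def matrix_matrix_mult_def inner_mat by (simp add: sym_matD)

lemma mat_inner_eq_inner': "sym_mat S \<Longrightarrow> mat_inner S T = S \<bullet> T"
  unfolding mat_inner_def trace_def matrix_matrix_mult_def inner_mat
  by (subst sum.swap) (simp add: sym_matD)

lemma axis_nth_if: "axis a (1::real) $ b = (if a = b then 1 else 0)"
  by (simp add: axis_def)

lemma axis_bilinear: "axis a 1 \<bullet> ((M :: 'n::finite sqmat) *v axis b 1) = M $ a $ b"
  by (simp add: inner_axis' matrix_vector_mult_basis column_def)

lemma sym_bilinear: "sym_mat M \<Longrightarrow> x \<bullet> (M *v y) = y \<bullet> (M *v x)"
  by (metis dot_lmul_matrix inner_commute sym_mat_def transpose_matrix_vector)

lemma quadratic_entries: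
  "x \<bullet> ((M :: 'n::finite sqmat) *v y) = (\<Sum>a\<in>UNIV. \<Sum>b\<in>UNIV. x $ a * M $ a $ b * y $ b)"
  by (simp add: inner_vec_def matrix_vector_mult_def sum_distrib_left mult.assoc)

text \<open>Semidefiniteness of the principal submatrix on \<open>F\<close>, expressed by test
  vectors supported in \<open>F\<close>; the index type stays the same while the face
  shrinks.\<close>

definition psd_on :: "'n::finite set \<Rightarrow> 'n sqmat \<Rightarrow> bool" where
  "psd_on F M \<longleftrightarrow> sym_mat M \<and> (\<forall>x. (\<forall>a. a \<notin> F \<longrightarrow> x $ a = 0) \<longrightarrow> 0 \<le> x \<bullet> (M *v x))"

lemma psd_iff_psd_on: "psd M \<longleftrightarrow> psd_on UNIV M"
  unfolding psd_def psd_on_def by simp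

lemma psd_on_mono: "psd_on F M \<Longrightarrow> G \<subseteq> F \<Longrightarrow> psd_on G M"
  unfolding psd_on_def by blast

lemma psd_on_diag: "psd_on F M \<Longrightarrow> a \<in> F \<Longrightarrow> 0 \<le> M $ a $ a"
  unfolding psd_on_def axis_bilinear[symmetric] by (force simp: axis_def)

lemma psd_on_zero_row:
  assumes M: "psd_on F M" and ab: "a \<in> F" "b \<in> F" and z: "M $ a $ a = 0"
  shows "M $ a $ b = 0"
proof (rule ccontr)
  assume nz: "M $ a $ b \<noteq> 0"
  \<comment> \<open>Since the \<open>(a, a)\<close> entry is zero, the form at
    \<open>t e\<^sub>a + e\<^sub>b\<close> is affine in \<open>t\<close>; this value makes it equal
    to \<open>-1\<close>.\<close>
  define t where "t = - (M $ b $ b + 1) / (2 * M $ a $ b)"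
  define x where "x = t *\<^sub>R axis a 1 + axis b (1::real)"
  have "\<forall>c. c \<notin> F \<longrightarrow> x $ c = 0" using ab by (auto simp: x_def axis_def)
  then have "0 \<le> x \<bullet> (M *v x)" using M unfolding psd_on_def by blast
  also have "x \<bullet> (M *v x) = 2 * t * M $ a $ b + M $ b $ b"
    using z sym_matD[of M a b] M unfolding psd_on_def x_def
    by (simp add: matrix_vector_right_distrib inner_add_left inner_add_right axis_bilinear
        matrix_vector_mult_scaleR)
  also have "\<dots> = -1" using nz by (simp add: t_def field_simps)
  finally show False by simp
qed

lemma psd_zero_row: "psd M \<Longrightarrow> M $ a $ a = 0 \<Longrightarrow> M $ a $ b = 0 \<and> M $ b $ a = 0"
  by (metis UNIV_I psd_def psd_iff_psd_on psd_on_zero_row sym_matD)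

lemma psd_diag: "psd M \<Longrightarrow> 0 \<le> M $ a $ a"
  by (simp add: psd_iff_psd_on psd_on_diag)

lemma pos_def_diag: "pos_def M \<Longrightarrow> 0 < M $ a $ a"
  unfolding pos_def_def axis_bilinear[symmetric] by simp

lemma pos_def_imp_psd: "pos_def M \<Longrightarrow> psd M"
  unfolding pos_def_def psd_def by (metis inner_zero_left less_eq_real_def)

lemma psd_add: "psd X \<Longrightarrow> psd Y \<Longrightarrow> psd (X + Y)"
  unfolding psd_def by (simp add: sym_mat_intros matrix_vector_mult_add_rdistrib inner_add_right)

lemma psd_scaleR: "psd X \<Longrightarrow> 0 \<le> c \<Longrightarrow> psd (c *\<^sub>R X)"
  unfolding psd_def by (simp add: sym_mat_intros scaleR_matrix_vector_assoc[symmetric])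

text \<open>A zero of a nonnegative quadratic form is a minimizer, so its gradient vanishes;
  otherwise the form would be affine and nonconstant along a line through \<open>y\<close> in
  direction \<open>x\<close>.\<close>

lemma psd_quadratic_zero:
  assumes "psd M" "x \<bullet> (M *v x) = 0"
  shows "M *v x = 0"
proof -
  have "y \<bullet> (M *v x) = 0" for y
  proof (rule ccontr)
    assume nz: "y \<bullet> (M *v x) \<noteq> 0"
    define t where "t = - (y \<bullet> (M *v y) + 1) / (2 * (y \<bullet> (M *v x)))"
    have "0 \<le> (t *\<^sub>R x + y) \<bullet> (M *v (t *\<^sub>R x + y))" using assms unfolding psd_def by blast
    also have "\<dots> = 2 * t * (y \<bullet> (M *v x)) + y \<bullet> (M *v y)"
      using assms(2) sym_bilinear[of M x y] assms(1) unfolding psd_def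
      by (simp add: matrix_vector_right_distrib inner_add_left inner_add_right matrix_vector_mult_scaleR)
    also have "\<dots> = -1" using nz by (simp add: t_def field_simps)
    finally show False by simp
  qed
  then show ?thesis by (metis inner_eq_zero_iff)
qed

subsection \<open>Congruence\<close>

text \<open>This is the rotation by \<open>transpose S\<close>, written so that successive
  congruences compose in the order of the matrix product.\<close>

definition congr :: "'n::finite sqmat \<Rightarrow> 'n sqmat \<Rightarrow> 'n sqmat" where
  "congr S M = S ** M ** transpose S"

lemma congr_nth: "congr S M $ a $ b = (\<Sum>c\<in>UNIV. \<Sum>d\<in>UNIV. S $ a $ c * M $ c $ d * S $ b $ d)"
  unfolding congr_def matrix_matrix_mult_def transpose_def
  by (simp add: sum_distrib_right) (subst sum.swap, simp)

lemma congr_bilinear: "x \<bullet> (congr S M *v y) = (transpose S *v x) \<bullet> (M *v (transpose S *v y))"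
  unfolding congr_def by (simp add: matrix_vector_mul_assoc[symmetric] dot_lmul_matrix)

lemma congr_congr: "congr S (congr T M) = congr (S ** T) M"
  unfolding congr_def by (simp add: matrix_transpose_mul matrix_mul_assoc)

lemma congr_one [simp]: "congr (mat 1) M = M"
  unfolding congr_def by simp

lemma linear_congr: "linear (congr S)"
  by (rule linearI)
    (simp_all add: congr_nth vec_eq_iff algebra_simps sum.distrib sum_distrib_left)

lemma sym_mat_congr: "sym_mat M \<Longrightarrow> sym_mat (congr S M)"
  unfolding sym_mat_def congr_def by (simp add: matrix_transpose_mul matrix_mul_assoc)

lemma psd_congr: "psd M \<Longrightarrow> psd (congr S M)"
  unfolding psd_def by (simp add: sym_mat_congr congr_bilinear)

text \<open>The adjoint of a congruence is the congruence with the transpose; the proof reorders a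
  fourfold sum.\<close>

lemma inner_congr: "congr S M \<bullet> X = M \<bullet> congr (transpose S) X"
proof -
  have "congr S M \<bullet> X = (\<Sum>a\<in>UNIV. \<Sum>b\<in>UNIV. \<Sum>c\<in>UNIV. \<Sum>d\<in>UNIV. S$a$c * M$c$d * S$b$d * X$a$b)"
    unfolding inner_mat congr_nth by (simp add: sum_distrib_right)
  also have "\<dots> = (\<Sum>a\<in>UNIV. \<Sum>c\<in>UNIV. \<Sum>b\<in>UNIV. \<Sum>d\<in>UNIV. S$a$c * M$c$d * S$b$d * X$a$b)"
    by (rule sum.cong[OF refl sum.swap])
  also have "\<dots> = (\<Sum>c\<in>UNIV. \<Sum>a\<in>UNIV. \<Sum>b\<in>UNIV. \<Sum>d\<in>UNIV. S$a$c * M$c$d * S$b$d * X$a$b)"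
    by (rule sum.swap)
  also have "\<dots> = (\<Sum>c\<in>UNIV. \<Sum>a\<in>UNIV. \<Sum>d\<in>UNIV. \<Sum>b\<in>UNIV. S$a$c * M$c$d * S$b$d * X$a$b)"
    by (rule sum.cong[OF refl sum.cong[OF refl sum.swap]])
  also have "\<dots> = (\<Sum>c\<in>UNIV. \<Sum>d\<in>UNIV. \<Sum>a\<in>UNIV. \<Sum>b\<in>UNIV. S$a$c * M$c$d * S$b$d * X$a$b)"
    by (rule sum.cong[OF refl sum.swap])
  also have "\<dots> = M \<bullet> congr (transpose S) X"
    unfolding inner_mat congr_nth by (simp add: transpose_def sum_distrib_left mult_ac)
  finally show ?thesis .
qed

lemma pos_def_congr:
  assumes "pos_def M" "S' ** S = mat 1"
  shows "pos_def (congr S M)"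
proof -
  have "S ** S' = mat 1" using assms(2) by (simp add: matrix_left_right_inverse)
  then have "transpose S' ** transpose S = mat 1"
    by (metis matrix_transpose_mul transpose_mat)
  then have "transpose S *v x \<noteq> 0" if "x \<noteq> 0" for x
    using that by (metis matrix_vector_mul_assoc matrix_vector_mul_lid matrix_vector_mult_0_right)
  then show ?thesis using assms(1) unfolding pos_def_def by (simp add: sym_mat_congr congr_bilinear)
qed

lemma congr_inverse: "S' ** S = mat 1 \<Longrightarrow> congr S' (congr S M) = M"
  by (simp add: congr_congr)

subsection \<open>Orthogonal diagonalization on a set of indices\<close>

text \<open>First order condition at a maximizer of the Rayleigh quotient on \<open>W\<close>: a
  move from \<open>w\<close> in an orthogonal direction \<open>v\<close> changes the form to first
  order by the mixed term, but the norm only to second order.\<close>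

lemma sphere_maximizer_orthogonal:
  fixes M :: "'n::finite sqmat"
  assumes M: "sym_mat M" and W: "subspace W" and w: "w \<in> W" "norm w = 1"
    and max: "\<And>y. y \<in> W \<Longrightarrow> norm y = 1 \<Longrightarrow> y \<bullet> (M *v y) \<le> w \<bullet> (M *v w)"
    and v: "v \<in> W" "v \<bullet> w = 0"
  shows "v \<bullet> (M *v w) = 0"
proof (rule ccontr)
  assume nz: "v \<bullet> (M *v w) \<noteq> 0"
  define \<mu> where "\<mu> = w \<bullet> (M *v w)"
  have hom: "y \<bullet> (M *v y) \<le> \<mu> * (y \<bullet> y)" if "y \<in> W" for y
  proof (cases "y = 0")
    case False
    let ?u = "(1 / norm y) *\<^sub>R y"
    have "?u \<in> W" "norm ?u = 1" using that W False by (auto simp: subspace_scale)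
    then have "?u \<bullet> (M *v ?u) \<le> \<mu>" using max \<mu>_def by blast
    then have "(y \<bullet> (M *v y)) / (norm y)\<^sup>2 \<le> \<mu>"
      by (simp add: matrix_vector_mult_scaleR power2_eq_square)
    then show ?thesis using False by (simp add: divide_le_eq power2_norm_eq_inner)
  qed simp
  let ?p = "v \<bullet> (M *v w)" and ?c = "v \<bullet> (M *v v) - \<mu> * (v \<bullet> v)"
  have q: "2 * t * ?p + t\<^sup>2 * ?c \<le> 0" for t
  proof -
    have "w + t *\<^sub>R v \<in> W" using w v W by (simp add: subspace_add subspace_scale)
    from hom[OF this] show ?thesis
      using v(2) w(2) sym_bilinear[OF M, of w v] unfolding \<mu>_def
      by (simp add: matrix_vector_right_distrib inner_add_left inner_add_right matrix_vector_mult_scaleR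
          inner_commute[of w v] norm_eq_1 algebra_simps power2_eq_square)
  qed
  \<comment> \<open>\<open>e\<close> dominates the quadratic coefficient, so that at
    \<open>t = ?p / e\<close> the linear term wins and contradicts \<open>q\<close>.\<close>
  define e where "e = \<bar>?c\<bar> + 1"
  define t where "t = ?p / e"
  have e: "0 < e" "- e \<le> ?c" by (auto simp: e_def)
  have "2 * t * ?p + t\<^sup>2 * ?c = ?p\<^sup>2 / e * (2 + ?c / e)"
    using e(1) unfolding t_def by (simp add: power2_eq_square add_divide_distrib distrib_left)
  moreover have "?c / e \<ge> -1" using e by (simp add: pos_le_divide_eq)
  then have "0 < ?p\<^sup>2 / e * (2 + ?c / e)"
    using nz e by (intro mult_pos_pos divide_pos_pos) auto
  ultimately show False using q[of t] by linarith
qed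

text \<open>Spectral theorem for the compression of \<open>M\<close> to \<open>W\<close>: split off
  a maximizer of the form on the unit sphere and continue in its orthogonal complement. The vectors
  are indexed by \<open>B\<close> because they become rows of a matrix.\<close>

lemma orthonormal_diagonalization:
  fixes M :: "'n::finite sqmat"
  assumes M: "sym_mat M" and B: "finite B" and "subspace W" "dim W = card B"
  shows "\<exists>w. (\<forall>a\<in>B. w a \<in> W \<and> norm (w a) = 1) \<and>
     (\<forall>a\<in>B. \<forall>b\<in>B. a \<noteq> b \<longrightarrow> w a \<bullet> w b = 0 \<and> w a \<bullet> (M *v w b) = 0)"
  using B assms(3,4)
proof (induction B arbitrary: W rule: finite_induct)
  case (insert c B)
  let ?S = "W \<inter> {x. norm x = 1}"
  obtain y where "y \<in> W" "y \<noteq> 0"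
  proof -
    have "\<not> W \<subseteq> {0}" using insert by (metis card_insert_disjoint dim_eq_0 nat.distinct(1))
    then show ?thesis using that by blast
  qed
  then have "(1 / norm y) *\<^sub>R y \<in> ?S" using insert.prems by (auto simp: subspace_scale)
  then have ne: "?S \<noteq> {}" by blast
  have "?S = W \<inter> sphere 0 1" by (auto simp: sphere_def dist_norm)
  then have comp: "compact ?S" using closed_Int_compact[of W "sphere 0 1"] insert.prems closed_subspace by auto
  have cont: "continuous_on ?S (\<lambda>x. x \<bullet> (M *v x))"
    by (intro continuous_intros linear_continuous_on linear_linear[THEN iffD1] matrix_vector_mul_linear)
  obtain u where u: "u \<in> ?S" "\<And>y. y \<in> ?S \<Longrightarrow> y \<bullet> (M *v y) \<le> u \<bullet> (M *v u)"
    using continuous_attains_sup[OF comp ne cont] by blast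
  have key: "v \<bullet> (M *v u) = 0" if "v \<in> W" "v \<bullet> u = 0" for v
    using sphere_maximizer_orthogonal[OF M, of W u v] u insert.prems that by auto
  let ?V = "{y \<in> W. \<forall>x\<in>span {u}. orthogonal x y}"
  have Veq: "?V = {y \<in> W. y \<bullet> u = 0}"
    by (auto simp: orthogonal_def span_singleton inner_commute)
  have "u \<noteq> 0" using u by auto
  then have "dim (span {u}) = 1" by (simp add: dim_singleton)
  moreover have "dim ?V + dim (span {u}) = dim W"
    using u insert.prems(1)
    by (intro dim_subspace_orthogonal_to_vectors subspace_span span_minimal) auto
  moreover have "dim W = Suc (card B)" using insert.prems(2) insert.hyps by simp
  ultimately have d: "dim ?V = card B" by linarith
  have sV: "subspace ?V" unfolding Veq using insert.prems(1) unfolding subspace_def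
    by (simp add: inner_add_left)
  obtain w where w: "\<forall>a\<in>B. w a \<in> ?V \<and> norm (w a) = 1"
    "\<forall>a\<in>B. \<forall>b\<in>B. a \<noteq> b \<longrightarrow> w a \<bullet> w b = 0 \<and> w a \<bullet> (M *v w b) = 0"
    using insert.IH[OF sV d] by (elim exE conjE) (rule that)
  have wb: "w b \<bullet> u = 0 \<and> u \<bullet> w b = 0 \<and> w b \<bullet> (M *v u) = 0 \<and> u \<bullet> (M *v w b) = 0" if "b \<in> B" for b
  proof -
    have "w b \<in> W \<and> w b \<bullet> u = 0" using w(1) that unfolding Veq by blast
    then show ?thesis using key[of "w b"] sym_bilinear[OF M, of u "w b"] inner_commute[of u "w b"] by simp
  qed
  show ?case
  proof (intro exI[of _ "w(c := u)"] conjI ballI impI)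
    fix a b assume "a \<in> insert c B" "b \<in> insert c B" "a \<noteq> b"
    then consider "a = c" "b \<in> B" "b \<noteq> c" | "a \<in> B" "b = c" "a \<noteq> c" | "a \<in> B" "b \<in> B" "a \<noteq> c" "b \<noteq> c" "a \<noteq> b"
      using insert.hyps(2) by blast
    then show "(w(c := u)) a \<bullet> (w(c := u)) b = 0" "(w(c := u)) a \<bullet> (M *v (w(c := u)) b) = 0"
      by (cases; use wb w(2) in simp)+
  qed (use w(1) u insert.hyps(2) in auto)
qed auto

text \<open>Such matrices mix only the indices in \<open>R\<close>; the congruence with them leaves
  the block outside \<open>R\<close> alone.\<close>

definition identity_off :: "'n::finite set \<Rightarrow> 'n sqmat \<Rightarrow> bool" where
  "identity_off R S \<longleftrightarrow> (\<forall>a b. \<not> (a \<in> R \<and> b \<in> R) \<longrightarrow> S $ a $ b = (if a = b then 1 else 0))"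

lemma dim_vectors_supported: "dim {x::real^'n. \<forall>i. i \<notin> B \<longrightarrow> x $ i = 0} = card B"
  using dim_substandard_cart[of B, where 'a=real] by (simp add: dim_vec_eq)

lemma orthogonal_matrix_diagonalizes:
  fixes M :: "'n::finite sqmat"
  assumes M: "sym_mat M"
  obtains U where "orthogonal_matrix U" "identity_off B U"
    "\<And>a b. a \<in> B \<Longrightarrow> b \<in> B \<Longrightarrow> a \<noteq> b \<Longrightarrow> congr U M $ a $ b = 0"
proof -
  let ?W = "{x::real^'n. \<forall>i. i \<notin> B \<longrightarrow> x $ i = 0}"
  have "subspace ?W" by (auto simp: subspace_def)
  then obtain w where w: "\<forall>a\<in>B. w a \<in> ?W \<and> norm (w a) = 1"
     "\<forall>a\<in>B. \<forall>b\<in>B. a \<noteq> b \<longrightarrow> w a \<bullet> w b = 0 \<and> w a \<bullet> (M *v w b) = 0"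
    using orthonormal_diagonalization[OF M _ _ dim_vectors_supported, of B] by auto
  define r where "r = (\<lambda>a. if a \<in> B then w a else axis a 1)"
  define U :: "'n sqmat" where "U = (\<chi> a. r a)"
  have r: "r a \<bullet> r b = (if a = b then 1 else 0)" for a b
    using w by (auto simp: r_def norm_eq_1 inner_axis' inner_axis axis_nth_if)
  have tU: "transpose U *v axis a 1 = r a" for a
    unfolding matrix_vector_mult_basis column_transpose by (simp add: U_def row_def vec_eq_iff)
  have "U ** transpose U = mat 1"
    unfolding matrix_mult_transpose_dot_row U_def row_def mat_def by (simp add: vec_eq_iff r)
  then have "orthogonal_matrix U" by (simp add: orthogonal_matrix_def matrix_left_right_inverse)
  moreover have "identity_off B U"
    using w(1) unfolding identity_off_def U_def r_def by (simp add: axis_nth_if)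
  moreover have "congr U M $ a $ b = 0" if "a \<in> B" "b \<in> B" "a \<noteq> b" for a b
    using that w unfolding axis_bilinear[symmetric] congr_bilinear tU r_def by auto
  ultimately show ?thesis using that by blast
qed

lemma orthogonal_matrix_inverse:
  "orthogonal_matrix U \<Longrightarrow> U ** transpose U = mat 1 \<and> transpose U ** U = mat 1"
  by (simp add: orthogonal_matrix_def)

text \<open>Once \<open>X\<close> is diagonal, only the diagonal of the rotated \<open>Z\<close>
  enters the inner product. Diagonalizing one of the two matrices is therefore enough to see its
  sign.\<close>

lemma psd_inner_via_diagonal:
  assumes X: "psd X" and Z: "psd Z"
  obtains U where "orthogonal_matrix U" "X \<bullet> Z = (\<Sum>a\<in>UNIV. congr U X $ a $ a * congr U Z $ a $ a)"
    "\<And>a b. a \<noteq> b \<Longrightarrow> congr U X $ a $ b = 0"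
proof -
  obtain U where U: "orthogonal_matrix U" "\<And>a b. a \<noteq> b \<Longrightarrow> congr U X $ a $ b = 0"
    using X orthogonal_matrix_diagonalizes[of X UNIV] unfolding psd_def by (metis UNIV_I)
  have "X = congr (transpose U) (congr U X)"
    using orthogonal_matrix_inverse[OF U(1)] by (simp add: congr_inverse)
  then have "X \<bullet> Z = congr U X \<bullet> congr U Z"
    by (metis inner_congr transpose_transpose)
  also have "\<dots> = (\<Sum>a\<in>UNIV. congr U X $ a $ a * congr U Z $ a $ a)"
    unfolding inner_mat
  proof (intro sum.cong refl)
    fix a :: 'a
    have "(\<Sum>b\<in>UNIV. congr U X $ a $ b * congr U Z $ a $ b) =
        (\<Sum>b\<in>UNIV. if b = a then congr U X $ a $ a * congr U Z $ a $ a else 0)"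
      using U(2) by (intro sum.cong) auto
    then show "(\<Sum>b\<in>UNIV. congr U X $ a $ b * congr U Z $ a $ b) = congr U X $ a $ a * congr U Z $ a $ a"
      by simp
  qed
  finally show ?thesis using that U by blast
qed

lemma psd_inner_nonneg: "psd X \<Longrightarrow> psd Z \<Longrightarrow> 0 \<le> X \<bullet> Z"
  by (rule psd_inner_via_diagonal[of X Z]) (simp_all add: psd_congr psd_diag sum_nonneg)

lemma psd_eq_zero:
  assumes "psd M" "\<And>a. M $ a $ a = 0"
  shows "M = 0"
  using psd_zero_row[OF assms] by (simp add: vec_eq_iff)

lemma pos_def_inner_pos:
  assumes "pos_def X" "psd Z" "Z \<noteq> 0"
  shows "0 < X \<bullet> Z"
proof -
  obtain U where U: "orthogonal_matrix U"
    "X \<bullet> Z = (\<Sum>a\<in>UNIV. congr U X $ a $ a * congr U Z $ a $ a)"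
    by (rule psd_inner_via_diagonal[OF pos_def_imp_psd[OF assms(1)] assms(2)]) (rule that)
  note o = orthogonal_matrix_inverse[OF U(1)]
  have p: "0 < congr U X $ a $ a" for a
    using pos_def_congr[OF assms(1)] o pos_def_diag by blast
  have "congr U Z \<noteq> 0"
    using o assms(3) congr_inverse[of "transpose U" U Z] linear_0[OF linear_congr] by metis
  then obtain a where "congr U Z $ a $ a \<noteq> 0" using psd_eq_zero[OF psd_congr[OF assms(2)]] by blast
  then have "0 < congr U Z $ a $ a" using psd_diag[OF psd_congr[OF assms(2)], of U a] by linarith
  then show ?thesis unfolding U(2)
    using p psd_diag[OF psd_congr[OF assms(2)]]
    by (intro sum_pos2[of _ a]) (auto simp: less_imp_le)
qed

section \<open>Blocks and regular facial reduction sequences\<close>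

lemma card_below_inj: "inj (\<lambda>a::'n::{finite,linorder}. card {c. c \<le> a})"
proof (rule linorder_injI)
  fix a b :: 'n assume "a < b"
  then have "{c. c \<le> a} \<subset> {c. c \<le> b}" by force
  then show "card {c. c \<le> a} \<noteq> card {c. c \<le> b}" by (metis finite psubset_card_mono less_irrefl)
qed

lemma range_card_below: "range (\<lambda>a::'n::{finite,linorder}. card {c. c \<le> a}) = {1..CARD('n)}"
proof (rule card_subset_eq)
  show "range (\<lambda>a::'n. card {c. c \<le> a}) \<subseteq> {1..CARD('n)}"
    by (auto simp: Suc_le_eq card_gt_0_iff intro!: card_mono)
  show "card (range (\<lambda>a::'n. card {c. c \<le> a})) = card {1..CARD('n)}"
    by (simp add: card_image card_below_inj)
qed simp

lemma card_below_above: "card {c. c \<le> a} + card {c. a \<le> c} = Suc CARD('n)" for a :: "'n::{finite,linorder}"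
proof -
  have "{c. c \<le> a} \<union> {c. a \<le> c} = UNIV" "{c. c \<le> a} \<inter> {c. a \<le> c} = {a}" by auto
  then show ?thesis using card_Un_Int[of "{c. c \<le> a}" "{c. a \<le> c}"] by simp
qed

lemma card_vimage_below:
  assumes "I \<subseteq> {1..CARD('n::{finite,linorder})}"
  shows "card {a::'n. card {c. c \<le> a} \<in> I} = card I"
proof -
  let ?f = "\<lambda>a::'n. card {c. c \<le> a}"
  have "?f ` (?f -` I) = I" using assms by (simp only: image_vimage_eq range_card_below Int_absorb2)
  moreover have "card (?f ` (?f -` I)) = card (?f -` I)"
    by (rule card_image[OF inj_on_subset[OF card_below_inj subset_UNIV]])
  ultimately show ?thesis by (simp add: vimage_def)
qed

lemma card_upper_left: "s \<le> CARD('n) \<Longrightarrow> card (upper_left s :: 'n::{finite,linorder} set) = s"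
proof -
  assume s: "s \<le> CARD('n)"
  have "1 \<le> card {c. c \<le> a}" for a :: 'n by (auto simp: Suc_le_eq card_gt_0_iff)
  then have "upper_left s = {a::'n. card {c. c \<le> a} \<in> {1..s}}" unfolding upper_left_def by auto
  then show ?thesis using card_vimage_below[where 'n='n, of "{1..s}"] s by simp
qed

lemma card_lower_right: "r \<le> CARD('n) \<Longrightarrow> card (lower_right r :: 'n::{finite,linorder} set) = r"
proof -
  assume r: "r \<le> CARD('n)"
  have "card {c. c \<le> a} \<le> CARD('n)" for a :: 'n by (simp add: card_mono)
  then have "lower_right r = {a::'n. card {c. c \<le> a} \<in> {Suc CARD('n) - r..CARD('n)}}"
    unfolding lower_right_def
  proof (intro Collect_cong)
    fix a :: 'n assume *: "\<And>a::'n. card {c. c \<le> a} \<le> CARD('n)"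
    show "card {c. a \<le> c} \<le> r \<longleftrightarrow> card {c. c \<le> a} \<in> {Suc CARD('n) - r..CARD('n)}"
      unfolding atLeastAtMost_iff using card_below_above[of a] *[of a] r by linarith
  qed
  moreover have "{Suc CARD('n) - r..CARD('n)} \<subseteq> {1..CARD('n)}" using r by auto
  moreover have "card {Suc CARD('n) - r..CARD('n)} = r" using r by simp
  ultimately show ?thesis using card_vimage_below[where 'n='n] by metis
qed

lemma upper_left_lower_right_disjoint:
  "r + s \<le> CARD('n) \<Longrightarrow> (upper_left s :: 'n::{finite,linorder} set) \<inter> lower_right r = {}"
  unfolding upper_left_def lower_right_def
proof (rule ccontr)
  assume rs: "r + s \<le> CARD('n)" and "\<not> {a::'n. card {c. c \<le> a} \<le> s} \<inter> {a. card {c. a \<le> c} \<le> r} = {}"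
  then obtain a :: 'n where "card {c. c \<le> a} \<le> s" "card {c. a \<le> c} \<le> r" by blast
  then show False using card_below_above[of a] rs by linarith
qed

definition diag_pos :: "'n::finite set \<Rightarrow> 'n sqmat \<Rightarrow> bool" where
  "diag_pos R X \<longleftrightarrow> (\<forall>a b. if a = b \<and> a \<in> R then 0 < X $ a $ b else X $ a $ b = 0)"

lemma diag_pd_block_iff:
  "diag_pd_block M R \<longleftrightarrow> (\<forall>a\<in>R. \<forall>b\<in>R. a \<noteq> b \<longrightarrow> M $ a $ b = 0) \<and> (\<forall>a\<in>R. 0 < M $ a $ a)"
proof (intro iffI conjI)
  assume M: "diag_pd_block M R"
  then show "\<forall>a\<in>R. \<forall>b\<in>R. a \<noteq> b \<longrightarrow> M $ a $ b = 0" unfolding diag_pd_block_def by blast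
  show "\<forall>a\<in>R. 0 < M $ a $ a"
  proof
    fix a assume "a \<in> R"
    then have "(\<forall>c. c \<notin> R \<longrightarrow> axis a (1::real) $ c = 0) \<and> axis a (1::real) \<noteq> 0"
      by (auto simp: axis_nth_if axis_eq_0_iff)
    then show "0 < M $ a $ a" using M unfolding diag_pd_block_def axis_bilinear[symmetric] by blast
  qed
next
  assume M: "(\<forall>a\<in>R. \<forall>b\<in>R. a \<noteq> b \<longrightarrow> M $ a $ b = 0) \<and> (\<forall>a\<in>R. 0 < M $ a $ a)"
  have "0 < x \<bullet> (M *v x)" if x: "\<forall>a. a \<notin> R \<longrightarrow> x $ a = 0" "x \<noteq> 0" for x
  proof -
    have "x $ a * M $ a $ b * x $ b = (if b = a then M $ a $ a * (x $ a)\<^sup>2 else 0)" for a b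
      using M x(1) by (cases "a \<in> R"; cases "b \<in> R") (auto simp: power2_eq_square)
    then have "x \<bullet> (M *v x) = (\<Sum>a\<in>UNIV. M $ a $ a * (x $ a)\<^sup>2)"
      unfolding quadratic_entries by simp
    also obtain a where a: "x $ a \<noteq> 0" using x(2) by (auto simp: vec_eq_iff)
    have "0 < (\<Sum>a\<in>UNIV. M $ a $ a * (x $ a)\<^sup>2)"
    proof (rule sum_pos2)
      show "0 < M $ a $ a * (x $ a)\<^sup>2" using a x(1) M by (intro mult_pos_pos) auto
      fix b show "0 \<le> M $ b $ b * (x $ b)\<^sup>2" using x(1) M
        by (cases "b \<in> R") (auto simp: less_imp_le)
    qed auto
    finally show ?thesis .
  qed
  then show "diag_pd_block M R" using M unfolding diag_pd_block_def by blast
qed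

lemma diag_pos_iff: "diag_pos R X \<longleftrightarrow> diag_pd_block X R \<and> supported_on X R"
proof
  assume "diag_pos R X"
  then have z: "X $ a $ b = 0" if "\<not> (a = b \<and> a \<in> R)" for a b
    using that unfolding diag_pos_def by presburger
  have p: "0 < X $ a $ a" if "a \<in> R" for a
    using \<open>diag_pos R X\<close> that unfolding diag_pos_def by presburger
  show "diag_pd_block X R \<and> supported_on X R"
    unfolding diag_pd_block_iff supported_on_def
    by (intro conjI ballI allI impI) ((rule z; blast), (rule p; blast), (rule z; blast))
next
  assume "diag_pd_block X R \<and> supported_on X R"
  then have "if a = b \<and> a \<in> R then 0 < X $ a $ b else X $ a $ b = 0" for a b
    unfolding diag_pd_block_iff supported_on_def by (cases "a \<in> R \<and> b \<in> R") auto
  then show "diag_pos R X" unfolding diag_pos_def by blast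
qed

lemma diag_pos_sym: "diag_pos R X \<Longrightarrow> sym_mat X"
  unfolding diag_pos_def sym_mat_iff by metis

lemma diag_pos_psd:
  assumes X: "diag_pos R X" shows "psd X"
proof -
  have "0 \<le> x \<bullet> (X *v x)" for x
    unfolding quadratic_entries
  proof (intro sum_nonneg)
    fix a b
    have "a = b \<or> X $ a $ b = 0" "0 \<le> X $ a $ a"
      using X unfolding diag_pos_def by (metis less_eq_real_def)+
    then show "0 \<le> x $ a * X $ a $ b * x $ b"
      by (metis mult.commute mult.left_commute mult_nonneg_nonneg mult_zero_left mult_zero_right zero_le_square order_refl)
  qed
  then show ?thesis using X diag_pos_sym unfolding psd_def by blast
qed

lemma diag_pos_indicator: "diag_pos R (\<chi> a b. if a = b \<and> a \<in> R then c else 0)" if "0 < c" for c :: real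
  using that by (simp add: diag_pos_def)

lemma rank_supported:
  fixes X :: "'n::finite sqmat"
  assumes "supported_on X R" shows "rank X \<le> card R"
proof -
  have "(X *v x) $ a = 0" if "a \<notin> R" for a x
    using assms that unfolding supported_on_def by (simp add: matrix_vector_mult_def)
  then have "range ((*v) X) \<subseteq> {x. \<forall>i. i \<notin> R \<longrightarrow> x $ i = 0}" by auto
  then have "dim (range ((*v) X)) \<le> card R"
    unfolding dim_vectors_supported[of R, symmetric] by (rule dim_subset)
  then show ?thesis by (simp add: rank_dim_range)
qed

lemma rank_diag_pos:
  fixes X :: "'n::finite sqmat"
  assumes X: "diag_pos R X" shows "rank X = card R"
proof (rule antisym)
  show "rank X \<le> card R" using X rank_supported diag_pos_iff by blast
  have "{x. \<forall>i. i \<notin> R \<longrightarrow> x $ i = 0} \<subseteq> range ((*v) X)"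
  proof
    fix x :: "real^'n" assume x: "x \<in> {x. \<forall>i. i \<notin> R \<longrightarrow> x $ i = 0}"
    have "X *v (\<chi> a. x $ a / X $ a $ a) = x"
    proof (simp add: vec_eq_iff matrix_vector_mult_def, intro allI)
      fix a
      have "(\<Sum>b\<in>UNIV. X $ a $ b * x $ b / X $ b $ b) = (\<Sum>b\<in>UNIV. if b = a then x $ a else 0)"
      proof (intro sum.cong refl)
        fix b show "X $ a $ b * x $ b / X $ b $ b = (if b = a then x $ a else 0)"
          using X x unfolding diag_pos_def by (cases "a \<in> R") (auto, metis less_irrefl)
      qed
      then show "(\<Sum>b\<in>UNIV. X $ a $ b * x $ b / X $ b $ b) = x $ a" by simp
    qed
    then show "x \<in> range ((*v) X)" by (metis rangeI)
  qed
  then have "card R \<le> dim (range ((*v) X))"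
    unfolding dim_vectors_supported[of R, symmetric] by (rule dim_subset)
  then show "card R \<le> rank X" by (simp add: rank_dim_range)
qed

lemma supported_inner_zero:
  assumes "supported_on X R" "\<And>a b. a \<in> R \<Longrightarrow> b \<in> R \<Longrightarrow> M $ a $ b = 0"
  shows "M \<bullet> X = 0"
proof -
  have "M $ a $ b * X $ a $ b = 0" for a b
    using assms unfolding supported_on_def by (metis mult_eq_0_iff)
  then show ?thesis unfolding inner_mat by (intro sum.neutral ballI)
qed

lemma psd_supported: "psd X \<Longrightarrow> (\<And>a. a \<notin> R \<Longrightarrow> X $ a $ a = 0) \<Longrightarrow> supported_on X R"
  unfolding supported_on_def using psd_zero_row by metis

text \<open>Translates the algorithm's conditions on reduced faces into statements about index sets.
  The diagonal indicator matrix of \<open>R\<close> lies in the face and detects every index of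
  \<open>R\<close>.\<close>

lemma psd_face_inj:
  assumes "psd_face R = psd_face R'" shows "R = R'"
proof -
  have "R \<subseteq> R'" if "psd_face R \<subseteq> psd_face R'" for R R' :: "'a set"
  proof
    fix a assume a: "a \<in> R"
    define D :: "'a sqmat" where "D = (\<chi> b c. if b = c \<and> b \<in> R then 1 else 0)"
    have "D \<in> psd_face R"
      using diag_pos_indicator[of 1 R] diag_pos_psd diag_pos_iff unfolding psd_face_def D_def by force
    then have "supported_on D R'" using that unfolding psd_face_def by blast
    moreover have "D $ a $ a \<noteq> 0" using a by (simp add: D_def)
    ultimately show "a \<in> R'" unfolding supported_on_def by metis
  qed
  then show ?thesis using assms by blast
qed

text \<open>Regular facial reduction sequences as families of matrices and of index sets, both indexed
  by \<open>0, \<dots>, k\<close>.\<close>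

definition rseq :: "(nat \<Rightarrow> 'n::finite sqmat) \<Rightarrow> (nat \<Rightarrow> 'n set) \<Rightarrow> nat \<Rightarrow> bool" where
  "rseq M P k \<longleftrightarrow> (\<forall>i\<le>k. sym_mat (M i)) \<and> (\<forall>i\<le>k. \<forall>j<i. P i \<inter> P j = {}) \<and>
     (\<forall>i\<le>k. \<forall>a b. (\<forall>j<i. a \<notin> P j \<and> b \<notin> P j) \<longrightarrow>
        (if a = b \<and> a \<in> P i then 0 < M i $ a $ b else M i $ a $ b = 0))"

text \<open>In \<open>rseq\<close> the positive diagonal block and the vanishing remainder are
  merged into one entrywise condition; disjointness of the sets makes this equivalent.\<close>

lemma regular_fr_structure_iff:
  "regular_fr_structure (map M [0..<Suc k]) (map P [0..<Suc k]) \<longleftrightarrow> rseq M P k"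
proof -
  have nth: "map f [0..<Suc k] ! i = f i" if "i \<le> k" for f :: "nat \<Rightarrow> 'c" and i
    using that by (metis add_0 diff_zero le_imp_less_Suc length_upt nth_map nth_upt)
  have un: "\<Union>(set (take i (map P [0..<Suc k]))) = (\<Union>j<i. P j)" if "i \<le> k" for i
    using that by (simp add: take_map del: upt_Suc) (auto simp: atLeast0LessThan)
  show ?thesis (is "?L = ?R")
  proof
    assume L: ?L
    have s: "sym_mat (M i)" if "i \<le> k" for i
      using L that unfolding regular_fr_structure_def by (auto simp del: upt_Suc)
    have d: "P i \<inter> P j = {}" if "i \<le> k" "j < i" for i j
    proof -
      have "i < length (map P [0..<Suc k])" using that by simp
      then have "map P [0..<Suc k] ! i \<inter> map P [0..<Suc k] ! j = {}"
        using L that unfolding regular_fr_structure_def by blast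
      then show ?thesis using nth[of i P] nth[of j P] that by (simp del: upt_Suc)
    qed
    have e: "diag_pd_block (M i) (P i) \<and> (\<forall>a b. a \<notin> (\<Union>j<i. P j) \<and> b \<notin> (\<Union>j<i. P j) \<and>
               \<not> (a \<in> P i \<and> b \<in> P i) \<longrightarrow> M i $ a $ b = 0)" if "i \<le> k" for i
    proof -
      have "i < length (map M [0..<Suc k])" using that by simp
      then show ?thesis using L nth[OF that, of P] nth[OF that, of M] un[OF that]
        unfolding regular_fr_structure_def by metis
    qed
    show ?R unfolding rseq_def
    proof (intro conjI allI impI)
      fix i a b assume i: "i \<le> k" and ab: "\<forall>j<i. a \<notin> P j \<and> b \<notin> P j"
      then have "a \<notin> (\<Union>j<i. P j) \<and> b \<notin> (\<Union>j<i. P j)" by auto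
      then show "if a = b \<and> a \<in> P i then 0 < M i $ a $ b else M i $ a $ b = 0"
        using e[OF i] unfolding diag_pd_block_iff by metis
    qed (use s d in auto)
  next
    assume R: ?R
    show ?L unfolding regular_fr_structure_def
    proof (intro conjI allI impI)
      fix i assume "i < length (map M [0..<Suc k])"
      then have i: "i \<le> k" by simp
      have dis: "\<forall>j<i. a \<notin> P j" if "a \<in> P i" for a using R i that unfolding rseq_def by blast
      show "diag_pd_block (map M [0..<Suc k] ! i) (map P [0..<Suc k] ! i)"
        unfolding nth[OF i] diag_pd_block_iff using R i dis unfolding rseq_def by metis
      fix a b assume "a \<notin> \<Union>(set (take i (map P [0..<Suc k]))) \<and> b \<notin> \<Union>(set (take i (map P [0..<Suc k]))) \<and>
           \<not> (a \<in> map P [0..<Suc k] ! i \<and> b \<in> map P [0..<Suc k] ! i)"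
      then have "\<forall>j<i. a \<notin> P j \<and> b \<notin> P j" "\<not> (a \<in> P i \<and> b \<in> P i)"
        unfolding un[OF i] nth[OF i] by auto
      then show "map M [0..<Suc k] ! i $ a $ b = 0"
        unfolding nth[OF i] using R i unfolding rseq_def by metis
    next
      fix i j assume "i < length (map P [0..<Suc k])" "j < i"
      then show "map P [0..<Suc k] ! i \<inter> map P [0..<Suc k] ! j = {}"
        using R nth[of i P] nth[of j P] unfolding rseq_def by (simp del: upt_Suc)
    qed (use R in \<open>auto simp: rseq_def simp del: upt_Suc\<close>)
  qed
qed

lemma rseq_zero:
  "\<lbrakk>rseq M P k; i \<le> k; \<forall>j<i. a \<notin> P j \<and> b \<notin> P j; \<not> (a = b \<and> a \<in> P i)\<rbrakk> \<Longrightarrow> M i $ a $ b = 0"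
  unfolding rseq_def by metis

lemma rseq_pos: "\<lbrakk>rseq M P k; i \<le> k; a \<in> P i\<rbrakk> \<Longrightarrow> 0 < M i $ a $ a"
  unfolding rseq_def by (metis disjoint_iff)

lemma rseq_zero_outside:
  "\<lbrakk>rseq M P k; i \<le> k; \<And>j. j \<le> k \<Longrightarrow> a \<notin> P j \<and> b \<notin> P j\<rbrakk> \<Longrightarrow> M i $ a $ b = 0"
  by (rule rseq_zero[of M P k i]) auto

text \<open>Entries in rows or columns of earlier index sets are free, so only symmetry has to be
  checked for them.\<close>

lemma rseq_adjust:
  assumes "rseq M P k" "\<And>i. i \<le> k \<Longrightarrow> sym_mat (M' i)"
    "\<And>i a b. i \<le> k \<Longrightarrow> \<forall>j<i. a \<notin> P j \<and> b \<notin> P j \<Longrightarrow> M' i $ a $ b = M i $ a $ b"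
  shows "rseq M' P k"
  using assms unfolding rseq_def by metis

text \<open>Orthogonality to \<open>M 0\<close>, \<open>M 1\<close> and so on successively kills the
  rows of \<open>X\<close> indexed by \<open>P 0\<close>, \<open>P 1\<close> and so on: once the
  earlier rows are zero, the inner product with \<open>M j\<close> is a sum of positive multiples of
  the nonnegative diagonal entries of \<open>X\<close> over \<open>P j\<close>.\<close>

lemma rseq_reduced_face:
  fixes M :: "nat \<Rightarrow> 'n::finite sqmat"
  assumes M: "rseq M P k"
  shows "reduced_face (map M [0..<Suc k]) = psd_face (- (\<Union>i\<le>k. P i))"
proof -
  have mi: "mat_inner (M i) X = M i \<bullet> X" if "i \<le> k" for i X
    using M that unfolding rseq_def by (simp add: mat_inner_eq_inner')
  have all: "(\<forall>Y\<in>set (map M [0..<Suc k]). mat_inner Y X = 0) \<longleftrightarrow> (\<forall>i\<le>k. M i \<bullet> X = 0)" for X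
    using mi by (auto simp del: upt_Suc simp: less_Suc_eq_le)
  have "supported_on X (- (\<Union>i\<le>k. P i))" if X: "psd X" and z: "\<forall>i\<le>k. M i \<bullet> X = 0" for X
  proof -
    have "\<forall>i<j. \<forall>a\<in>P i. X $ a $ a = 0" if "j \<le> Suc k" for j
      using that
    proof (induction j)
      case (Suc j)
      then have IH: "\<forall>i<j. \<forall>a\<in>P i. X $ a $ a = 0" and j: "j \<le> k" by auto
      have "M j $ a $ b * X $ a $ b = (if b = a then (if a \<in> P j then M j $ a $ a * X $ a $ a else 0) else 0)" for a b
      proof (cases "\<forall>i<j. a \<notin> P i \<and> b \<notin> P i")
        case True
        then show ?thesis using rseq_zero[OF M j True] by auto
      next
        case False
        then obtain i where i: "i < j" "a \<in> P i \<or> b \<in> P i" by auto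
        then have "X $ a $ b = 0" using IH psd_zero_row[OF X] by blast
        then show ?thesis by auto
      qed
      then have "M j \<bullet> X = (\<Sum>a\<in>UNIV. if a \<in> P j then M j $ a $ a * X $ a $ a else 0)"
        unfolding inner_mat by simp
      then have sz: "(\<Sum>a\<in>UNIV. if a \<in> P j then M j $ a $ a * X $ a $ a else 0) = 0" using z j by simp
      have "X $ a $ a = 0" if "a \<in> P j" for a
      proof -
        have "\<forall>a\<in>UNIV. (if a \<in> P j then M j $ a $ a * X $ a $ a else 0) = 0"
          using sz rseq_pos[OF M j] psd_diag[OF X]
          by (subst sum_nonneg_eq_0_iff[symmetric]) (auto simp: less_imp_le)
        then show ?thesis using that rseq_pos[OF M j that] by (metis UNIV_I mult_eq_0_iff less_irrefl)
      qed
      then show ?case using IH by (auto simp: less_Suc_eq)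
    qed simp
    then have "X $ a $ a = 0" if "a \<in> (\<Union>i\<le>k. P i)" for a using that by (auto simp: less_Suc_eq_le)
    then show ?thesis by (intro psd_supported[OF X]) blast
  qed
  moreover have "M i \<bullet> X = 0" if "supported_on X (- (\<Union>i\<le>k. P i))" "i \<le> k" for i X
    by (rule supported_inner_zero[OF that(1)], rule rseq_zero_outside[OF M that(2)]) auto
  ultimately show ?thesis unfolding reduced_face_def psd_face_def all by (intro Collect_cong) metis
qed

section \<open>Duality\<close>

lemma is_sdp_nth: "is_sdp P \<Longrightarrow> i < length (equations P) \<Longrightarrow> sym_mat (fst (equations P ! i))"
  unfolding is_sdp_def using nth_mem by fastforce

lemma sym_comb_lhs: "is_sdp P \<Longrightarrow> sym_mat (comb_lhs P y)"
  unfolding comb_lhs_def by (intro sym_mat_sum sym_mat_intros) (auto simp: is_sdp_nth)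

lemma feasible_P_iff:
  assumes "is_sdp P"
  shows "feasible_P P X \<longleftrightarrow> psd X \<and> (\<forall>i<length (equations P). fst (equations P ! i) \<bullet> X = snd (equations P ! i))"
proof -
  have "mat_inner (fst (equations P ! i)) X = fst (equations P ! i) \<bullet> X" if "i < length (equations P)" for i
    using that assms by (simp add: mat_inner_eq_inner' is_sdp_nth)
  then show ?thesis unfolding feasible_P_def by (auto simp: all_set_conv_all_nth split_beta)
qed

lemma comb_inner_feasible:
  assumes "is_sdp P" "feasible_P P X"
  shows "comb_lhs P y \<bullet> X = comb_rhs P y"
  using assms(2) unfolding feasible_P_iff[OF assms(1)] comb_lhs_def comb_rhs_def
  by (simp add: inner_sum_left)

lemma mat_inner_psd: "psd X \<Longrightarrow> mat_inner S X = S \<bullet> X"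
  by (simp add: psd_def mat_inner_eq_inner)

text \<open>For a feasible pair with zero inner product the duality gap is zero, so both members are
  optimal; any other feasible point is optimal exactly if it closes the gap with the opposite
  member.\<close>

lemma
  assumes P: "is_sdp P" and X: "feasible_P P X" and Z: "dual_feasible P y" "Z = objective P - comb_lhs P y"
    and XZ: "X \<bullet> Z = 0"
  shows optimal_P_iff: "optimal_P P X' \<longleftrightarrow> feasible_P P X' \<and> X' \<bullet> Z = 0"
    and optimal_D_iff: "optimal_D P Z' \<longleftrightarrow> feasible_D P Z' \<and> X \<bullet> Z' = 0"
proof -
  have pX: "psd X'" if "feasible_P P X'" for X' using that unfolding feasible_P_def by blast
  have gap: "objective P \<bullet> X' = comb_rhs P y' + X' \<bullet> (objective P - comb_lhs P y')" if "feasible_P P X'" for X' y'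
    using comb_inner_feasible[OF P that, of y'] by (simp add: inner_diff_right inner_commute)
  have objX: "objective P \<bullet> X = comb_rhs P y" using gap[OF X, of y] XZ Z(2) by simp
  have ge: "0 \<le> X' \<bullet> (objective P - comb_lhs P y')" if "feasible_P P X'" "dual_feasible P y'" for X' y'
    using psd_inner_nonneg that unfolding feasible_P_def dual_feasible_def by blast
  have mi: "mat_inner (objective P) X' = objective P \<bullet> X'" if "feasible_P P X'" for X'
    using pX[OF that] by (simp add: mat_inner_psd)
  show "optimal_P P X' \<longleftrightarrow> feasible_P P X' \<and> X' \<bullet> Z = 0"
  proof
    assume o: "optimal_P P X'"
    then have f: "feasible_P P X'" and "objective P \<bullet> X' \<le> objective P \<bullet> X"
      unfolding optimal_P_def using mi X by auto
    then have "X' \<bullet> Z \<le> 0" using gap[OF f, of y] objX Z(2) by simp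
    then show "feasible_P P X' \<and> X' \<bullet> Z = 0" using ge[OF f Z(1)] f Z(2) by simp
  next
    assume f: "feasible_P P X' \<and> X' \<bullet> Z = 0"
    have "objective P \<bullet> X' \<le> objective P \<bullet> X''" if "feasible_P P X''" for X''
      using gap[of X' y] gap[OF that, of y] ge[OF that Z(1)] f Z(2) by simp
    then show "optimal_P P X'" unfolding optimal_P_def using f mi by auto
  qed
  show "optimal_D P Z' \<longleftrightarrow> feasible_D P Z' \<and> X \<bullet> Z' = 0"
  proof
    assume "optimal_D P Z'"
    then obtain y' where y': "dual_optimal P y'" "Z' = objective P - comb_lhs P y'"
      unfolding optimal_D_def by blast
    then have f: "dual_feasible P y'" and "comb_rhs P y \<le> comb_rhs P y'"
      using Z(1) unfolding dual_optimal_def by auto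
    then have "X \<bullet> Z' \<le> 0" using gap[OF X, of y'] objX y'(2) by simp
    then show "feasible_D P Z' \<and> X \<bullet> Z' = 0" using ge[OF X f] f y'(2) unfolding feasible_D_def by auto
  next
    assume f: "feasible_D P Z' \<and> X \<bullet> Z' = 0"
    then obtain y' where y': "dual_feasible P y'" "Z' = objective P - comb_lhs P y'"
      unfolding feasible_D_def by blast
    have "comb_rhs P y'' \<le> comb_rhs P y'" if "dual_feasible P y''" for y''
      using gap[OF X, of y'] gap[OF X, of y''] ge[OF X that] f y'(2) by simp
    then show "optimal_D P Z'" unfolding optimal_D_def dual_optimal_def using y' by blast
  qed
qed

section \<open>Runs of the algorithm\<close>

definition Aseq :: "'n::finite alg_state \<Rightarrow> nat \<Rightarrow> 'n sqmat" where
  "Aseq \<sigma> i = (if i = 0 then Zstar \<sigma> else Amat \<sigma> i)"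

definition Yseq :: "'n::finite alg_state \<Rightarrow> nat \<Rightarrow> 'n sqmat" where
  "Yseq \<sigma> j = (if j = 0 then Xstar \<sigma> else Ymat \<sigma> j)"

lemma upt_0_Suc_Cons: "[0..<Suc k] = 0 # [1..<Suc k]"
  by (simp add: upt_conv_Cons del: upt_Suc)

lemma seq_A_eq: "seq_A \<sigma> = map (Aseq \<sigma>) [0..<Suc (len_A \<sigma>)]"
  unfolding seq_A_def upt_0_Suc_Cons by (simp add: Aseq_def del: upt_Suc)

lemma seq_Y_eq: "seq_Y \<sigma> = map (Yseq \<sigma>) [0..<Suc (len_Y \<sigma>)]"
  unfolding seq_Y_def upt_0_Suc_Cons by (simp add: Yseq_def del: upt_Suc)

definition parameters_ok :: "nat \<Rightarrow> 'n::{finite,linorder} alg_state \<Rightarrow> bool" where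
  "parameters_ok m \<sigma> \<longleftrightarrow> 0 < size_r \<sigma> \<and> 0 < size_s \<sigma> \<and> size_r \<sigma> + size_s \<sigma> < CARD('n) \<and>
     len_A \<sigma> \<in> {1..CARD('n) - size_r \<sigma> - size_s \<sigma>} \<and> len_Y \<sigma> \<in> {1..CARD('n) - size_r \<sigma> - size_s \<sigma>} \<and>
     len_A \<sigma> < m \<and> pos_def (Xbar \<sigma>) \<and> pos_def (Zbar \<sigma>)"

definition stars_ok :: "'n::{finite,linorder} alg_state \<Rightarrow> bool" where
  "stars_ok \<sigma> \<longleftrightarrow> diag_pos (lower_right (size_r \<sigma>)) (Xstar \<sigma>) \<and>
     diag_pos (upper_left (size_s \<sigma>)) (Zstar \<sigma>) \<and> Delta_X \<sigma> \<bullet> Delta_Z \<sigma> = 0"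

definition sequences_ok :: "'n::{finite,linorder} alg_state \<Rightarrow> bool" where
  "sequences_ok \<sigma> \<longleftrightarrow> rseq (Aseq \<sigma>) (Pset \<sigma>) (len_A \<sigma>) \<and> (\<forall>i\<le>len_A \<sigma>. Pset \<sigma> i \<noteq> {}) \<and>
     (\<Union>i\<le>len_A \<sigma>. Pset \<sigma> i) = - lower_right (size_r \<sigma>) \<and>
     rseq (Yseq \<sigma>) (Qset \<sigma>) (len_Y \<sigma>) \<and> (\<forall>j\<le>len_Y \<sigma>. Qset \<sigma> j \<noteq> {}) \<and>
     (\<Union>j\<le>len_Y \<sigma>. Qset \<sigma> j) = - upper_left (size_s \<sigma>)"

definition base_eqs :: "nat \<Rightarrow> 'n::finite alg_state \<Rightarrow> bool" where
  "base_eqs i \<sigma> \<longleftrightarrow> (\<forall>i'\<in>{1..i}. \<forall>j\<in>{1..len_Y \<sigma>}. Amat \<sigma> i' \<bullet> Ymat \<sigma> j = 0)"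

definition equations_ok :: "nat \<Rightarrow> 'n::finite alg_state \<Rightarrow> bool" where
  "equations_ok m \<sigma> \<longleftrightarrow> Amat \<sigma> (len_A \<sigma> + 1) = Delta_Z \<sigma> \<and>
     (\<forall>i\<in>{1..m}. sym_mat (Amat \<sigma> i) \<and> Amat \<sigma> i \<bullet> Delta_X \<sigma> = 0 \<and>
        (\<forall>j\<in>{1..len_Y \<sigma>}. Amat \<sigma> i \<bullet> Ymat \<sigma> j = 0))"

fun invariant :: "nat \<Rightarrow> stage \<times> 'n::{finite,linorder} alg_state \<Rightarrow> bool" where
  "invariant m (Start, \<sigma>) \<longleftrightarrow> True"
| "invariant m (Done1, \<sigma>) \<longleftrightarrow> parameters_ok m \<sigma>"
| "invariant m (Done2, \<sigma>) \<longleftrightarrow> parameters_ok m \<sigma> \<and> stars_ok \<sigma>"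
| "invariant m (BaseEq i, \<sigma>) \<longleftrightarrow> parameters_ok m \<sigma> \<and> stars_ok \<sigma> \<and> sequences_ok \<sigma> \<and>
     i \<le> len_A \<sigma> \<and> base_eqs i \<sigma>"
| "invariant m (Done4, \<sigma>) \<longleftrightarrow> parameters_ok m \<sigma> \<and> stars_ok \<sigma> \<and> sequences_ok \<sigma> \<and>
     base_eqs (len_A \<sigma>) \<sigma> \<and> (\<forall>i\<in>{1..len_A \<sigma>}. Amat \<sigma> i \<bullet> Delta_X \<sigma> = 0) \<and>
     (\<forall>j\<in>{1..len_Y \<sigma>}. Ymat \<sigma> j \<bullet> Delta_Z \<sigma> = 0)"
| "invariant m (Done5, \<sigma>) \<longleftrightarrow> parameters_ok m \<sigma> \<and> stars_ok \<sigma> \<and> sequences_ok \<sigma> \<and> equations_ok m \<sigma>"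
| "invariant m (Finished, \<sigma>) \<longleftrightarrow> parameters_ok m \<sigma> \<and> stars_ok \<sigma> \<and> sequences_ok \<sigma> \<and> equations_ok m \<sigma> \<and>
     (\<forall>i\<in>{1..m}. bvec \<sigma> i = Amat \<sigma> i \<bullet> Xstar \<sigma>) \<and>
     (\<exists>y. Cmat \<sigma> = Zstar \<sigma> + (\<Sum>i = 1..m. y i *\<^sub>R Amat \<sigma> i))"

lemma sym_Delta_X: "parameters_ok m \<sigma> \<Longrightarrow> stars_ok \<sigma> \<Longrightarrow> sym_mat (Delta_X \<sigma>)"
  unfolding parameters_ok_def stars_ok_def Delta_X_def pos_def_def
  by (auto intro: sym_mat_intros diag_pos_sym)

lemma sym_Delta_Z: "parameters_ok m \<sigma> \<Longrightarrow> stars_ok \<sigma> \<Longrightarrow> sym_mat (Delta_Z \<sigma>)"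
  unfolding parameters_ok_def stars_ok_def Delta_Z_def pos_def_def
  by (auto intro: sym_mat_intros diag_pos_sym)

text \<open>The first matrix of a regular sequence has no free entries, so its positive diagonal
  determines \<open>P 0\<close>. Hence the first sets of both structures are forced by
  \<open>Zstar\<close> and \<open>Xstar\<close>.\<close>

lemma rseq_first:
  assumes "rseq M P k" "diag_pos R (M 0)" shows "P 0 = R"
proof -
  have "a \<in> P 0 \<longleftrightarrow> a \<in> R" for a
  proof -
    have "if a \<in> P 0 then 0 < M 0 $ a $ a else M 0 $ a $ a = 0"
      using assms(1) unfolding rseq_def by fastforce
    moreover have "if a \<in> R then 0 < M 0 $ a $ a else M 0 $ a $ a = 0"
      using assms(2) unfolding diag_pos_def by metis
    ultimately show ?thesis by (metis less_irrefl)
  qed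
  then show ?thesis by blast
qed

lemma Pset_0: "sequences_ok \<sigma> \<Longrightarrow> stars_ok \<sigma> \<Longrightarrow> Pset \<sigma> 0 = upper_left (size_s \<sigma>)"
  unfolding sequences_ok_def stars_ok_def
  by (rule rseq_first[of "Aseq \<sigma>" _ "len_A \<sigma>"]) (simp_all add: Aseq_def)

lemma Qset_0: "sequences_ok \<sigma> \<Longrightarrow> stars_ok \<sigma> \<Longrightarrow> Qset \<sigma> 0 = lower_right (size_r \<sigma>)"
  unfolding sequences_ok_def stars_ok_def
  by (rule rseq_first[of "Yseq \<sigma>" _ "len_Y \<sigma>"]) (simp_all add: Yseq_def)

lemma Pset_Qset_0_disjoint:
  "sequences_ok \<sigma> \<Longrightarrow> stars_ok \<sigma> \<Longrightarrow> i \<le> len_A \<sigma> \<Longrightarrow> Pset \<sigma> i \<inter> Qset \<sigma> 0 = {}"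
  using Qset_0[of \<sigma>] unfolding sequences_ok_def by blast

lemma Qset_Pset_0_disjoint:
  "sequences_ok \<sigma> \<Longrightarrow> stars_ok \<sigma> \<Longrightarrow> j \<le> len_Y \<sigma> \<Longrightarrow> Qset \<sigma> j \<inter> Pset \<sigma> 0 = {}"
  using Pset_0[of \<sigma>] unfolding sequences_ok_def by blast

subsection \<open>Adjusting blocks\<close>

lemma adjusts_block_inner:
  assumes "adjusts_block Y Y' R S"
    "\<And>a b. a \<in> R \<Longrightarrow> b \<in> S \<Longrightarrow> A $ a $ b = 0 \<and> A $ b $ a = 0"
  shows "A \<bullet> Y' = A \<bullet> Y"
proof -
  have "A $ a $ b * Y' $ a $ b = A $ a $ b * Y $ a $ b" for a b
    using assms unfolding adjusts_block_def by (metis mult_zero_left)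
  then show ?thesis unfolding inner_mat by (intro sum.cong refl)
qed

lemma adjusts_block_refl: "sym_mat M \<Longrightarrow> adjusts_block M M R S"
  unfolding adjusts_block_def by simp

text \<open>The case \<open>p = q\<close> is included and gives a single diagonal entry; it serves
  the adjustments inside \<open>Pset \<sigma> 0\<close> and \<open>Qset \<sigma> 0\<close>.\<close>

definition unit_at :: "'n::finite \<Rightarrow> 'n \<Rightarrow> 'n sqmat" where
  "unit_at p q = (\<chi> a b. if (a = p \<and> b = q) \<or> (a = q \<and> b = p) then 1 else 0)"

lemma sym_unit_at: "sym_mat (unit_at p q)"
  unfolding sym_mat_iff unit_at_def by auto

lemma inner_unit_at:
  assumes "sym_mat A" "A $ p $ q \<noteq> 0"
  shows "A \<bullet> unit_at p q \<noteq> 0"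
proof -
  \<comment> \<open>\<open>A\<close> is constant on the support of the indicator, which is its own
    square; so the inner product is this entry times the squared norm of
    \<open>unit_at p q\<close>.\<close>
  have "A $ a $ b * unit_at p q $ a $ b = A $ p $ q * (unit_at p q $ a $ b * unit_at p q $ a $ b)" for a b
    using assms(1) by (auto simp: unit_at_def sym_matD)
  then have "A \<bullet> unit_at p q = A $ p $ q * (unit_at p q \<bullet> unit_at p q)"
    unfolding inner_mat sum_distrib_left by (intro sum.cong refl)
  moreover have "unit_at p q $ p $ q \<noteq> 0" by (simp add: unit_at_def)
  then have "unit_at p q \<noteq> 0" by auto
  ultimately show ?thesis using assms(2) by simp
qed

text \<open>One linear equation is met by changing a single entry, together with its mirror image,
  at a place where the coefficient matrix is nonzero.\<close>

lemma exists_adjustment: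
  assumes Y: "sym_mat Y" and pq: "p \<in> R" "q \<in> S" and A: "sym_mat A" "A $ p $ q \<noteq> 0"
  shows "\<exists>Y'. adjusts_block Y Y' R S \<and> A \<bullet> Y' = 0"
proof -
  note nz = inner_unit_at[OF A]
  define Y' where "Y' = Y - (A \<bullet> Y / (A \<bullet> unit_at p q)) *\<^sub>R unit_at p q"
  have "sym_mat Y'" unfolding Y'_def by (intro sym_mat_intros Y sym_unit_at)
  moreover have "Y' $ a $ b = Y $ a $ b" if "\<not> (a \<in> R \<and> b \<in> S) \<and> \<not> (a \<in> S \<and> b \<in> R)" for a b
    using that pq unfolding Y'_def unit_at_def by auto
  moreover have "A \<bullet> Y' = 0" using nz unfolding Y'_def by (simp add: inner_diff_right)
  ultimately show ?thesis unfolding adjusts_block_def by blast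
qed

lemma sequences_ok_sym:
  assumes "sequences_ok \<sigma>"
  shows "i \<in> {1..len_A \<sigma>} \<Longrightarrow> sym_mat (Amat \<sigma> i)" "j \<in> {1..len_Y \<sigma>} \<Longrightarrow> sym_mat (Ymat \<sigma> j)"
proof -
  assume "i \<in> {1..len_A \<sigma>}"
  then show "sym_mat (Amat \<sigma> i)" using assms unfolding sequences_ok_def rseq_def Aseq_def
    by (metis atLeastAtMost_iff not_one_le_zero)
next
  assume "j \<in> {1..len_Y \<sigma>}"
  then show "sym_mat (Ymat \<sigma> j)" using assms unfolding sequences_ok_def rseq_def Yseq_def
    by (metis atLeastAtMost_iff not_one_le_zero)
qed

lemma Amat_zero:
  assumes "sequences_ok \<sigma>" "i \<in> {1..len_A \<sigma>}" "\<And>j. j < i \<Longrightarrow> a \<notin> Pset \<sigma> j \<and> b \<notin> Pset \<sigma> j"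
    "\<not> (a = b \<and> a \<in> Pset \<sigma> i)"
  shows "Amat \<sigma> i $ a $ b = 0"
  using rseq_zero[of "Aseq \<sigma>" "Pset \<sigma>" "len_A \<sigma>" i a b] assms unfolding sequences_ok_def Aseq_def by auto

lemma Ymat_zero:
  assumes "sequences_ok \<sigma>" "i \<in> {1..len_Y \<sigma>}" "\<And>j. j < i \<Longrightarrow> a \<notin> Qset \<sigma> j \<and> b \<notin> Qset \<sigma> j"
    "\<not> (a = b \<and> a \<in> Qset \<sigma> i)"
  shows "Ymat \<sigma> i $ a $ b = 0"
  using rseq_zero[of "Yseq \<sigma>" "Qset \<sigma>" "len_Y \<sigma>" i a b] assms unfolding sequences_ok_def Yseq_def by auto

text \<open>\<open>Qset \<sigma> 0\<close> is the lower right index set, which avoids all sets of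
  the first structure. This keeps the base equations intact in step 4b and gives
  \<open>b\<^sub>i = 0\<close> for the first \<open>k\<close> equations.\<close>

lemma Amat_zero_Qset_0:
  assumes "sequences_ok \<sigma>" "stars_ok \<sigma>" "i \<in> {1..len_A \<sigma>}" "a \<in> Qset \<sigma> 0" "b \<in> Qset \<sigma> 0"
  shows "Amat \<sigma> i $ a $ b = 0"
proof -
  have "a \<notin> Pset \<sigma> j \<and> b \<notin> Pset \<sigma> j" if "j \<le> len_A \<sigma>" for j
    using Pset_Qset_0_disjoint[OF assms(1,2) that] assms by blast
  then show ?thesis using assms by (intro Amat_zero) auto
qed

lemma Ymat_zero_Pset_0:
  assumes "sequences_ok \<sigma>" "stars_ok \<sigma>" "i \<in> {1..len_Y \<sigma>}" "a \<in> Pset \<sigma> 0" "b \<in> Pset \<sigma> 0"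
  shows "Ymat \<sigma> i $ a $ b = 0"
proof -
  have "a \<notin> Qset \<sigma> j \<and> b \<notin> Qset \<sigma> j" if "j \<le> len_Y \<sigma>" for j
    using Qset_Pset_0_disjoint[OF assms(1,2) that] assms by blast
  then show ?thesis using assms by (intro Ymat_zero) auto
qed

text \<open>Every adjusted block of the \<open>i\<close>-th matrix has its rows or its columns in an
  earlier set of the same structure, where regularity leaves the entries free.\<close>

lemma sequences_ok_adjust:
  assumes s: "sequences_ok \<sigma>"
    and p: "Zstar \<sigma>' = Zstar \<sigma>" "Xstar \<sigma>' = Xstar \<sigma>" "Pset \<sigma>' = Pset \<sigma>" "Qset \<sigma>' = Qset \<sigma>"
      "len_A \<sigma>' = len_A \<sigma>" "len_Y \<sigma>' = len_Y \<sigma>" "size_r \<sigma>' = size_r \<sigma>" "size_s \<sigma>' = size_s \<sigma>"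
    and A: "\<And>i. i \<in> {1..len_A \<sigma>} \<Longrightarrow> \<exists>j<i. \<exists>S. adjusts_block (Amat \<sigma> i) (Amat \<sigma>' i) (Pset \<sigma> j) S"
    and Y: "\<And>i. i \<in> {1..len_Y \<sigma>} \<Longrightarrow> \<exists>j<i. \<exists>S. adjusts_block (Ymat \<sigma> i) (Ymat \<sigma>' i) S (Qset \<sigma> j)"
  shows "sequences_ok \<sigma>'"
proof -
  have "rseq (Aseq \<sigma>') (Pset \<sigma>) (len_A \<sigma>)"
  proof (rule rseq_adjust)
    show r: "rseq (Aseq \<sigma>) (Pset \<sigma>) (len_A \<sigma>)" using s unfolding sequences_ok_def by blast
    fix i assume i: "i \<le> len_A \<sigma>"
    show "sym_mat (Aseq \<sigma>' i)"
      using A[of i] r i p(1) unfolding Aseq_def rseq_def adjusts_block_def by (cases "i = 0") auto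
    fix a b assume ab: "\<forall>j<i. a \<notin> Pset \<sigma> j \<and> b \<notin> Pset \<sigma> j"
    show "Aseq \<sigma>' i $ a $ b = Aseq \<sigma> i $ a $ b"
      using A[of i] i ab p(1) unfolding Aseq_def adjusts_block_def by (cases "i = 0") auto
  qed
  moreover have "rseq (Yseq \<sigma>') (Qset \<sigma>) (len_Y \<sigma>)"
  proof (rule rseq_adjust)
    show r: "rseq (Yseq \<sigma>) (Qset \<sigma>) (len_Y \<sigma>)" using s unfolding sequences_ok_def by blast
    fix i assume i: "i \<le> len_Y \<sigma>"
    show "sym_mat (Yseq \<sigma>' i)"
      using Y[of i] r i p(2) unfolding Yseq_def rseq_def adjusts_block_def by (cases "i = 0") auto
    fix a b assume ab: "\<forall>j<i. a \<notin> Qset \<sigma> j \<and> b \<notin> Qset \<sigma> j"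
    show "Yseq \<sigma>' i $ a $ b = Yseq \<sigma> i $ a $ b"
      using Y[of i] i ab p(2) unfolding Yseq_def adjusts_block_def by (cases "i = 0") auto
  qed
  ultimately show ?thesis using s p unfolding sequences_ok_def by simp
qed

subsection \<open>The invariant is preserved\<close>

lemma reduced_face_union:
  assumes "rseq M P k" "reduced_face (map M [0..<Suc k]) = psd_face R"
  shows "(\<Union>i\<le>k. P i) = - R"
  using psd_face_inj[OF assms(2)[unfolded rseq_reduced_face[OF assms(1)]]] by blast

lemma alg_step_invariant:
  assumes "alg_step m c c'" "invariant m c"
  shows "invariant m c'"
  using assms
proof (induction rule: alg_step.induct)
  case (step1 r s k l X Z \<sigma>)
  then show ?case by (simp add: parameters_ok_def)
next
  case (step2 X \<sigma> Z)
  have "sym_mat (Zbar \<sigma> - Z)"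
    using step2 diag_pos_iff[of "upper_left (size_s \<sigma>)" Z] unfolding invariant.simps parameters_ok_def pos_def_def
    by (intro sym_mat_intros) (simp_all add: diag_pos_sym)
  then have "(Xbar \<sigma> - X) \<bullet> (Zbar \<sigma> - Z) = 0" using step2 by (simp add: mat_inner_eq_inner)
  then show ?case using step2
    by (simp add: parameters_ok_def stars_ok_def diag_pos_iff Delta_X_def Delta_Z_def)
next
  case (step3 \<sigma>' Q P Y A \<sigma>)
  have len: "len_A \<sigma>' = len_A \<sigma>" "len_Y \<sigma>' = len_Y \<sigma>" using step3(1) by simp_all
  have rA: "rseq (Aseq \<sigma>') P (len_A \<sigma>)" and rY: "rseq (Yseq \<sigma>') Q (len_Y \<sigma>)"
    using step3(2,5) unfolding seq_A_eq seq_Y_eq len regular_fr_structure_iff by auto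
  have "(\<Union>i\<le>len_A \<sigma>. P i) = - lower_right (size_r \<sigma>)"
    using reduced_face_union[OF rA] step3(4) unfolding seq_A_eq len by blast
  moreover have "(\<Union>i\<le>len_Y \<sigma>. Q i) = - upper_left (size_s \<sigma>)"
    using reduced_face_union[OF rY] step3(7) unfolding seq_Y_eq len by blast
  ultimately have "sequences_ok \<sigma>'"
    using rA rY step3(1,3,6) by (simp add: sequences_ok_def)
  moreover have "parameters_ok m \<sigma>' \<and> stars_ok \<sigma>'"
    using step3 by (simp add: parameters_ok_def stars_ok_def Delta_X_def Delta_Z_def)
  ultimately show ?case by (simp add: base_eqs_def)
next
  case (base_equations i \<sigma> A Y)
  let ?\<sigma>' = "\<sigma>\<lparr>Amat := (Amat \<sigma>)(i := A), Ymat := Y\<rparr>"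
  from base_equations have so: "sequences_ok \<sigma>" "stars_ok \<sigma>" and i: "i \<in> {1..len_A \<sigma>}"
    and old: "base_eqs (i - 1) \<sigma>" and pm: "parameters_ok m \<sigma>" by auto
  have i1: "i - 1 < i" using i by simp
  have "sequences_ok ?\<sigma>'"
  proof (rule sequences_ok_adjust[OF so(1)])
    fix i' assume i': "i' \<in> {1..len_A \<sigma>}"
    show "\<exists>j<i'. \<exists>S. adjusts_block (Amat \<sigma> i') (Amat ?\<sigma>' i') (Pset \<sigma> j) S"
    proof (cases "i' = i")
      case True
      then show ?thesis using base_equations(2) i1 by auto
    next
      case False
      then show ?thesis using i' adjusts_block_refl sequences_ok_sym(1)[OF so(1) i']
        by (intro exI[of _ 0]) auto
    qed
  next
    fix j assume "j \<in> {1..len_Y \<sigma>}"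
    then show "\<exists>i'<j. \<exists>S. adjusts_block (Ymat \<sigma> j) (Ymat ?\<sigma>' j) S (Qset \<sigma> i')"
      using base_equations(3) by (intro exI[of _ 0]) auto
  qed simp_all
  moreover have "Amat ?\<sigma>' i' \<bullet> Ymat ?\<sigma>' j = 0" if i': "i' \<in> {1..i}" and j: "j \<in> {1..len_Y \<sigma>}" for i' j
  proof (cases "i' = i")
    case True
    have "sym_mat (Y j)" using base_equations(3) j unfolding adjusts_block_def by blast
    then show ?thesis using bspec[OF base_equations(4) j] True by (simp add: mat_inner_eq_inner)
  next
    case False
    then have i'': "i' \<in> {1..len_A \<sigma>}" "i' \<in> {1..i - 1}" using i' i by auto
    have "Amat \<sigma> i' \<bullet> Y j = Amat \<sigma> i' \<bullet> Ymat \<sigma> j"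
    proof (rule adjusts_block_inner)
      show "adjusts_block (Ymat \<sigma> j) (Y j) (Pset \<sigma> (i - 1)) (Qset \<sigma> 0)" using base_equations(3) j by blast
      fix a b assume a: "a \<in> Pset \<sigma> (i - 1)" and b: "b \<in> Qset \<sigma> 0"
      have "a \<notin> Pset \<sigma> l" if "l < i'" for l
      proof -
        have "Pset \<sigma> (i - 1) \<inter> Pset \<sigma> l = {}"
        proof -
          have "i - 1 \<le> len_A \<sigma>" "l < i - 1" using i i'' that by auto
          then show ?thesis using so(1) unfolding sequences_ok_def rseq_def by metis
        qed
        then show ?thesis using a by blast
      qed
      moreover have "b \<notin> Pset \<sigma> l" if "l \<le> len_A \<sigma>" for l
        using Pset_Qset_0_disjoint[OF so that] b by blast
      \<comment> \<open>If \<open>i' = i - 1\<close>, then \<open>a\<close> lies in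
        \<open>Pset \<sigma> i'\<close> itself, where the diagonal entry is positive;
        \<open>a \<noteq> b\<close> excludes this case.\<close>
      moreover have "i - 1 \<le> len_A \<sigma>" using i by auto
      then have "a \<noteq> b" using Pset_Qset_0_disjoint[OF so] a b by blast
      ultimately show "Amat \<sigma> i' $ a $ b = 0 \<and> Amat \<sigma> i' $ b $ a = 0"
        using i'' by (intro conjI Amat_zero[OF so(1)]) auto
    qed
    also have "\<dots> = 0" using old i'' j unfolding base_eqs_def by blast
    finally show ?thesis using False by simp
  qed
  moreover have "parameters_ok m ?\<sigma>'" "stars_ok ?\<sigma>'"
    using pm so(2) by (simp_all add: parameters_ok_def stars_ok_def Delta_X_def Delta_Z_def)
  ultimately show ?case using i by (simp add: base_eqs_def)
next
  case (step4b \<sigma> A Y)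
  let ?\<sigma>' = "\<sigma>\<lparr>Amat := A, Ymat := Y\<rparr>"
  from step4b have so: "sequences_ok \<sigma>" "stars_ok \<sigma>"
    and old: "base_eqs (len_A \<sigma>) \<sigma>" and pm: "parameters_ok m \<sigma>" by auto
  have sX: "sym_mat (Delta_X \<sigma>)" and sZ: "sym_mat (Delta_Z \<sigma>)"
    using sym_Delta_X sym_Delta_Z pm so(2) by blast+
  have so': "sequences_ok ?\<sigma>'"
  proof (rule sequences_ok_adjust[OF so(1)])
    fix i' assume i': "i' \<in> {1..len_A \<sigma>}"
    then show "\<exists>j<i'. \<exists>S. adjusts_block (Amat \<sigma> i') (Amat ?\<sigma>' i') (Pset \<sigma> j) S"
      using step4b(1) by (intro exI[of _ 0]) auto
  next
    fix j assume "j \<in> {1..len_Y \<sigma>}"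
    then show "\<exists>i'<j. \<exists>S. adjusts_block (Ymat \<sigma> j) (Ymat ?\<sigma>' j) S (Qset \<sigma> i')"
      using step4b(2) by (intro exI[of _ 0]) auto
  qed simp_all
  have pm': "parameters_ok m ?\<sigma>'" and st': "stars_ok ?\<sigma>'"
    using pm so(2) by (simp_all add: parameters_ok_def stars_ok_def Delta_X_def Delta_Z_def)
  have "A i \<bullet> Y j = 0" if i: "i \<in> {1..len_A \<sigma>}" and j: "j \<in> {1..len_Y \<sigma>}" for i j
  proof -
    \<comment> \<open>The changes are undone one at a time: first that of \<open>Y j\<close>, as the
      new \<open>A i\<close> vanishes on the block of \<open>Qset \<sigma> 0\<close>, then that of
      \<open>A i\<close>, as the old \<open>Ymat \<sigma> j\<close> vanishes on the block of
      \<open>Pset \<sigma> 0\<close>.\<close>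
    have "A i \<bullet> Y j = A i \<bullet> Ymat \<sigma> j"
      using Amat_zero_Qset_0[OF so' st'] i j step4b(2) by (intro adjusts_block_inner) auto
    also have "\<dots> = Ymat \<sigma> j \<bullet> A i" by (rule inner_commute)
    also have "\<dots> = Ymat \<sigma> j \<bullet> Amat \<sigma> i"
      using Ymat_zero_Pset_0[OF so] i j step4b(1) by (intro adjusts_block_inner) auto
    also have "\<dots> = 0" using old i j unfolding base_eqs_def by (simp add: inner_commute)
    finally show ?thesis .
  qed
  then show ?case using so' pm' st' step4b(1,2) sX sZ
    by (simp add: base_eqs_def mat_inner_eq_inner Delta_X_def Delta_Z_def)
next
  case (step5 \<sigma> A)
  let ?\<sigma>' = "\<sigma>\<lparr>Amat := A\<rparr>"
  from step5 have so: "sequences_ok \<sigma>" "stars_ok \<sigma>"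
    and old: "base_eqs (len_A \<sigma>) \<sigma>" and pm: "parameters_ok m \<sigma>"
    and AX: "\<And>i. i \<in> {1..len_A \<sigma>} \<Longrightarrow> Amat \<sigma> i \<bullet> Delta_X \<sigma> = 0"
    and YZ: "\<And>j. j \<in> {1..len_Y \<sigma>} \<Longrightarrow> Ymat \<sigma> j \<bullet> Delta_Z \<sigma> = 0" by auto
  have sX: "sym_mat (Delta_X \<sigma>)" and sZ: "sym_mat (Delta_Z \<sigma>)"
    using sym_Delta_X sym_Delta_Z pm so(2) by blast+
  have so': "sequences_ok ?\<sigma>'"
  proof (rule sequences_ok_adjust[OF so(1)])
    fix i' assume i': "i' \<in> {1..len_A \<sigma>}"
    then show "\<exists>j<i'. \<exists>S. adjusts_block (Amat \<sigma> i') (Amat ?\<sigma>' i') (Pset \<sigma> j) S"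
      using step5(1) adjusts_block_refl[OF sequences_ok_sym(1)[OF so(1) i']]
      by (intro exI[of _ 0] conjI exI[of _ "{}"]) auto
  next
    fix j assume j: "j \<in> {1..len_Y \<sigma>}"
    then show "\<exists>i'<j. \<exists>S. adjusts_block (Ymat \<sigma> j) (Ymat ?\<sigma>' j) S (Qset \<sigma> i')"
      using adjusts_block_refl sequences_ok_sym(2)[OF so(1) j] by (intro exI[of _ 0]) auto
  qed simp_all
  have pm': "parameters_ok m ?\<sigma>'" and st': "stars_ok ?\<sigma>'"
    using pm so(2) by (simp_all add: parameters_ok_def stars_ok_def Delta_X_def Delta_Z_def)
  have "sym_mat (A i) \<and> A i \<bullet> Delta_X \<sigma> = 0 \<and> (\<forall>j\<in>{1..len_Y \<sigma>}. A i \<bullet> Ymat \<sigma> j = 0)" if i: "i \<in> {1..m}" for i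
  proof -
    consider "i \<in> {1..len_A \<sigma>}" | "i = len_A \<sigma> + 1" | "i \<in> {len_A \<sigma> + 2..m}" using i by fastforce
    then show ?thesis
    proof cases
      case 1
      then show ?thesis using AX old step5(1) sequences_ok_sym(1)[OF so(1)] unfolding base_eqs_def by auto
    next
      case 2
      then show ?thesis using sZ YZ step5(2) so(2) unfolding stars_ok_def by (simp add: inner_commute)
    next
      case 3
      have "sym_mat (A i)" and "mat_inner (A i) (Delta_X \<sigma>) = 0"
        and "\<forall>j\<in>{1..len_Y \<sigma>}. mat_inner (A i) (Ymat \<sigma> j) = 0"
        using bspec[OF step5(3) 3] by blast+
      then show ?thesis by (simp add: mat_inner_eq_inner')
    qed
  qed
  then show ?case using so' pm' st' step5(2)
    by (simp add: equations_ok_def Delta_X_def Delta_Z_def)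
next
  case (step6 b \<sigma> C y)
  have "sym_mat (Xstar \<sigma>)" using step6(3) diag_pos_sym unfolding invariant.simps stars_ok_def by blast
  then have b: "\<forall>i\<in>{1..m}. b i = Amat \<sigma> i \<bullet> Xstar \<sigma>" using step6(1) by (simp add: mat_inner_eq_inner)
  let ?\<sigma>' = "\<sigma>\<lparr>bvec := b, Cmat := C\<rparr>"
  have "Aseq ?\<sigma>' = Aseq \<sigma>" "Yseq ?\<sigma>' = Yseq \<sigma>" by (simp_all add: Aseq_def Yseq_def fun_eq_iff)
  then show ?case using step6 b
    by (auto simp: parameters_ok_def stars_ok_def sequences_ok_def equations_ok_def Delta_X_def Delta_Z_def)
qed

lemma reachable_invariant:
  assumes "reachable m c" shows "invariant m c"
proof -
  obtain \<sigma>0 where "(alg_step m)\<^sup>*\<^sup>* (Start, \<sigma>0) c" using assms unfolding reachable_def by blast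
  then show ?thesis
    by (induction rule: rtranclp_induct) (auto intro: alg_step_invariant)
qed

subsection \<open>Progress and termination\<close>

definition level_diag :: "('n::finite \<Rightarrow> nat) \<Rightarrow> nat \<Rightarrow> 'n sqmat" where
  "level_diag q i = (\<chi> a b. if a = b \<and> q a = i then 1 else 0)"

text \<open>A structure is encoded by a level function with the index sets as its fibres;
  \<open>i \<le> q a\<close> says that \<open>a\<close> is in none of the first \<open>i\<close>
  sets.\<close>

definition level_normal :: "('n::finite \<Rightarrow> nat) \<Rightarrow> nat \<Rightarrow> 'n sqmat \<Rightarrow> bool" where
  "level_normal q i M \<longleftrightarrow> (\<forall>a b. i \<le> q a \<and> i \<le> q b \<longrightarrow>
     (if a = b \<and> q a = i then 0 < M $ a $ b else M $ a $ b = 0))"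

lemma level_normal_level_diag: "level_normal q i (level_diag q i)"
  unfolding level_normal_def level_diag_def by auto

lemma rseq_levels:
  assumes "\<And>i. i \<le> k \<Longrightarrow> sym_mat (M i)" "\<And>i. i \<le> k \<Longrightarrow> level_normal q i (M i)"
  shows "rseq M (\<lambda>i. {a. q a = i}) k"
proof -
  have "i \<le> q a" if "\<forall>j<i. a \<notin> {a. q a = j}" for i a using that by (metis mem_Collect_eq not_less)
  then show ?thesis using assms unfolding rseq_def level_normal_def by auto
qed

lemma level_normal_diag_pos: "diag_pos {a. q a = 0} M \<Longrightarrow> level_normal q 0 M"
  unfolding level_normal_def diag_pos_def by simp

lemma step3_levels:
  fixes \<sigma> :: "'n::{finite,linorder} alg_state"
  assumes st: "stars_ok \<sigma>"
    and p: "\<And>a. p a = 0 \<longleftrightarrow> a \<in> upper_left (size_s \<sigma>)" "\<And>a. p a = Suc (len_A \<sigma>) \<longleftrightarrow> a \<in> lower_right (size_r \<sigma>)"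
      "\<And>a. p a \<le> Suc (len_A \<sigma>)" "\<And>i. i \<le> len_A \<sigma> \<Longrightarrow> \<exists>a. p a = i"
    and q: "\<And>a. q a = 0 \<longleftrightarrow> a \<in> lower_right (size_r \<sigma>)" "\<And>a. q a = Suc (len_Y \<sigma>) \<longleftrightarrow> a \<in> upper_left (size_s \<sigma>)"
      "\<And>a. q a \<le> Suc (len_Y \<sigma>)" "\<And>i. i \<le> len_Y \<sigma> \<Longrightarrow> \<exists>a. q a = i"
    and A: "\<And>i. i \<in> {1..len_A \<sigma>} \<Longrightarrow> sym_mat (A i) \<and> level_normal p i (A i)"
    and Y: "\<And>i. i \<in> {1..len_Y \<sigma>} \<Longrightarrow> sym_mat (Y i) \<and> level_normal q i (Y i)"
  shows "alg_step m (Done2, \<sigma>)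
    (BaseEq 0, \<sigma>\<lparr>Amat := A, Ymat := Y, Pset := (\<lambda>i. {a. p a = i}), Qset := (\<lambda>i. {a. q a = i})\<rparr>)"
    (is "alg_step m _ (_, ?\<sigma>')")
proof (rule alg_step.step3[OF refl])
  have len: "len_A ?\<sigma>' = len_A \<sigma>" "len_Y ?\<sigma>' = len_Y \<sigma>" by simp_all
  have sX: "diag_pos {a. q a = 0} (Xstar \<sigma>)" and sZ: "diag_pos {a. p a = 0} (Zstar \<sigma>)"
    using st p(1) q(1) unfolding stars_ok_def by simp_all
  have rA: "rseq (Aseq ?\<sigma>') (\<lambda>i. {a. p a = i}) (len_A \<sigma>)"
    using A sZ by (intro rseq_levels) (auto simp: Aseq_def diag_pos_sym level_normal_diag_pos)
  have rY: "rseq (Yseq ?\<sigma>') (\<lambda>i. {a. q a = i}) (len_Y \<sigma>)"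
    using Y sX by (intro rseq_levels) (auto simp: Yseq_def diag_pos_sym level_normal_diag_pos)
  show "regular_fr_structure (seq_A ?\<sigma>') (map (\<lambda>i. {a. p a = i}) [0..<Suc (len_A \<sigma>)])"
    using rA unfolding seq_A_eq len regular_fr_structure_iff .
  show "regular_fr_structure (seq_Y ?\<sigma>') (map (\<lambda>i. {a. q a = i}) [0..<Suc (len_Y \<sigma>)])"
    using rY unfolding seq_Y_eq len regular_fr_structure_iff .
  have "a \<in> (\<Union>i\<le>len_A \<sigma>. {a. p a = i}) \<longleftrightarrow> a \<notin> lower_right (size_r \<sigma>)" for a
    using p(2,3)[of a] by auto
  then have "- (\<Union>i\<le>len_A \<sigma>. {a. p a = i}) = lower_right (size_r \<sigma>)" by blast
  then show "reduced_face (seq_A ?\<sigma>') = psd_face (lower_right (size_r \<sigma>))"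
    using rseq_reduced_face[OF rA] unfolding seq_A_eq len by simp
  have "a \<in> (\<Union>i\<le>len_Y \<sigma>. {a. q a = i}) \<longleftrightarrow> a \<notin> upper_left (size_s \<sigma>)" for a
    using q(2,3)[of a] by auto
  then have "- (\<Union>i\<le>len_Y \<sigma>. {a. q a = i}) = upper_left (size_s \<sigma>)" by blast
  then show "reduced_face (seq_Y ?\<sigma>') = psd_face (upper_left (size_s \<sigma>))"
    using rseq_reduced_face[OF rY] unfolding seq_Y_eq len by simp
qed (use p(4) q(4) in auto)

lemma exists_levels:
  assumes "finite M" "k \<in> {1..card M}" "U \<inter> L = {}" "M = - (U \<union> L)" "U \<noteq> {}" "L \<noteq> {}"
  shows "\<exists>p. (\<forall>a. p a = 0 \<longleftrightarrow> a \<in> U) \<and> (\<forall>a. p a = Suc k \<longleftrightarrow> a \<in> L) \<and> (\<forall>a. p a \<le> Suc k) \<and>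
    (\<forall>i\<le>k. \<exists>a. p a = i)"
proof -
  obtain N where N: "N \<subseteq> M" "card N = k" using assms(2) by (meson atLeastAtMost_iff obtain_subset_with_card_n)
  then have "finite N" using assms(1) finite_subset by blast
  then obtain f where f: "bij_betw f N {1..k}"
    using N(2) finite_same_card_bij[of N "{1..k}"] by auto
  \<comment> \<open>Middle indices outside \<open>N\<close> join level \<open>1\<close>, which is a
    middle level because \<open>k\<close> is positive.\<close>
  define p where "p a = (if a \<in> U then 0 else if a \<in> L then Suc k else if a \<in> N then f a else 1)" for a
  have fN: "f a \<in> {1..k}" if "a \<in> N" for a using f that by (metis bij_betwE)
  have "\<exists>a. p a = i" if "i \<le> k" for i
  proof (cases "i = 0")
    case True then show ?thesis using assms(5) unfolding p_def by auto
  next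
    case False
    then have "i \<in> f ` N" using that bij_betw_imp_surj_on[OF f] by simp
    then obtain a where "a \<in> N" "f a = i" by blast
    then show ?thesis using N(1) assms(4) unfolding p_def by (intro exI[of _ a]) auto
  qed
  moreover have "p a = 0 \<longleftrightarrow> a \<in> U" "p a = Suc k \<longleftrightarrow> a \<in> L" "p a \<le> Suc k" for a
    using fN[of a] assms(2,3) unfolding p_def by auto
  ultimately show ?thesis by blast
qed

lemma exists_step2:
  fixes \<sigma> :: "'n::{finite,linorder} alg_state"
  assumes pm: "parameters_ok m \<sigma>"
  shows "\<exists>c'. alg_step m (Done1, \<sigma>) c'"
proof -
  let ?L = "lower_right (size_r \<sigma>) :: 'n set" and ?U = "upper_left (size_s \<sigma>) :: 'n set"
  have le: "size_r \<sigma> \<le> CARD('n)" "size_s \<sigma> \<le> CARD('n)" "size_r \<sigma> + size_s \<sigma> \<le> CARD('n)"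
    and pos: "0 < size_r \<sigma>" "0 < size_s \<sigma>" and pd: "pos_def (Xbar \<sigma>)" "pos_def (Zbar \<sigma>)"
    using pm unfolding parameters_ok_def by auto
  have ne: "?L \<noteq> {}" "?U \<noteq> {}"
    using card_lower_right[OF le(1)] card_upper_left[OF le(2)] pos by (metis card.empty less_irrefl)+
  define D :: "'n set \<Rightarrow> 'n sqmat" where "D R = (\<chi> a b. if a = b \<and> a \<in> R then 1 else 0)" for R
  have D: "diag_pos R (c *\<^sub>R D R)" if "0 < c" for R c
    using that by (simp add: diag_pos_def D_def)
  have D1: "diag_pos R (D R)" for R using D[of 1 R] by simp
  have nz: "D R \<noteq> 0" if "R \<noteq> {}" for R
    using that by (auto simp: vec_eq_iff D_def)
  have x: "0 < Xbar \<sigma> \<bullet> D ?U" and z: "0 < Zbar \<sigma> \<bullet> D ?L" and xz: "0 < Xbar \<sigma> \<bullet> Zbar \<sigma>"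
    using pos_def_inner_pos[OF pd(1) diag_pos_psd[OF D1] nz[OF ne(2)]]
      pos_def_inner_pos[OF pd(2) diag_pos_psd[OF D1] nz[OF ne(1)]]
      pos_def_inner_pos[OF pd(1) pos_def_imp_psd[OF pd(2)]] pos_def_diag[OF pd(2)] by force+
  define t where "t = Xbar \<sigma> \<bullet> Zbar \<sigma>"
  \<comment> \<open>The scalings make both mixed products equal to \<open>t / 2\<close>, and the
    product of \<open>X\<close> and \<open>Z\<close> is zero; the four terms of the expanded inner
    product then cancel.\<close>
  define X where "X = (t / (2 * (Zbar \<sigma> \<bullet> D ?L))) *\<^sub>R D ?L"
  define Z where "Z = (t / (2 * (Xbar \<sigma> \<bullet> D ?U))) *\<^sub>R D ?U"
  have dX: "diag_pos ?L X" and dZ: "diag_pos ?U Z"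
    using x z xz D unfolding X_def Z_def t_def by simp_all
  have "X \<bullet> Z = 0"
    using upper_left_lower_right_disjoint[OF le(3)] dX dZ
    by (intro supported_inner_zero[of _ ?U]) (auto simp: diag_pos_iff supported_on_def)
  moreover have "X \<bullet> Zbar \<sigma> = t / 2" "Xbar \<sigma> \<bullet> Z = t / 2"
    using x z unfolding X_def Z_def by (simp_all add: inner_commute)
  ultimately have "(Xbar \<sigma> - X) \<bullet> (Zbar \<sigma> - Z) = 0"
    by (simp add: inner_diff_left inner_diff_right t_def)
  moreover have "sym_mat (Zbar \<sigma> - Z)"
    using pd(2) diag_pos_sym[OF dZ] unfolding pos_def_def by (intro sym_mat_intros) simp_all
  ultimately have "mat_inner (Xbar \<sigma> - X) (Zbar \<sigma> - Z) = 0" by (simp add: mat_inner_eq_inner)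
  then show ?thesis using alg_step.step2[of X \<sigma> Z m] dX dZ unfolding diag_pos_iff by blast
qed

lemma exists_step3:
  fixes \<sigma> :: "'n::{finite,linorder} alg_state"
  assumes pm: "parameters_ok m \<sigma>" and st: "stars_ok \<sigma>"
  shows "\<exists>c'. alg_step m (Done2, \<sigma>) c'"
proof -
  let ?L = "lower_right (size_r \<sigma>) :: 'n set" and ?U = "upper_left (size_s \<sigma>) :: 'n set"
  let ?M = "- (?U \<union> ?L)"
  have le: "size_r \<sigma> \<le> CARD('n)" "size_s \<sigma> \<le> CARD('n)" "size_r \<sigma> + size_s \<sigma> \<le> CARD('n)"
    and pos: "0 < size_r \<sigma>" "0 < size_s \<sigma>"
    using pm unfolding parameters_ok_def by auto
  have ne: "?L \<noteq> {}" "?U \<noteq> {}"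
    using card_lower_right[OF le(1)] card_upper_left[OF le(2)] pos by (metis card.empty less_irrefl)+
  note dis = upper_left_lower_right_disjoint[OF le(3)]
  have "card (?U \<union> ?L) = size_s \<sigma> + size_r \<sigma>"
    using card_Un_disjoint[OF _ _ dis] card_lower_right[OF le(1)] card_upper_left[OF le(2)] by simp
  then have cM: "card ?M = CARD('n) - size_r \<sigma> - size_s \<sigma>"
    by (simp add: Compl_eq_Diff_UNIV card_Diff_subset)
  obtain p where p: "\<forall>a. p a = 0 \<longleftrightarrow> a \<in> ?U" "\<forall>a. p a = Suc (len_A \<sigma>) \<longleftrightarrow> a \<in> ?L"
    "\<forall>a. p a \<le> Suc (len_A \<sigma>)" "\<forall>i\<le>len_A \<sigma>. \<exists>a. p a = i"
    using exists_levels[of ?M "len_A \<sigma>" ?U ?L] pm dis ne unfolding cM parameters_ok_def by auto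
  obtain q where q: "\<forall>a. q a = 0 \<longleftrightarrow> a \<in> ?L" "\<forall>a. q a = Suc (len_Y \<sigma>) \<longleftrightarrow> a \<in> ?U"
    "\<forall>a. q a \<le> Suc (len_Y \<sigma>)" "\<forall>i\<le>len_Y \<sigma>. \<exists>a. q a = i"
    using exists_levels[of ?M "len_Y \<sigma>" ?L ?U] pm dis ne unfolding cM parameters_ok_def
    by (metis Int_commute Un_commute finite)
  have s: "sym_mat (level_diag q i)" for q :: "'n \<Rightarrow> nat" and i
    unfolding sym_mat_iff level_diag_def by auto
  show ?thesis
    using step3_levels[OF st, of p q "level_diag p" "level_diag q"] p q s level_normal_level_diag by blast
qed

lemma exists_base_equations:
  fixes \<sigma> :: "'n::{finite,linorder} alg_state"
  assumes so: "sequences_ok \<sigma>" "stars_ok \<sigma>" and i: "i < len_A \<sigma>"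
  shows "\<exists>c'. alg_step m (BaseEq i, \<sigma>) c'"
proof -
  have iA: "Suc i \<in> {1..len_A \<sigma>}" using i by simp
  obtain p q where pq: "p \<in> Pset \<sigma> i" "q \<in> Qset \<sigma> 0" using so(1) i unfolding sequences_ok_def by fastforce
  have sA: "sym_mat (Amat \<sigma> (Suc i))" using sequences_ok_sym(1)[OF so(1) iA] .
  \<comment> \<open>One entry of the free block is set to \<open>1\<close>, so that every
    \<open>Ymat \<sigma> j\<close> can be corrected at this same entry.\<close>
  define A where "A = (\<chi> a b. if unit_at p q $ a $ b = 1 then 1 else Amat \<sigma> (Suc i) $ a $ b)"
  have A: "sym_mat A" unfolding sym_mat_iff A_def using sA sym_unit_at[of p q] by (simp add: sym_matD)
  have Apq: "A $ p $ q \<noteq> 0" by (simp add: A_def unit_at_def)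
  have aA: "adjusts_block (Amat \<sigma> (Suc i)) A (Pset \<sigma> i) (Qset \<sigma> 0)"
    using A pq unfolding adjusts_block_def by (auto simp: A_def unit_at_def)
  have "\<forall>j\<in>{1..len_Y \<sigma>}. \<exists>Y'. adjusts_block (Ymat \<sigma> j) Y' (Pset \<sigma> i) (Qset \<sigma> 0) \<and> A \<bullet> Y' = 0"
    using exists_adjustment[OF _ pq A Apq] sequences_ok_sym(2)[OF so(1)] by blast
  then obtain Y where Y: "\<forall>j\<in>{1..len_Y \<sigma>}. adjusts_block (Ymat \<sigma> j) (Y j) (Pset \<sigma> i) (Qset \<sigma> 0) \<and> A \<bullet> Y j = 0"
    by metis
  have "alg_step m (BaseEq (Suc i - 1), \<sigma>) (BaseEq (Suc i), \<sigma>\<lparr>Amat := (Amat \<sigma>)(Suc i := A), Ymat := Y\<rparr>)"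
    using aA Y A by (intro alg_step.base_equations iA) (auto simp: mat_inner_eq_inner')
  then show ?thesis by auto
qed

lemma exists_step4b:
  fixes \<sigma> :: "'n::{finite,linorder} alg_state"
  assumes pm: "parameters_ok m \<sigma>" and so: "sequences_ok \<sigma>" "stars_ok \<sigma>"
  shows "\<exists>c'. alg_step m (BaseEq (len_A \<sigma>), \<sigma>) c'"
proof -
  obtain p q where pq: "p \<in> Pset \<sigma> 0" "q \<in> Qset \<sigma> 0" using so(1) unfolding sequences_ok_def by fastforce
  have sX: "sym_mat (Delta_X \<sigma>)" and sZ: "sym_mat (Delta_Z \<sigma>)"
    using sym_Delta_X sym_Delta_Z pm so(2) by blast+
  \<comment> \<open>At these diagonal positions the starred matrices vanish while
    \<open>Xbar\<close> and \<open>Zbar\<close> are positive, so the differences have nonzero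
    entries there.\<close>
  have "p \<notin> Qset \<sigma> 0" "q \<notin> Pset \<sigma> 0" using Pset_Qset_0_disjoint[OF so, of 0] pq by auto
  then have "Xstar \<sigma> $ p $ p = 0" "Zstar \<sigma> $ q $ q = 0"
    using so(2) Pset_0[OF so] Qset_0[OF so] unfolding stars_ok_def diag_pos_def by metis+
  then have "Delta_X \<sigma> $ p $ p \<noteq> 0" "Delta_Z \<sigma> $ q $ q \<noteq> 0"
    using pm pos_def_diag[of "Xbar \<sigma>" p] pos_def_diag[of "Zbar \<sigma>" q]
    unfolding parameters_ok_def Delta_X_def Delta_Z_def by auto
  then have "\<forall>i\<in>{1..len_A \<sigma>}. \<exists>A'. adjusts_block (Amat \<sigma> i) A' (Pset \<sigma> 0) (Pset \<sigma> 0) \<and> Delta_X \<sigma> \<bullet> A' = 0"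
    "\<forall>j\<in>{1..len_Y \<sigma>}. \<exists>Y'. adjusts_block (Ymat \<sigma> j) Y' (Qset \<sigma> 0) (Qset \<sigma> 0) \<and> Delta_Z \<sigma> \<bullet> Y' = 0"
    using exists_adjustment[OF _ pq(1) pq(1) sX] exists_adjustment[OF _ pq(2) pq(2) sZ]
      sequences_ok_sym[OF so(1)] by blast+
  then obtain A Y where
    "\<forall>i\<in>{1..len_A \<sigma>}. adjusts_block (Amat \<sigma> i) (A i) (Pset \<sigma> 0) (Pset \<sigma> 0) \<and> Delta_X \<sigma> \<bullet> A i = 0"
    "\<forall>j\<in>{1..len_Y \<sigma>}. adjusts_block (Ymat \<sigma> j) (Y j) (Qset \<sigma> 0) (Qset \<sigma> 0) \<and> Delta_Z \<sigma> \<bullet> Y j = 0"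
    by metis
  then have "alg_step m (BaseEq (len_A \<sigma>), \<sigma>) (Done4, \<sigma>\<lparr>Amat := A, Ymat := Y\<rparr>)"
    using sX sZ by (intro alg_step.step4b) (auto simp: mat_inner_eq_inner inner_commute)
  then show ?thesis by blast
qed

lemma progress:
  fixes c :: "stage \<times> 'n::{finite,linorder} alg_state"
  assumes n: "3 \<le> CARD('n)" and m: "2 \<le> m" and c: "reachable m c" "fst c \<noteq> Finished"
  shows "\<exists>c'. alg_step m c c'"
proof -
  obtain st \<sigma> where c_eq: "c = (st, \<sigma>)" by fastforce
  have inv: "invariant m (st, \<sigma>)" using reachable_invariant c(1) c_eq by blast
  show ?thesis
  proof (cases st)
    case Start
    have "pos_def (mat 1 :: 'n sqmat)" unfolding pos_def_def sym_mat_def by simp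
    \<comment> \<open>The smallest admissible choice sets all four size parameters to
      \<open>1\<close>; the bounds \<open>3 \<le> CARD('n)\<close> and \<open>2 \<le> m\<close> make
      it possible.\<close>
    moreover have "1 \<in> {1..CARD('n) - 1 - 1}" "1 + 1 < CARD('n)" "1 < m" using n m by auto
    ultimately show ?thesis
      using alg_step.step1[of 1 1 1 1 m "mat 1" "mat 1" \<sigma>] Start c_eq zero_less_one by blast
  next
    case Done1 then show ?thesis using exists_step2 inv c_eq by simp
  next
    case Done2 then show ?thesis using exists_step3[of m \<sigma>] inv c_eq by simp
  next
    case (BaseEq i)
    then show ?thesis using exists_base_equations exists_step4b inv c_eq
      by (cases "i < len_A \<sigma>") (auto simp: not_less)
  next
    case Done4
    \<comment> \<open>Zero matrices satisfy all the orthogonality requirements on the remaining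
      equations.\<close>
    define A where "A i = (if i \<le> len_A \<sigma> then Amat \<sigma> i else if i = len_A \<sigma> + 1 then Delta_Z \<sigma> else 0)" for i
    have "sym_mat (0 :: 'n sqmat)" by (simp add: sym_mat_iff)
    then show ?thesis
      using alg_step.step5[of \<sigma> A m] Done4 c_eq by (auto simp: A_def mat_inner_eq_inner')
  next
    case Done5
    then show ?thesis
      using alg_step.step6[of m "\<lambda>i. mat_inner (Amat \<sigma> i) (Xstar \<sigma>)" \<sigma> _ "\<lambda>_. 0", OF _ refl] c_eq
      by blast
  next
    case Finished then show ?thesis using c c_eq by simp
  qed
qed

text \<open>A lexicographic measure: the stages count down, and inside the subroutine the number of
  outstanding iterations does.\<close>

fun remaining :: "stage \<times> 'n::finite alg_state \<Rightarrow> nat \<times> nat" where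
  "remaining (Start, \<sigma>) = (6, 0)"
| "remaining (Done1, \<sigma>) = (5, 0)"
| "remaining (Done2, \<sigma>) = (4, 0)"
| "remaining (BaseEq i, \<sigma>) = (3, len_A \<sigma> - i)"
| "remaining (Done4, \<sigma>) = (2, 0)"
| "remaining (Done5, \<sigma>) = (1, 0)"
| "remaining (Finished, \<sigma>) = (0, 0)"

lemma alg_step_remaining:
  "alg_step m c c' \<Longrightarrow> (remaining c', remaining c) \<in> less_than <*lex*> less_than"
  by (induction rule: alg_step.induct) auto

lemma no_infinite_run:
  "\<nexists>f :: nat \<Rightarrow> stage \<times> 'n::{finite,linorder} alg_state. reachable m (f 0) \<and> (\<forall>t. alg_step m (f t) (f (Suc t)))"
proof
  assume "\<exists>f :: nat \<Rightarrow> stage \<times> 'n alg_state. reachable m (f 0) \<and> (\<forall>t. alg_step m (f t) (f (Suc t)))"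
  then obtain f :: "nat \<Rightarrow> stage \<times> 'n alg_state" where f: "\<And>t. alg_step m (f t) (f (Suc t))" by blast
  have "wf (less_than <*lex*> less_than)" by blast
  then show False
    unfolding wf_iff_no_infinite_down_chain using alg_step_remaining[OF f] by meson
qed

subsection \<open>The output\<close>

lemma output_sdp_simps:
  "length (equations (output_sdp m \<sigma>)) = m"
  "i < m \<Longrightarrow> equations (output_sdp m \<sigma>) ! i = (Amat \<sigma> (Suc i), bvec \<sigma> (Suc i))"
  "objective (output_sdp m \<sigma>) = Cmat \<sigma>"
  unfolding output_sdp_def by (simp_all del: upt_Suc)

lemma comb_lhs_output: "comb_lhs (output_sdp m \<sigma>) y = (\<Sum>i = 1..m. y (i - 1) *\<^sub>R Amat \<sigma> i)"
proof -
  have "comb_lhs (output_sdp m \<sigma>) y = (\<Sum>i<m. y (Suc i - 1) *\<^sub>R Amat \<sigma> (Suc i))"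
    unfolding comb_lhs_def output_sdp_simps(1) by (intro sum.cong refl) (simp add: output_sdp_simps)
  also have "\<dots> = (\<Sum>i = 1..m. y (i - 1) *\<^sub>R Amat \<sigma> i)"
    by (simp add: sum.atLeast1_atMost_eq)
  finally show ?thesis .
qed

lemma output_correct:
  fixes \<sigma> :: "'n::{finite,linorder} alg_state"
  assumes "possible_output m \<sigma>"
  shows "let P = output_sdp m \<sigma> in
           is_sdp P \<and>
           fails_strict_complementarity P \<and>
           max_rank_optimal_P P (Xstar \<sigma>) \<and>
           max_rank_optimal_D P (Zstar \<sigma>) \<and>
           pos_def (Xbar \<sigma>) \<and> feasible_P P (Xbar \<sigma>) \<and>
           pos_def (Zbar \<sigma>) \<and> feasible_D P (Zbar \<sigma>) \<and>
           slater_P P \<and> slater_D P \<and>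
           (\<forall>i\<in>{1..len_A \<sigma>}. bvec \<sigma> i = 0) \<and>
           regular_fr (seq_A \<sigma>) \<and>
           reduced_face (seq_A \<sigma>) = psd_face (lower_right (size_r \<sigma>)) \<and>
           (\<forall>i\<in>{1..m}. \<forall>j\<in>{1..len_Y \<sigma>}. mat_inner (Amat \<sigma> i) (Ymat \<sigma> j) = 0) \<and>
           (\<forall>j\<in>{1..len_Y \<sigma>}. mat_inner (Cmat \<sigma>) (Ymat \<sigma> j) = 0) \<and>
           regular_fr (seq_Y \<sigma>) \<and>
           reduced_face (seq_Y \<sigma>) = psd_face (upper_left (size_s \<sigma>))"
proof -
  let ?L = "lower_right (size_r \<sigma>) :: 'n set" and ?U = "upper_left (size_s \<sigma>) :: 'n set"
  let ?P = "output_sdp m \<sigma>"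
  have "invariant m (Finished, \<sigma>)" using assms reachable_invariant unfolding possible_output_def by blast
  then obtain y where pm: "parameters_ok m \<sigma>" and st: "stars_ok \<sigma>" and so: "sequences_ok \<sigma>"
    and eq: "equations_ok m \<sigma>" and b: "\<And>i. i \<in> {1..m} \<Longrightarrow> bvec \<sigma> i = Amat \<sigma> i \<bullet> Xstar \<sigma>"
    and C: "Cmat \<sigma> = Zstar \<sigma> + (\<Sum>i = 1..m. y i *\<^sub>R Amat \<sigma> i)" by auto
  have le: "size_r \<sigma> \<le> CARD('n)" "size_s \<sigma> \<le> CARD('n)" "size_r \<sigma> + size_s \<sigma> \<le> CARD('n)"
    and k: "len_A \<sigma> < m" and lt: "size_r \<sigma> + size_s \<sigma> < CARD('n)"
    and pd: "pos_def (Xbar \<sigma>)" "pos_def (Zbar \<sigma>)"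
    using pm unfolding parameters_ok_def by auto
  have X: "diag_pos ?L (Xstar \<sigma>)" and Z: "diag_pos ?U (Zstar \<sigma>)" and XZ: "Delta_X \<sigma> \<bullet> Delta_Z \<sigma> = 0"
    using st unfolding stars_ok_def by auto
  have symA: "sym_mat (Amat \<sigma> i)" and AX: "Amat \<sigma> i \<bullet> Delta_X \<sigma> = 0"
    and AY: "\<And>j. j \<in> {1..len_Y \<sigma>} \<Longrightarrow> Amat \<sigma> i \<bullet> Ymat \<sigma> j = 0" if "i \<in> {1..m}" for i
    using eq that unfolding equations_ok_def by auto
  have AZ: "Amat \<sigma> (Suc (len_A \<sigma>)) = Delta_Z \<sigma>" using eq unfolding equations_ok_def by simp
  have symC: "sym_mat (Cmat \<sigma>)"
    unfolding C using symA diag_pos_sym[OF Z] by (intro sym_mat_intros sym_mat_sum) auto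
  have sdp: "is_sdp ?P"
    unfolding is_sdp_def using symA symC by (auto simp: output_sdp_def simp del: upt_Suc)
  have feas: "feasible_P ?P X' \<longleftrightarrow> psd X' \<and> (\<forall>i\<in>{1..m}. Amat \<sigma> i \<bullet> X' = bvec \<sigma> i)" for X'
  proof -
    have "(\<forall>i<m. Amat \<sigma> (Suc i) \<bullet> X' = bvec \<sigma> (Suc i)) \<longleftrightarrow> (\<forall>i\<in>{1..m}. Amat \<sigma> i \<bullet> X' = bvec \<sigma> i)"
      by (metis atLeastAtMost_iff Suc_le_eq One_nat_def Suc_pred' le_add1 plus_1_eq_Suc)
    then show ?thesis unfolding feasible_P_iff[OF sdp] output_sdp_simps(1)
      by (simp add: output_sdp_simps(2))
  qed
  have fX: "feasible_P ?P (Xstar \<sigma>)" using b diag_pos_psd[OF X] unfolding feas by simp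
  have fX': "feasible_P ?P (Xbar \<sigma>)"
    using AX b pos_def_imp_psd[OF pd(1)] unfolding feas Delta_X_def by (simp add: inner_diff_right)
  let ?y = "\<lambda>i. y (Suc i)"
  have "comb_lhs ?P ?y = (\<Sum>i = 1..m. y i *\<^sub>R Amat \<sigma> i)"
    unfolding comb_lhs_output by (intro sum.cong) auto
  then have Zeq: "Zstar \<sigma> = objective ?P - comb_lhs ?P ?y" unfolding output_sdp_simps C by simp
  then have dZ: "dual_feasible ?P ?y" unfolding dual_feasible_def using diag_pos_psd[OF Z] by simp
  then have fZ: "feasible_D ?P (Zstar \<sigma>)" unfolding feasible_D_def using Zeq by blast
  \<comment> \<open>Lowering the coefficient of \<open>Amat \<sigma> (len_A \<sigma> + 1)\<close>,
    which is \<open>Delta_Z \<sigma>\<close>, by one leads from \<open>Zstar\<close> to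
    \<open>Zbar\<close>. Coefficients are counted from \<open>0\<close>, equations from
    \<open>1\<close>.\<close>
  let ?y' = "\<lambda>i. y (Suc i) - (if i = len_A \<sigma> then 1 else 0)"
  have "comb_lhs ?P ?y' = (\<Sum>i = 1..m. y i *\<^sub>R Amat \<sigma> i) - (\<Sum>i = 1..m. if i = Suc (len_A \<sigma>) then Amat \<sigma> i else 0)"
    unfolding comb_lhs_output sum_subtractf[symmetric] by (intro sum.cong) (auto simp: algebra_simps)
  also have "\<dots> = (\<Sum>i = 1..m. y i *\<^sub>R Amat \<sigma> i) - Delta_Z \<sigma>" using k AZ by (simp add: sum.delta')
  finally have Z'eq: "Zbar \<sigma> = objective ?P - comb_lhs ?P ?y'"
    unfolding output_sdp_simps C Delta_Z_def by simp
  then have fZ': "feasible_D ?P (Zbar \<sigma>)"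
    unfolding feasible_D_def dual_feasible_def using pos_def_imp_psd[OF pd(2)] by metis
  have XZ0: "Xstar \<sigma> \<bullet> Zstar \<sigma> = 0"
    using upper_left_lower_right_disjoint[OF le(3)] X Z
    by (intro supported_inner_zero[of _ ?U]) (auto simp: diag_pos_iff supported_on_def)
  note optP = optimal_P_iff[OF sdp fX dZ Zeq XZ0] and optD = optimal_D_iff[OF sdp fX dZ Zeq XZ0]
  have rA: "rseq (Aseq \<sigma>) (Pset \<sigma>) (len_A \<sigma>)" and rY: "rseq (Yseq \<sigma>) (Qset \<sigma>) (len_Y \<sigma>)"
    using so unfolding sequences_ok_def by auto
  have redA: "reduced_face (seq_A \<sigma>) = psd_face ?L" and redY: "reduced_face (seq_Y \<sigma>) = psd_face ?U"
    using rseq_reduced_face[OF rA] rseq_reduced_face[OF rY] so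
    unfolding seq_A_eq seq_Y_eq sequences_ok_def by simp_all
  have b0: "bvec \<sigma> i = 0" if "i \<in> {1..len_A \<sigma>}" for i
  proof -
    have "supported_on (Xstar \<sigma>) (Qset \<sigma> 0)" using X Qset_0[OF so st] diag_pos_iff by metis
    then have "Amat \<sigma> i \<bullet> Xstar \<sigma> = 0"
      using Amat_zero_Qset_0[OF so st that] by (rule supported_inner_zero)
    then show ?thesis using b that k by simp
  qed
  have YZ: "Ymat \<sigma> j \<bullet> Zstar \<sigma> = 0" if "j \<in> {1..len_Y \<sigma>}" for j
  proof -
    have "supported_on (Zstar \<sigma>) (Pset \<sigma> 0)" using Z Pset_0[OF so st] diag_pos_iff by metis
    then show ?thesis using Ymat_zero_Pset_0[OF so st that] by (rule supported_inner_zero)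
  qed
  have CY: "Cmat \<sigma> \<bullet> Ymat \<sigma> j = 0" if "j \<in> {1..len_Y \<sigma>}" for j
    unfolding C using YZ[OF that] AY[OF _ that]
    by (simp add: inner_add_left inner_sum_left inner_commute[of "Zstar \<sigma>"])
  have symY: "sym_mat (Ymat \<sigma> j)" if "j \<in> {1..len_Y \<sigma>}" for j using sequences_ok_sym(2)[OF so that] .
  have rankX: "rank (Xstar \<sigma>) = size_r \<sigma>" and rankZ: "rank (Zstar \<sigma>) = size_s \<sigma>"
    using rank_diag_pos[OF X] rank_diag_pos[OF Z] card_lower_right[OF le(1)] card_upper_left[OF le(2)] by auto
  have maxP: "max_rank_optimal_P ?P (Xstar \<sigma>)"
    unfolding max_rank_optimal_P_def
  proof (intro conjI allI impI)
    show "optimal_P ?P (Xstar \<sigma>)" unfolding optP using fX XZ0 by blast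
    fix X' assume "optimal_P ?P X'"
    then have f: "feasible_P ?P X'" and z: "X' \<bullet> Zstar \<sigma> = 0" unfolding optP by auto
    have ps: "psd X'" using f unfolding feas by blast
    \<comment> \<open>Optimality gives orthogonality to \<open>Zstar\<close>, and feasibility with
      zero right hand sides gives it for the first \<open>k\<close> matrices; so \<open>X'\<close>
      lies in the reduced face, which bounds its rank.\<close>
    have "mat_inner Y X' = 0" if "Y \<in> set (seq_A \<sigma>)" for Y
    proof -
      from that consider "Y = Zstar \<sigma>" | i where "i \<in> {1..len_A \<sigma>}" "Y = Amat \<sigma> i"
        unfolding seq_A_def by fastforce
      then have "Y \<bullet> X' = 0"
        using z f b0 k unfolding feas by cases (auto simp: inner_commute)
      then show ?thesis using ps by (simp add: mat_inner_psd)
    qed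
    then have "X' \<in> psd_face ?L" using ps redA unfolding reduced_face_def by blast
    then show "rank X' \<le> rank (Xstar \<sigma>)"
      using rank_supported card_lower_right[OF le(1)] unfolding psd_face_def rankX by fastforce
  qed
  have maxD: "max_rank_optimal_D ?P (Zstar \<sigma>)"
    unfolding max_rank_optimal_D_def
  proof (intro conjI allI impI)
    show "optimal_D ?P (Zstar \<sigma>)" unfolding optD using fZ XZ0 by blast
    fix Z' assume "optimal_D ?P Z'"
    then have f: "feasible_D ?P Z'" and z: "Xstar \<sigma> \<bullet> Z' = 0" unfolding optD by auto
    then obtain y' where ps: "psd Z'" and Z': "Z' = Cmat \<sigma> - (\<Sum>i = 1..m. y' (i - 1) *\<^sub>R Amat \<sigma> i)"
      unfolding feasible_D_def dual_feasible_def comb_lhs_output output_sdp_simps by blast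
    \<comment> \<open>Every dual slack is \<open>Cmat\<close> minus a combination of the
      \<open>Amat\<close>, and each \<open>Ymat\<close> is orthogonal to all of these.\<close>
    have "mat_inner Y Z' = 0" if "Y \<in> set (seq_Y \<sigma>)" for Y
    proof -
      from that consider "Y = Xstar \<sigma>" | j where "j \<in> {1..len_Y \<sigma>}" "Y = Ymat \<sigma> j"
        unfolding seq_Y_def by fastforce
      then have "Z' \<bullet> Y = 0"
      proof cases
        case 1 then show ?thesis using z by (simp add: inner_commute)
      next
        case 2 then show ?thesis unfolding Z' using CY AY by (simp add: inner_diff_left inner_sum_left)
      qed
      then show ?thesis using ps by (simp add: mat_inner_psd inner_commute)
    qed
    then have "Z' \<in> psd_face ?U" using ps redY unfolding reduced_face_def by blast
    then show "rank Z' \<le> rank (Zstar \<sigma>)"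
      using rank_supported card_upper_left[OF le(2)] unfolding psd_face_def rankZ by fastforce
  qed
  have "optimal_pair ?P (Xstar \<sigma>) (Zstar \<sigma>)"
    unfolding optimal_pair_def using fX fZ XZ0 diag_pos_psd[OF Z] by (simp add: mat_inner_psd)
  then have "fails_strict_complementarity ?P"
    unfolding fails_strict_complementarity_def using maxP maxD rankX rankZ lt by metis
  moreover have "regular_fr (seq_A \<sigma>)" "regular_fr (seq_Y \<sigma>)"
    unfolding regular_fr_def seq_A_eq seq_Y_eq using rA rY regular_fr_structure_iff by metis+
  ultimately show ?thesis
    unfolding Let_def slater_P_def slater_D_def
    using sdp maxP maxD pd fX' fZ' b0 redA redY AY CY symY
    by (auto simp: mat_inner_eq_inner)
qed

section \<open>A theorem of the alternative\<close>

definition outer :: "real^'n::finite \<Rightarrow> 'n sqmat" where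
  "outer x = (\<chi> a b. x $ a * x $ b)"

definition restrict_to :: "'n::finite set \<Rightarrow> 'n sqmat \<Rightarrow> 'n sqmat" where
  "restrict_to F M = (\<chi> a b. if a \<in> F \<and> b \<in> F then M $ a $ b else 0)"

lemma inner_outer: "M \<bullet> outer x = x \<bullet> (M *v x)"
  unfolding inner_mat quadratic_entries outer_def by (simp add: mult_ac)

lemma linear_restrict_to: "linear (restrict_to F)"
  by (rule linearI) (auto simp: restrict_to_def vec_eq_iff)

lemma inner_restrict_to: "restrict_to F M \<bullet> T = M \<bullet> restrict_to F T"
  unfolding inner_mat restrict_to_def by (intro sum.cong refl) auto

lemma inner_transpose: "transpose A \<bullet> T = A \<bullet> transpose (T :: 'n::finite sqmat)"
  unfolding inner_mat transpose_def by (subst sum.swap) simp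

lemma restrict_to_outer:
  "restrict_to F (outer x) = outer (\<chi> a. if a \<in> F then x $ a else 0)"
  unfolding restrict_to_def outer_def by (auto simp: vec_eq_iff)

lemma sym_restrict_to: "sym_mat M \<Longrightarrow> sym_mat (restrict_to F M)"
  unfolding sym_mat_iff restrict_to_def by auto

text \<open>The convex hull of the rank one matrices \<open>x x\<^sup>T\<close> with unit vectors \<open>x\<close> supported in \<open>F\<close> is a compact
  base of the psd matrices supported in \<open>F\<close>; it is separated from the restrictions of \<open>N\<close>.\<close>

lemma psd_alternative:
  fixes N :: "'n::finite sqmat set"
  assumes N: "subspace N" "\<And>Y. Y \<in> N \<Longrightarrow> sym_mat Y"
  shows "(\<exists>Z. psd Z \<and> supported_on Z F \<and> (\<forall>a\<in>F. 0 < Z $ a $ a) \<and> (\<forall>Y\<in>N. Y \<bullet> Z = 0)) \<or>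
    (\<exists>Y\<in>N. psd_on F Y \<and> (\<exists>a\<in>F. Y $ a $ a \<noteq> 0))"
proof -
  define V where "V = {x::real^'n. norm x = 1 \<and> (\<forall>a. a \<notin> F \<longrightarrow> x $ a = 0)}"
  define K where "K = convex hull (outer ` V)"
  let ?W = "restrict_to F ` N"
  let ?T = "\<lambda>M::'n sqmat. \<Sum>a\<in>UNIV. M $ a $ a"
  have W: "subspace ?W" using N(1) linear_restrict_to by (rule linear_subspace_image[rotated])
  have "V = sphere 0 1 \<inter> {x. \<forall>a. a \<notin> F \<longrightarrow> x $ a = 0}" unfolding V_def by auto
  moreover have "closed {x::real^'n. \<forall>a. a \<notin> F \<longrightarrow> x $ a = 0}"
    by (rule closed_subspace) (auto simp: subspace_def)
  ultimately have "compact V" by (simp add: compact_Int_closed)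
  moreover have "continuous_on V outer"
    unfolding outer_def by (intro continuous_intros)
  ultimately have K: "compact K" "convex K"
    unfolding K_def by (auto intro: compact_convex_hull compact_continuous_image)
  have KV: "outer x \<in> K" if "x \<in> V" for x using that unfolding K_def by (simp add: hull_inc)
  \<comment> \<open>Trace \<open>1\<close> keeps zero out of \<open>K\<close>, so that a common
    point with \<open>?W\<close> comes from a matrix that is nonzero on \<open>F\<close>.\<close>
  have K_psd: "(\<forall>x. 0 \<le> M \<bullet> outer x) \<and> ?T M = 1" if "M \<in> K" for M
  proof -
    have "K \<subseteq> {M. (\<forall>x. 0 \<le> M \<bullet> outer x) \<and> ?T M = 1}"
      unfolding K_def
    proof (rule hull_minimal)
      show "outer ` V \<subseteq> {M. (\<forall>x. 0 \<le> M \<bullet> outer x) \<and> ?T M = 1}"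
      proof safe
        fix x y :: "real^'n"
        have "outer x \<bullet> outer y = (x \<bullet> y) * (x \<bullet> y)"
          unfolding inner_mat outer_def inner_vec_def sum_product by (simp add: mult_ac)
        then show "0 \<le> outer x \<bullet> outer y" by simp
      next
        fix x assume "x \<in> V"
        then show "?T (outer x) = 1" unfolding V_def outer_def by (simp add: norm_eq_1 inner_vec_def)
      qed
      show "convex {M. (\<forall>x. 0 \<le> M \<bullet> outer x) \<and> ?T M = 1}"
        unfolding convex_def
        by (auto simp: inner_add_left sum.distrib sum_distrib_left[symmetric])
    qed
    then show ?thesis using that by blast
  qed
  show ?thesis
  proof (cases "K \<inter> ?W = {}")
    case False
    then obtain Y where Y: "Y \<in> N" "restrict_to F Y \<in> K" by auto
    have "0 \<le> x \<bullet> (Y *v x)" if "\<forall>a. a \<notin> F \<longrightarrow> x $ a = 0" for x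
    proof -
      have "restrict_to F (outer x) = outer x"
        using that unfolding restrict_to_def outer_def by (auto simp: vec_eq_iff)
      then show ?thesis using K_psd[OF Y(2)] by (metis inner_outer inner_restrict_to)
    qed
    then have "psd_on F Y" using N(2) Y(1) unfolding psd_on_def by blast
    moreover have "\<exists>a\<in>F. Y $ a $ a \<noteq> 0"
    proof (rule ccontr)
      assume "\<not> (\<exists>a\<in>F. Y $ a $ a \<noteq> 0)"
      then have "?T (restrict_to F Y) = 0" unfolding restrict_to_def by (intro sum.neutral) auto
      then show False using K_psd[OF Y(2)] by simp
    qed
    ultimately show ?thesis using Y(1) by blast
  next
    case True
    show ?thesis
    proof (cases "F = {}")
      case True
      have "psd (0 :: 'n sqmat)" by (simp add: psd_def sym_mat_iff)
      then show ?thesis using True by (intro disjI1 exI[of _ 0]) (simp add: supported_on_def)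
    next
      case False
      then obtain a where "a \<in> F" by blast
      then have "axis a 1 \<in> V" unfolding V_def by (auto simp: axis_nth_if norm_axis_1)
      then have "K \<noteq> {}" using KV by blast
      then obtain A b where A: "\<forall>x\<in>K. A \<bullet> x < b" "\<forall>x\<in>?W. A \<bullet> x > b"
        using separating_hyperplane_compact_closed[OF K(2,1) _ subspace_imp_convex[OF W] closed_subspace[OF W] True]
        by blast
      \<comment> \<open>A linear functional that is bounded below on a subspace vanishes on
        it.\<close>
      have W0: "A \<bullet> w = 0" if "w \<in> ?W" for w
      proof (rule ccontr)
        assume nz: "A \<bullet> w \<noteq> 0"
        have "((b - 1) / (A \<bullet> w)) *\<^sub>R w \<in> ?W" using W that by (rule subspace_scale)
        then have "b < A \<bullet> (((b - 1) / (A \<bullet> w)) *\<^sub>R w)" using A(2) by blast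
        then show False using nz by simp
      qed
      have "0 \<in> ?W" using W by (rule subspace_0)
      then have "b < 0" using A(2) by (metis inner_zero_right)
      then have neg: "A \<bullet> outer x < 0" if "x \<in> V" for x using A(1) KV[OF that] by fastforce
      \<comment> \<open>The negated normal vector, symmetrized and cut down to \<open>F\<close>; as
        the functional is negative on \<open>K\<close>, this form is positive at all nonzero vectors
        supported in \<open>F\<close>.\<close>
      define Z where "Z = - restrict_to F ((1/2) *\<^sub>R (A + transpose A))"
      let ?r = "\<lambda>x::real^'n. \<chi> a. if a \<in> F then x $ a else 0"
      have symo: "transpose (outer x) = outer x" for x :: "real^'n"
        by (simp add: outer_def transpose_def mult.commute)
      have Zx: "x \<bullet> (Z *v x) = - (A \<bullet> outer (?r x))" for x
        unfolding inner_outer[symmetric] Z_def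
        by (simp add: inner_restrict_to restrict_to_outer inner_add_left inner_transpose symo)
      have pos: "0 < - (A \<bullet> outer x)" if "x \<noteq> 0" "\<forall>a. a \<notin> F \<longrightarrow> x $ a = 0" for x
      proof -
        have "outer ((1 / norm x) *\<^sub>R x) = (1 / norm x)\<^sup>2 *\<^sub>R outer x"
          by (simp add: outer_def vec_eq_iff power2_eq_square)
        moreover have "(1 / norm x) *\<^sub>R x \<in> V" using that unfolding V_def by simp
        ultimately have "(1 / norm x)\<^sup>2 * (A \<bullet> outer x) < 0" using neg by fastforce
        moreover have "0 < (1 / norm x)\<^sup>2" using that(1) by simp
        ultimately show ?thesis by (simp add: mult_less_0_iff)
      qed
      have rsupp: "\<forall>a. a \<notin> F \<longrightarrow> ?r x $ a = 0" for x by simp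
      have "0 \<le> x \<bullet> (Z *v x)" for x
      proof (cases "?r x = 0")
        case True
        then have "outer (?r x) = 0" by (simp add: outer_def vec_eq_iff)
        then show ?thesis unfolding Zx by simp
      next
        case False
        then show ?thesis unfolding Zx by (rule less_imp_le[OF pos[OF _ rsupp]])
      qed
      moreover have "sym_mat Z"
        unfolding Z_def sym_mat_iff restrict_to_def by (auto simp: transpose_def)
      ultimately have "psd Z" unfolding psd_def by blast
      moreover have "supported_on Z F" unfolding supported_on_def Z_def restrict_to_def by auto
      moreover have "0 < Z $ a $ a" if "a \<in> F" for a
      proof -
        have "?r (axis a 1) = axis a 1" using that by (auto simp: vec_eq_iff axis_nth_if)
        then show ?thesis
          unfolding axis_bilinear[symmetric] Zx using that
          by (simp only:) (rule pos, auto simp: axis_nth_if axis_eq_0_iff)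
      qed
      moreover have "Y \<bullet> Z = 0" if "Y \<in> N" for Y
      proof -
        have "restrict_to F Y \<bullet> A = 0" using W0[OF imageI[OF that]] by (metis inner_commute)
        moreover have "restrict_to F Y \<bullet> transpose A = restrict_to F Y \<bullet> A"
          using sym_restrict_to[OF N(2)[OF that], of F] unfolding sym_mat_def
          by (metis inner_transpose transpose_transpose)
        ultimately show ?thesis unfolding Z_def
          by (simp add: inner_restrict_to[symmetric] inner_add_right)
      qed
      ultimately show ?thesis by blast
    qed
  qed
qed

section \<open>Simultaneous diagonalization\<close>

lemma identity_off_transpose: "identity_off R S \<Longrightarrow> identity_off R (transpose S)"
  unfolding identity_off_def transpose_def by auto

lemma identity_off_mono: "identity_off R S \<Longrightarrow> R \<subseteq> R' \<Longrightarrow> identity_off R' S"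
  unfolding identity_off_def by blast

lemma identity_off_one: "identity_off R (mat 1)"
  unfolding identity_off_def mat_def by simp

lemma identity_off_mult:
  assumes "identity_off R S" "identity_off R T"
  shows "identity_off R (S ** T)"
  unfolding identity_off_def
proof (intro allI impI)
  fix a b assume "\<not> (a \<in> R \<and> b \<in> R)"
  then consider "a \<notin> R" | "b \<notin> R" by blast
  then show "(S ** T) $ a $ b = (if a = b then 1 else 0)"
  proof cases
    case 1
    then have "S $ a $ c * T $ c $ b = (if c = a then T $ a $ b else 0)" for c
      using assms(1) unfolding identity_off_def by auto
    then have "(S ** T) $ a $ b = T $ a $ b" by (simp add: matrix_matrix_mult_def)
    then show ?thesis using 1 assms(2) unfolding identity_off_def by auto
  next
    case 2
    then have "S $ a $ c * T $ c $ b = (if c = b then S $ a $ b else 0)" for c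
      using assms(2) unfolding identity_off_def by auto
    then have "(S ** T) $ a $ b = S $ a $ b" by (simp add: matrix_matrix_mult_def)
    then show ?thesis using 2 assms(1) unfolding identity_off_def by auto
  qed
qed

lemma identity_off_nonzero: "identity_off R S \<Longrightarrow> S $ a $ c \<noteq> 0 \<Longrightarrow> a = c \<or> a \<in> R \<and> c \<in> R"
  unfolding identity_off_def by metis

lemma congr_off_row:
  assumes "identity_off R S" "a \<notin> R"
  shows "congr S M $ a $ b = (\<Sum>d\<in>UNIV. M $ a $ d * S $ b $ d)"
proof -
  have "(\<Sum>d\<in>UNIV. S $ a $ c * M $ c $ d * S $ b $ d) = (if c = a then \<Sum>d\<in>UNIV. M $ a $ d * S $ b $ d else 0)" for c
    using assms unfolding identity_off_def by auto
  then show ?thesis unfolding congr_nth by simp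
qed

lemma congr_off:
  assumes "identity_off R S" "a \<notin> R" "b \<notin> R"
  shows "congr S M $ a $ b = M $ a $ b"
proof -
  have "M $ a $ d * S $ b $ d = (if d = b then M $ a $ b else 0)" for d
    using assms unfolding identity_off_def by auto
  then show ?thesis unfolding congr_off_row[OF assms(1,2)] by simp
qed

lemma congr_off_zero:
  assumes "identity_off R S" "a \<notin> R" "b \<in> R" "\<And>d. d \<in> R \<Longrightarrow> M $ a $ d = 0"
  shows "congr S M $ a $ b = 0"
  unfolding congr_off_row[OF assms(1,2)]
  using identity_off_nonzero[OF assms(1), of b] assms(3,4) by (intro sum.neutral) (metis mult_eq_0_iff)

lemma congr_zero_block:
  assumes S: "identity_off R S" and F: "R \<subseteq> F" "a \<in> F" "b \<in> F"
    and M: "\<And>c d. c \<in> F \<Longrightarrow> d \<in> F \<Longrightarrow> M $ c $ d = 0"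
  shows "congr S M $ a $ b = 0"
proof -
  have "S $ a $ c * M $ c $ d * S $ b $ d = 0" for c d
    using identity_off_nonzero[OF S, of a c] identity_off_nonzero[OF S, of b d] F M
    by (metis mult_eq_0_iff subsetD)
  then show ?thesis unfolding congr_nth by (intro sum.neutral ballI)
qed

lemma congr_supported_off:
  assumes S: "identity_off R S" and M: "supported_on M E" and d: "E \<inter> R = {}"
  shows "congr S M = M"
proof -
  have "S $ a $ c * M $ c $ d * S $ b $ d = (if c = a then (if d = b then M $ a $ b else 0) else 0)" for a b c d
  proof (cases "c \<in> E \<and> d \<in> E")
    case True
    then have "c \<notin> R" "d \<notin> R" using assms(3) by auto
    then show ?thesis using S unfolding identity_off_def by auto
  next
    case False
    then show ?thesis using M unfolding supported_on_def by auto
  qed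
  then have "(\<Sum>d\<in>UNIV. S $ a $ c * M $ c $ d * S $ b $ d) = (if c = a then M $ a $ b else 0)" for a b c
    by (cases "c = a") simp_all
  then have "congr S M $ a $ b = M $ a $ b" for a b unfolding congr_nth by simp
  then show ?thesis by (simp add: vec_eq_iff)
qed

lemma congr_supported:
  assumes S: "identity_off R S" and M: "supported_on M F" and R: "R \<subseteq> F"
  shows "supported_on (congr S M) F"
  unfolding supported_on_def
proof (intro allI impI)
  fix a b assume ab: "\<not> (a \<in> F \<and> b \<in> F)"
  have "S $ a $ c * M $ c $ d * S $ b $ d = 0" for c d
    using identity_off_nonzero[OF S, of a c] identity_off_nonzero[OF S, of b d] ab M R
    unfolding supported_on_def by (metis mult_eq_0_iff subsetD)
  then show "congr S M $ a $ b = 0" unfolding congr_nth by (intro sum.neutral ballI)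
qed

lemma psd_on_congr:
  assumes S: "identity_off R S" and R: "R \<subseteq> F" and M: "psd_on F M"
  shows "psd_on F (congr S M)"
  unfolding psd_on_def
proof (intro conjI allI impI)
  show "sym_mat (congr S M)" using M sym_mat_congr unfolding psd_on_def by blast
  fix x :: "real^'a" assume x: "\<forall>a. a \<notin> F \<longrightarrow> x $ a = 0"
  have "(transpose S *v x) $ a = 0" if "a \<notin> F" for a
  proof -
    have z: "S $ c $ a * x $ c = 0" for c
      using identity_off_nonzero[OF S, of c a] x that R by (metis mult_eq_0_iff subsetD)
    then show ?thesis unfolding matrix_vector_mult_def transpose_def vec_lambda_beta
      by (intro sum.neutral ballI z)
  qed
  then show "0 \<le> x \<bullet> (congr S M *v x)" unfolding congr_bilinear using M unfolding psd_on_def by blast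
qed

text \<open>The regularity, with unit diagonal blocks, of a second sequence of matrices is to survive the
  diagonalization of the first one. Its structure is given by the level function \<open>p\<close>.\<close>

definition unit_normal :: "('n::finite \<Rightarrow> nat) \<Rightarrow> nat \<Rightarrow> 'n sqmat \<Rightarrow> bool" where
  "unit_normal p i A \<longleftrightarrow> (\<forall>a b. i \<le> p a \<and> i \<le> p b \<longrightarrow> A $ a $ b = (if a = b \<and> p a = i then 1 else 0))"

text \<open>\<open>S\<close> moves the sequence that is being diagonalized, and its transposed
  inverse moves the second sequence, so that inner products between the two are kept. Only the
  second action has to respect the levels of \<open>p\<close>.\<close>

definition level_change :: "('n::finite \<Rightarrow> nat) \<Rightarrow> 'n set \<Rightarrow> 'n sqmat \<Rightarrow> 'n sqmat \<Rightarrow> bool" where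
  "level_change p R S S' \<longleftrightarrow> S ** S' = mat 1 \<and> S' ** S = mat 1 \<and> identity_off R S \<and> identity_off R S' \<and>
     (\<forall>i A. unit_normal p i A \<longrightarrow> unit_normal p i (congr (transpose S') A))"

text \<open>Rows of \<open>L\<close> reach only columns of the same or a higher level, so the new
  entries on the levels \<open>\<ge> i\<close> depend only on those of \<open>A\<close>. There
  \<open>A\<close> is the projection onto level \<open>i\<close>, and the result is the Gram matrix
  of the level \<open>i\<close> parts of the rows, orthonormal by \<open>O\<close> for rows of level
  \<open>i\<close> and zero for higher ones.\<close>

lemma unit_normal_congr:
  assumes L: "\<And>a c. L $ a $ c \<noteq> 0 \<Longrightarrow> p a \<le> p c"
    and O: "\<And>a b. p a = p b \<Longrightarrow> (\<Sum>c\<in>UNIV. if p c = p a then L $ a $ c * L $ b $ c else 0) = (if a = b then 1 else 0)"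
    and A: "unit_normal p i A"
  shows "unit_normal p i (congr L A)"
  unfolding unit_normal_def
proof (intro allI impI)
  fix a b assume ab: "i \<le> p a \<and> i \<le> p b"
  have "L $ a $ c * A $ c $ d * L $ b $ d = (if d = c then (if p c = i then L $ a $ c * L $ b $ c else 0) else 0)" for c d
  proof (cases "L $ a $ c = 0 \<or> L $ b $ d = 0")
    case False
    then have "i \<le> p c \<and> i \<le> p d" using L ab order_trans by metis
    then have "A $ c $ d = (if c = d \<and> p c = i then 1 else 0)" using A unfolding unit_normal_def by blast
    then show ?thesis by auto
  qed auto
  then have eq: "congr L A $ a $ b = (\<Sum>c\<in>UNIV. if p c = i then L $ a $ c * L $ b $ c else 0)"
    unfolding congr_nth by simp
  show "congr L A $ a $ b = (if a = b \<and> p a = i then 1 else 0)"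
  proof (cases "p a = i \<and> p b = i")
    case True
    then show ?thesis unfolding eq using O[of a b] by simp
  next
    case False
    then have "L $ a $ c = 0 \<or> L $ b $ c = 0" if "p c = i" for c
      using L[of a c] L[of b c] ab that by fastforce
    then have "(\<Sum>c\<in>UNIV. if p c = i then L $ a $ c * L $ b $ c else 0) = 0"
      by (intro sum.neutral) auto
    then show ?thesis unfolding eq using False by auto
  qed
qed

lemma level_change_one: "level_change p R (mat 1) (mat 1)"
  unfolding level_change_def by (simp add: identity_off_one)

lemma level_change_mono: "level_change p R S S' \<Longrightarrow> R \<subseteq> R' \<Longrightarrow> level_change p R' S S'"
  unfolding level_change_def using identity_off_mono by blast

lemma level_change_trans:
  assumes "level_change p R S S'" "level_change p R T T'"
  shows "level_change p R (T ** S) (S' ** T')"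
proof -
  have "(T ** S) ** (S' ** T') = T ** (S ** S') ** T'" "(S' ** T') ** (T ** S) = S' ** (T' ** T) ** S"
    by (simp_all add: matrix_mul_assoc)
  then show ?thesis using assms unfolding level_change_def
    by (simp add: identity_off_mult matrix_transpose_mul congr_congr[symmetric])
qed

lemma level_change_orthogonal:
  assumes U: "orthogonal_matrix U" "identity_off B U" and B: "\<And>a b. a \<in> B \<Longrightarrow> b \<in> B \<Longrightarrow> p a = p b"
  shows "level_change p B U (transpose U)"
proof -
  note o = orthogonal_matrix_inverse[OF U(1)]
  have lev: "p a = p c" if "U $ a $ c \<noteq> 0" for a c using identity_off_nonzero[OF U(2) that] B by blast
  have "unit_normal p i (congr U A)" if A: "unit_normal p i A" for i A
  proof (rule unit_normal_congr[OF _ _ A])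
    fix a b assume "p a = p b"
    have "(\<Sum>c\<in>UNIV. if p c = p a then U $ a $ c * U $ b $ c else 0) = (\<Sum>c\<in>UNIV. U $ a $ c * U $ b $ c)"
      using lev by (intro sum.cong refl) (metis mult_eq_0_iff)
    also have "\<dots> = (U ** transpose U) $ a $ b" by (simp add: matrix_matrix_mult_def transpose_def)
    finally show "(\<Sum>c\<in>UNIV. if p c = p a then U $ a $ c * U $ b $ c else 0) = (if a = b then 1 else 0)"
      using o by (simp add: mat_def)
  qed (use lev in auto)
  then show ?thesis using o U(2) unfolding level_change_def by (simp add: identity_off_transpose)
qed

lemma matrix_add_mult: "(A + B) ** C = A ** C + B ** C" for A B C :: "'n::finite sqmat"
  by (simp add: matrix_matrix_mult_def vec_eq_iff distrib_right sum.distrib)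

lemma matrix_mult_uminus: "(- A) ** B = - (A ** B)" "A ** (- B) = - (A ** B)" for A B :: "'n::finite sqmat"
  by (simp_all add: matrix_matrix_mult_def vec_eq_iff sum_negf)

definition column_matrix :: "'n::finite \<Rightarrow> ('n \<Rightarrow> real) \<Rightarrow> 'n sqmat" where
  "column_matrix b f = (\<chi> c d. if d = b then f c else 0)"

text \<open>Multiples of row \<open>b\<close> are subtracted from rows of higher level; the
  transposed inverse is then unit triangular in the direction that \<open>unit_normal_congr\<close>
  requires. The inverse is explicit because the column matrix squares to zero.\<close>

lemma level_change_eliminate:
  assumes f: "\<And>c. f c \<noteq> 0 \<Longrightarrow> c \<in> R \<and> p b < p c" and b: "b \<in> R"
  shows "level_change p R (mat 1 - column_matrix b f) (mat 1 + column_matrix b f)"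
proof -
  let ?E = "column_matrix b f"
  have fb: "f b = 0" using f by blast
  have E2: "?E ** ?E = 0"
    unfolding matrix_matrix_mult_def column_matrix_def
    by (simp add: vec_eq_iff) (auto intro!: sum.neutral simp: fb)
  have io: "identity_off R (mat 1 + ?E)" "identity_off R (mat 1 - ?E)"
    unfolding identity_off_def column_matrix_def mat_def using f b by auto
  let ?L = "transpose (mat 1 + ?E)"
  have Lac: "?L $ a $ c = (if a = c then 1 else 0) + (if a = b then f c else 0)" for a c
    by (auto simp: transpose_def mat_def column_matrix_def)
  have "unit_normal p i (congr ?L A)" if A: "unit_normal p i A" for i A
  proof (rule unit_normal_congr[OF _ _ A])
    show "p a \<le> p c" if "?L $ a $ c \<noteq> 0" for a c
      using that f[of c] unfolding Lac by (auto split: if_splits)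
    fix a a' assume aa: "p a = p a'"
    have "(if p c = p a then ?L $ a $ c * ?L $ a' $ c else 0) = (if c = a then (if a = a' then 1 else 0) else 0)" for c
    proof (cases "p c = p a")
      case True
      then have "f c = 0" if "a = b \<or> a' = b" using f[of c] aa that True by (metis less_irrefl)
      then have "?L $ a $ c = (if a = c then 1 else 0)" "?L $ a' $ c = (if a' = c then 1 else 0)"
        unfolding Lac by auto
      then show ?thesis using True by auto
    qed auto
    then show "(\<Sum>c\<in>UNIV. if p c = p a then ?L $ a $ c * ?L $ a' $ c else 0) = (if a = a' then 1 else 0)"
      by simp
  qed
  moreover have "(mat 1 - ?E) ** (mat 1 + ?E) = mat 1" "(mat 1 + ?E) ** (mat 1 - ?E) = mat 1"
    using E2 unfolding matrix_add_ldistrib matrix_add_mult diff_conv_add_uminus matrix_mult_uminus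
    by simp_all
  ultimately show ?thesis unfolding level_change_def using io by blast
qed

lemma congr_eliminate_column:
  assumes "f b = 0"
  shows "congr (mat 1 - column_matrix b f) M $ c $ b = M $ c $ b - f c * M $ b $ b"
proof -
  let ?S = "mat 1 - column_matrix b f"
  have S: "?S $ a $ d = (if a = d then 1 else 0) - (if d = b then f a else 0)" for a d
    by (auto simp: mat_def column_matrix_def)
  have "(\<Sum>d\<in>UNIV. ?S $ c $ a * M $ a $ d * ?S $ b $ d) = ?S $ c $ a * M $ a $ b" for a
  proof -
    have "?S $ c $ a * M $ a $ d * ?S $ b $ d = (if d = b then ?S $ c $ a * M $ a $ b else 0)" for d
      using assms unfolding S by auto
    then show ?thesis by simp
  qed
  then have "congr ?S M $ c $ b = (\<Sum>a\<in>UNIV. ?S $ c $ a * M $ a $ b)" unfolding congr_nth by simp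
  also have "\<dots> = (\<Sum>a\<in>UNIV. (if a = c then M $ c $ b else 0) - (if a = b then f c * M $ b $ b else 0))"
    unfolding S by (intro sum.cong refl) (auto simp: left_diff_distrib)
  also have "\<dots> = M $ c $ b - f c * M $ b $ b" by (simp add: sum_subtractf)
  finally show ?thesis .
qed

lemma level_diagonalization:
  fixes Y :: "'n::finite sqmat"
  assumes "psd_on R Y"
  shows "\<exists>S S'. level_change p R S S' \<and> (\<forall>a\<in>R. \<forall>b\<in>R. a \<noteq> b \<longrightarrow> congr S Y $ a $ b = 0)"
  using assms
proof (induction "card R" arbitrary: R Y rule: less_induct)
  case less
  show ?case
  proof (cases "R = {}")
    case True
    then show ?thesis using level_change_one by blast
  next
    case False
    have symY: "sym_mat Y" using less.prems unfolding psd_on_def by blast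
    define B where "B = {a \<in> R. p a = Min (p ` R)}"
    have "Min (p ` R) \<in> p ` R" using False by (intro Min_in) auto
    then obtain b where bB: "b \<in> B" unfolding B_def by auto
    have BR: "B \<subseteq> R" unfolding B_def by blast
    have Bmin: "p b < p c" if "c \<in> R" "c \<notin> B" for c
    proof -
      have "Min (p ` R) \<le> p c" using that(1) by simp
      moreover have "p b = Min (p ` R)" "p c \<noteq> Min (p ` R)" using that bB unfolding B_def by auto
      ultimately show ?thesis by linarith
    qed
    obtain U where U: "orthogonal_matrix U" "identity_off B U"
      and Ud: "\<And>a b. a \<in> B \<Longrightarrow> b \<in> B \<Longrightarrow> a \<noteq> b \<Longrightarrow> congr U Y $ a $ b = 0"
      using orthogonal_matrix_diagonalizes[OF symY, of B] by blast
    define Y1 where "Y1 = congr U Y"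
    have Y1: "psd_on R Y1" unfolding Y1_def by (rule psd_on_congr[OF U(2) BR less.prems])
    then have symY1: "sym_mat Y1" unfolding psd_on_def by blast
    have lc1: "level_change p R U (transpose U)"
      by (rule level_change_mono[OF level_change_orthogonal[OF U] BR]) (auto simp: B_def)
    \<comment> \<open>Within the lowest level, \<open>U\<close> has already cleared the column of
      \<open>b\<close>. For a zero pivot there is nothing to eliminate, since semidefiniteness makes
      the column vanish on \<open>R\<close>.\<close>
    define f where "f c = (if c \<in> R \<and> c \<notin> B \<and> Y1 $ b $ b \<noteq> 0 then Y1 $ c $ b / Y1 $ b $ b else 0)" for c
    define T where "T = mat 1 - column_matrix b f"
    define T' where "T' = mat 1 + column_matrix b f"
    have "c \<in> R \<and> p b < p c" if "f c \<noteq> 0" for c using that Bmin unfolding f_def by presburger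
    then have lc2: "level_change p R T T'"
      unfolding T_def T'_def using bB BR by (intro level_change_eliminate) blast+
    then have ioT: "identity_off R T" unfolding level_change_def by blast
    define Y2 where "Y2 = congr T Y1"
    have Y2: "psd_on R Y2" unfolding Y2_def by (rule psd_on_congr[OF ioT subset_refl Y1])
    then have symY2: "sym_mat Y2" unfolding psd_on_def by blast
    have Y2b: "Y2 $ c $ b = 0" if c: "c \<in> R" "c \<noteq> b" for c
    proof -
      have "Y2 $ c $ b = Y1 $ c $ b - f c * Y1 $ b $ b"
        unfolding Y2_def T_def using bB by (intro congr_eliminate_column) (simp add: f_def)
      moreover have "Y1 $ c $ b = 0" if "c \<in> B" using Ud that bB c unfolding Y1_def by blast
      moreover have "Y1 $ c $ b = 0" if "Y1 $ b $ b = 0"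
        using psd_on_zero_row[OF Y1 _ _ that] c(1) bB BR sym_matD[OF symY1] by (metis subsetD)
      ultimately show ?thesis using c unfolding f_def by auto
    qed
    have "card (R - {b}) < card R" using bB BR by (intro psubset_card_mono) auto
    moreover have "psd_on (R - {b}) Y2" using psd_on_mono[OF Y2] by blast
    ultimately obtain S3 S3' where lc3: "level_change p (R - {b}) S3 S3'"
      and d3: "\<forall>a\<in>R - {b}. \<forall>c\<in>R - {b}. a \<noteq> c \<longrightarrow> congr S3 Y2 $ a $ c = 0"
      using less.hyps by metis
    have io3: "identity_off (R - {b}) S3" using lc3 unfolding level_change_def by blast
    \<comment> \<open>The later moves act on \<open>R - {b}\<close> only and leave the cleared row
      of \<open>b\<close> zero.\<close>
    have b0: "congr S3 Y2 $ b $ c = 0" if "c \<in> R" "c \<noteq> b" for c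
      using that Y2b sym_matD[OF symY2] by (intro congr_off_zero[OF io3]) auto
    have "congr S3 Y2 $ a $ c = 0" if "a \<in> R" "c \<in> R" "a \<noteq> c" for a c
      using that d3 b0 sym_matD[OF sym_mat_congr[OF symY2], of S3] by (metis DiffI singletonD)
    moreover have "congr S3 Y2 = congr (S3 ** (T ** U)) Y"
      unfolding Y2_def Y1_def by (simp add: congr_congr matrix_mul_assoc)
    moreover have "level_change p R (S3 ** (T ** U)) ((transpose U ** T') ** S3')"
      using level_change_trans[OF level_change_trans[OF lc1 lc2] level_change_mono[OF lc3]] by blast
    ultimately show ?thesis by metis
  qed
qed

section \<open>Facial reduction\<close>

text \<open>\<open>E\<close> is the support of a known solution \<open>Z0\<close>, and
  \<open>R\<close> holds the undecided indices. The last hypothesis rules out a solution with larger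
  support and so forces the alternative to deliver a new matrix as long as \<open>R\<close> is
  nonempty. Level \<open>0\<close> is reserved for the indices outside \<open>E \<union> R\<close>;
  \<open>p\<close> only limits the admissible moves.\<close>

lemma facial_reduction:
  fixes N :: "'n::finite sqmat set"
  assumes "subspace N" "\<And>Y. Y \<in> N \<Longrightarrow> sym_mat Y" "E \<inter> R = {}" "diag_pos E Z0" "\<And>Y. Y \<in> N \<Longrightarrow> Y \<bullet> Z0 = 0"
    and "\<And>Z. psd Z \<Longrightarrow> supported_on Z (E \<union> R) \<Longrightarrow> \<forall>Y\<in>N. Y \<bullet> Z = 0 \<Longrightarrow> supported_on Z E"
  shows "\<exists>S S' l q Y. level_change p R S S' \<and> (\<forall>a. q a = 0 \<longleftrightarrow> a \<notin> E \<union> R) \<and> (\<forall>a. q a = Suc l \<longleftrightarrow> a \<in> E) \<and>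
    (\<forall>a. q a \<le> Suc l) \<and> (\<forall>i\<in>{1..l}. \<exists>a. q a = i) \<and>
    (\<forall>i\<in>{1..l}. (\<exists>V\<in>N. Y i = congr S V) \<and> level_normal q i (Y i))"
  using assms
proof (induction "card R" arbitrary: R N rule: less_induct)
  case less
  show ?case
  proof (cases "R = {}")
    case True
    \<comment> \<open>With no undecided index there are no matrices to choose: \<open>l = 0\<close>,
      and \<open>E\<close> itself is level \<open>1\<close>.\<close>
    then show ?thesis
      by (intro exI[of _ "mat 1"] exI[of _ 0] exI[of _ "\<lambda>a. if a \<in> E then 1 else 0"] exI[of _ "\<lambda>_. 0"])
        (simp add: level_change_one)
  next
    case False
    let ?F = "E \<union> R"
    note symN = less.prems(2) and ER = less.prems(3) and Z0 = less.prems(4)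
    have "\<nexists>Z. psd Z \<and> supported_on Z ?F \<and> (\<forall>a\<in>?F. 0 < Z $ a $ a) \<and> (\<forall>Y\<in>N. Y \<bullet> Z = 0)"
    proof
      assume "\<exists>Z. psd Z \<and> supported_on Z ?F \<and> (\<forall>a\<in>?F. 0 < Z $ a $ a) \<and> (\<forall>Y\<in>N. Y \<bullet> Z = 0)"
      then obtain Z where Z: "supported_on Z E" "\<forall>a\<in>?F. 0 < Z $ a $ a" using less.prems(6) by blast
      obtain a where "a \<in> R" using False by blast
      then have "a \<notin> E" "0 < Z $ a $ a" using ER Z(2) by auto
      then show False using Z(1) unfolding supported_on_def by (metis less_irrefl)
    qed
    then obtain Y where YN: "Y \<in> N" and Y: "psd_on ?F Y" and nzY: "\<exists>a\<in>?F. Y $ a $ a \<noteq> 0"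
      using psd_alternative[OF less.prems(1,2), of ?F] by blast
    have symY: "sym_mat Y" using symN YN by blast
    \<comment> \<open>On \<open>E\<close> the diagonal of \<open>Y\<close> is nonnegative and that
      of the diagonal matrix \<open>Z0\<close> is positive; orthogonality leaves only zeros.\<close>
    have Yee: "Y $ e $ e = 0" if "e \<in> E" for e
    proof -
      have "Y $ a $ b * Z0 $ a $ b = (if b = a then (if a \<in> E then Y $ a $ a * Z0 $ a $ a else 0) else 0)" for a b
        using Z0 unfolding diag_pos_def by (metis mult_zero_right)
      then have "(\<Sum>a\<in>UNIV. if a \<in> E then Y $ a $ a * Z0 $ a $ a else 0) = 0"
        using less.prems(5)[OF YN] unfolding inner_mat by simp
      moreover have Zpos: "0 < Z0 $ a $ a" if "a \<in> E" for a using Z0 that unfolding diag_pos_def by metis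
      then have "0 \<le> (if a \<in> E then Y $ a $ a * Z0 $ a $ a else 0)" for a
        using psd_on_diag[OF Y, of a] by (simp add: less_imp_le)
      ultimately have "\<forall>a\<in>UNIV. (if a \<in> E then Y $ a $ a * Z0 $ a $ a else 0) = 0"
        by (subst sum_nonneg_eq_0_iff[symmetric]) auto
      then show ?thesis using that Zpos[OF that] by (metis UNIV_I mult_eq_0_iff less_irrefl)
    qed
    have YE: "Y $ e $ b = 0" if "e \<in> E" "b \<in> ?F" for e b
      using psd_on_zero_row[OF Y _ that(2) Yee[OF that(1)]] that(1) by blast
    obtain S S' where lc: "level_change p R S S'"
      and d: "\<forall>a\<in>R. \<forall>b\<in>R. a \<noteq> b \<longrightarrow> congr S Y $ a $ b = 0"
      using level_diagonalization[OF psd_on_mono[OF Y Un_upper2], of p] by (elim exE conjE) (rule that)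
    have ioS: "identity_off R S" and ioS': "identity_off R S'" and inv: "S ** S' = mat 1" "S' ** S = mat 1"
      using lc unfolding level_change_def by auto
    define Y1 where "Y1 = congr S Y"
    have Y1: "psd_on ?F Y1" unfolding Y1_def using psd_on_congr[OF ioS _ Y] by blast
    have symY1: "sym_mat Y1" using Y1 unfolding psd_on_def by blast
    have Y1E: "Y1 $ e $ b = 0" if "e \<in> E" "b \<in> ?F" for e b
    proof (cases "b \<in> R")
      case True
      then show ?thesis unfolding Y1_def using YE that ER by (intro congr_off_zero[OF ioS]) auto
    next
      case False
      then have "Y1 $ e $ b = Y $ e $ b" unfolding Y1_def using that ER by (intro congr_off[OF ioS]) auto
      then show ?thesis using YE that by simp
    qed
    have Y1d: "Y1 $ a $ b = 0" if "a \<in> ?F" "b \<in> ?F" "a \<noteq> b" for a b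
      using that Y1E d sym_matD[OF symY1] unfolding Y1_def[symmetric] by (metis UnE)
    \<comment> \<open>The set decided in this round. It is nonempty: otherwise \<open>Y1\<close>,
      and with it \<open>Y\<close>, would vanish on \<open>?F\<close>.\<close>
    define Q where "Q = {a \<in> R. Y1 $ a $ a \<noteq> 0}"
    have Qpos: "0 < Y1 $ a $ a" if "a \<in> Q" for a
      using psd_on_diag[OF Y1, of a] that unfolding Q_def by auto
    have Q0: "Y1 $ a $ a = 0" if "a \<in> ?F" "a \<notin> Q" for a
      using that Y1E unfolding Q_def by blast
    have Qne: "Q \<noteq> {}"
    proof
      assume "Q = {}"
      then have z: "Y1 $ a $ b = 0" if "a \<in> ?F" "b \<in> ?F" for a b
        using Q0 Y1d that by (cases "a = b") auto
      have "Y = congr S' Y1" unfolding Y1_def using inv(2) by (simp add: congr_inverse)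
      then have "Y $ a $ a = 0" if "a \<in> ?F" for a
        using congr_zero_block[OF ioS' _ that that z] by simp
      then show False using nzY by blast
    qed
    let ?R' = "R - Q"
    let ?N' = "congr S ` N"
    have QR: "Q \<subseteq> R" unfolding Q_def by blast
    have h0: "card ?R' < card R" using Qne QR by (intro psubset_card_mono) auto
    have h1: "subspace ?N'" using less.prems(1) linear_congr by (rule linear_subspace_image[rotated])
    have h2: "sym_mat V" if "V \<in> ?N'" for V using that symN sym_mat_congr by blast
    have h3: "E \<inter> ?R' = {}" using ER by blast
    have h4: "V \<bullet> Z0 = 0" if V: "V \<in> ?N'" for V
    proof -
      obtain W where "W \<in> N" "V = congr S W" using V by blast
      moreover have "congr (transpose S) Z0 = Z0"
        using congr_supported_off[OF identity_off_transpose[OF ioS] _ ER] Z0 diag_pos_iff by metis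
      ultimately show ?thesis using less.prems(5) by (simp add: inner_congr)
    qed
    \<comment> \<open>The last hypothesis is transported through the congruence. Supports survive
      because \<open>S\<close> and \<open>S'\<close> mix only indices in \<open>R\<close>, which
      \<open>E\<close> avoids.\<close>
    have h5: "supported_on Z E" if Z: "psd Z" "supported_on Z (E \<union> ?R')" "\<forall>V\<in>?N'. V \<bullet> Z = 0" for Z
    proof -
      let ?Z = "congr (transpose S) Z"
      have "supported_on Z ?F" using Z(2) unfolding supported_on_def by blast
      then have "supported_on ?Z ?F" by (intro congr_supported[OF identity_off_transpose[OF ioS]]) auto
      moreover have "\<forall>Y\<in>N. Y \<bullet> ?Z = 0" using Z(3) by (simp add: inner_congr)
      ultimately have Ze: "supported_on ?Z E" using less.prems(6) psd_congr[OF Z(1)] by blast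
      have "Z = congr (transpose S') ?Z"
        using inv(1) by (metis congr_inverse matrix_transpose_mul transpose_mat)
      also have "\<dots> = ?Z" by (rule congr_supported_off[OF identity_off_transpose[OF ioS'] Ze ER])
      finally show ?thesis using Ze by simp
    qed
    have "\<exists>S S' l q Y. level_change p ?R' S S' \<and> (\<forall>a. q a = 0 \<longleftrightarrow> a \<notin> E \<union> ?R') \<and>
        (\<forall>a. q a = Suc l \<longleftrightarrow> a \<in> E) \<and> (\<forall>a. q a \<le> Suc l) \<and> (\<forall>i\<in>{1..l}. \<exists>a. q a = i) \<and>
        (\<forall>i\<in>{1..l}. (\<exists>V\<in>?N'. Y i = congr S V) \<and> level_normal q i (Y i))"
      by (rule less.hyps[OF h0 h1 h2 h3 Z0 h4 h5])
    then obtain S2 S2' l2 q2 Y2 where lc2: "level_change p ?R' S2 S2'"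
      and q2: "\<forall>a. q2 a = 0 \<longleftrightarrow> a \<notin> E \<union> ?R'" "\<forall>a. q2 a = Suc l2 \<longleftrightarrow> a \<in> E" "\<forall>a. q2 a \<le> Suc l2"
        "\<forall>i\<in>{1..l2}. \<exists>a. q2 a = i"
      and Y2: "\<forall>i\<in>{1..l2}. (\<exists>V\<in>?N'. Y2 i = congr S2 V) \<and> level_normal q2 i (Y2 i)"
      by (elim exE conjE) (rule that)
    have io2: "identity_off ?R' S2" using lc2 unfolding level_change_def by blast
    \<comment> \<open>The recursive levels move up by one to make room for \<open>Q\<close> at level
      \<open>1\<close>; in the recursive call \<open>Q\<close> counted as outside and had level
      \<open>0\<close>.\<close>
    define q where "q a = (if a \<in> E \<union> ?R' then Suc (q2 a) else if a \<in> Q then 1 else 0)" for a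
    define Y3 where "Y3 i = (if i = 1 then congr S2 Y1 else Y2 (i - 1))" for i
    have lc3: "level_change p R (S2 ** S) (S' ** S2')"
      using level_change_trans[OF lc level_change_mono[OF lc2]] by blast
    have qF: "q a = 0 \<longleftrightarrow> a \<notin> ?F" for a using QR unfolding q_def by auto
    have qE: "q a = Suc (Suc l2) \<longleftrightarrow> a \<in> E" for a using q2(2) unfolding q_def by auto
    have qle: "q a \<le> Suc (Suc l2)" for a using q2(3) unfolding q_def by auto
    have q1: "q a = 1 \<longleftrightarrow> a \<in> Q" for a using q2(1) QR ER unfolding q_def by auto
    have qge: "q a = Suc (q2 a) \<and> a \<in> E \<union> ?R'" if "2 \<le> q a" for a
      using that unfolding q_def by (auto split: if_splits)
    have qex: "\<exists>a. q a = i" if "i \<in> {1..Suc l2}" for i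
    proof (cases "i = 1")
      case True then show ?thesis using Qne q1 by blast
    next
      case False
      then have i: "i - 1 \<in> {1..l2}" using that by auto
      then obtain a where a: "q2 a = i - 1" using q2(4) by blast
      then have "q2 a \<noteq> 0" using i by auto
      then have "a \<in> E \<union> ?R'" using q2(1)[rule_format, of a] by (metis (no_types))
      then show ?thesis using a i unfolding q_def by (intro exI[of _ a]) auto
    qed
    \<comment> \<open>The later moves mix only indices in \<open>?R'\<close>, whose rows in
      \<open>Y1\<close> vanish on \<open>?F\<close>, so they cannot spoil the first matrix.\<close>
    have n1: "level_normal q 1 (congr S2 Y1)"
      unfolding level_normal_def
    proof (intro allI impI)
      fix a b assume "1 \<le> q a \<and> 1 \<le> q b"
      then have ab: "a \<in> ?F" "b \<in> ?F" using qF by force+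
      have row: "congr S2 Y1 $ x $ y = 0" if "x \<in> ?F" "x \<notin> ?R'" "y \<in> ?R'" for x y
        using that Y1d by (intro congr_off_zero[OF io2]) auto
      consider "a \<notin> ?R'" "b \<notin> ?R'" | "a \<notin> ?R'" "b \<in> ?R'" | "a \<in> ?R'" "b \<notin> ?R'" | "a \<in> ?R'" "b \<in> ?R'" by blast
      then show "if a = b \<and> q a = 1 then 0 < congr S2 Y1 $ a $ b else congr S2 Y1 $ a $ b = 0"
      proof cases
        case 1
        then have "congr S2 Y1 $ a $ b = Y1 $ a $ b" by (rule congr_off[OF io2])
        then show ?thesis using Y1d[OF ab] Qpos Q0 ab q1[of a] by (cases "a = b") auto
      next
        case 2 then show ?thesis using row[of a b] ab by auto
      next
        case 3
        then have "congr S2 Y1 $ b $ a = 0" using row[of b a] ab by auto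
        then show ?thesis using 3 sym_matD[OF sym_mat_congr[OF symY1]] by metis
      next
        case 4
        have "Y1 $ c $ e = 0" if "c \<in> ?R'" "e \<in> ?R'" for c e
          using that Y1d[of c e] Q0[of c] by (cases "c = e") auto
        then have "congr S2 Y1 $ a $ b = 0" using 4 by (intro congr_zero_block[OF io2 subset_refl]) auto
        then show ?thesis using 4 q1[of a] by auto
      qed
    qed
    have Y3: "(\<exists>V\<in>N. Y3 i = congr (S2 ** S) V) \<and> level_normal q i (Y3 i)" if "i \<in> {1..Suc l2}" for i
    proof (cases "i = 1")
      case True
      then show ?thesis using n1 YN unfolding Y3_def Y1_def by (auto simp: congr_congr)
    next
      case False
      then have i: "i - 1 \<in> {1..l2}" "2 \<le> i" using that by auto
      have "level_normal q i (Y2 (i - 1))"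
        unfolding level_normal_def
      proof (intro allI impI)
        fix a b assume ab: "i \<le> q a \<and> i \<le> q b"
        then have "q a = Suc (q2 a)" "q b = Suc (q2 b)" using qge i(2) order_trans by blast+
        moreover from this have "i - 1 \<le> q2 a \<and> i - 1 \<le> q2 b" using ab by auto
        then have "if a = b \<and> q2 a = i - 1 then 0 < Y2 (i - 1) $ a $ b else Y2 (i - 1) $ a $ b = 0"
          using Y2 i(1) unfolding level_normal_def by blast
        ultimately show "if a = b \<and> q a = i then 0 < Y2 (i - 1) $ a $ b else Y2 (i - 1) $ a $ b = 0"
          using i(2) by (auto split: if_splits)
      qed
      moreover obtain V where "V \<in> N" "Y2 (i - 1) = congr S2 (congr S V)" using Y2 i(1) by blast
      ultimately show ?thesis using False unfolding Y3_def by (auto simp: congr_congr)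
    qed
    show ?thesis
      by (rule exI[of _ "S2 ** S"], rule exI[of _ "S' ** S2'"], rule exI[of _ "Suc l2"],
          rule exI[of _ q], rule exI[of _ Y3])
        (intro conjI allI ballI lc3 qF qE qle qex Y3[THEN conjunct1] Y3[THEN conjunct2])
  qed
qed

section \<open>Reformulations\<close>

definition lincomb :: "'a::real_vector list \<Rightarrow> (nat \<Rightarrow> real) \<Rightarrow> 'a" where
  "lincomb xs y = (\<Sum>i<length xs. y i *\<^sub>R xs ! i)"

text \<open>An equation is treated as one vector in the product of the matrices with the reals, so
  that left and right hand sides are combined at once.\<close>

lemma comb_eq_lincomb: "(comb_lhs P y, comb_rhs P y) = lincomb (equations P) y"
  unfolding lincomb_def comb_lhs_def comb_rhs_def
  by (rule prod_eqI) (simp_all add: fst_sum snd_sum)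

lemma lincomb_span: "x \<in> span (set xs) \<longleftrightarrow> (\<exists>y. x = lincomb xs y)"
proof
  let ?W = "range (lincomb xs)"
  have "subspace ?W"
  proof (rule subspaceI)
    show "0 \<in> ?W" by (rule range_eqI[of _ _ "\<lambda>_. 0"]) (simp add: lincomb_def)
    fix u v assume "u \<in> ?W" "v \<in> ?W"
    then obtain y z where "u = lincomb xs y" "v = lincomb xs z" by blast
    then show "u + v \<in> ?W"
      by (intro range_eqI[of _ _ "\<lambda>i. y i + z i"]) (simp add: lincomb_def scaleR_add_left sum.distrib)
  next
    fix u c assume "u \<in> ?W"
    then obtain y where "u = lincomb xs y" by blast
    then show "c *\<^sub>R u \<in> ?W"
      by (intro range_eqI[of _ _ "\<lambda>i. c * y i"]) (simp add: lincomb_def scaleR_sum_right)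
  qed
  moreover have "set xs \<subseteq> ?W"
  proof
    fix u assume "u \<in> set xs"
    then obtain j where j: "j < length xs" "u = xs ! j" by (metis in_set_conv_nth)
    have "lincomb xs (\<lambda>i. if i = j then 1 else 0) = (\<Sum>i<length xs. if i = j then xs ! j else 0)"
      unfolding lincomb_def by (intro sum.cong) auto
    then have "lincomb xs (\<lambda>i. if i = j then 1 else 0) = u" using j by simp
    then show "u \<in> ?W" by blast
  qed
  ultimately show "x \<in> span (set xs) \<Longrightarrow> \<exists>y. x = lincomb xs y" using span_minimal by blast
  show "\<exists>y. x = lincomb xs y \<Longrightarrow> x \<in> span (set xs)"
    unfolding lincomb_def by (elim exE, hypsubst) (intro span_sum span_scale span_base nth_mem, simp)
qed

lemma comb_span: "(comb_lhs P y, comb_rhs P y) \<in> span (set (equations P))"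
  unfolding comb_eq_lincomb lincomb_span by blast

lemma span_comb: "e \<in> span (set (equations P)) \<Longrightarrow> \<exists>y. e = (comb_lhs P y, comb_rhs P y)"
  unfolding comb_eq_lincomb lincomb_span .

text \<open>The coefficients arise by solving the combination for its \<open>i\<close>-th term. The
  coefficient \<open>1 / y i\<close> of the new vector is again nonzero, so replacing an equation is
  a reversible operation.\<close>

lemma lincomb_update_inverse:
  assumes i: "i < length xs" and y: "y i \<noteq> 0"
  shows "lincomb (xs[i := lincomb xs y]) (\<lambda>t. if t = i then 1 / y i else - y t / y i) = xs ! i"
proof -
  let ?B = "lincomb xs y" and ?z = "\<lambda>t. if t = i then 1 / y i else - y t / y i"
  let ?I = "{..<length xs} - {i}"
  have B: "?B = y i *\<^sub>R xs ! i + (\<Sum>t\<in>?I. y t *\<^sub>R xs ! t)"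
    unfolding lincomb_def using i by (subst sum.remove[of _ i]) auto
  have "lincomb (xs[i := ?B]) ?z = (1 / y i) *\<^sub>R ?B + (\<Sum>t\<in>?I. ?z t *\<^sub>R xs[i := ?B] ! t)"
    unfolding lincomb_def[of "xs[i := ?B]"] length_list_update using i by (subst sum.remove[of _ i]) auto
  also have "(\<Sum>t\<in>?I. ?z t *\<^sub>R xs[i := ?B] ! t) = (\<Sum>t\<in>?I. (- 1 / y i) *\<^sub>R (y t *\<^sub>R xs ! t))"
    by (intro sum.cong) auto
  also have "\<dots> = (- 1 / y i) *\<^sub>R (\<Sum>t\<in>?I. y t *\<^sub>R xs ! t)" by (rule scaleR_sum_right[symmetric])
  finally show ?thesis unfolding B using y by (simp add: scaleR_add_right)
qed

lemma span_update:
  assumes i: "i < length xs" and y: "y i \<noteq> 0"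
  shows "span (set (xs[i := lincomb xs y])) = span (set xs)"
proof -
  have sub: "span (set (zs[i := u])) \<subseteq> span (set zs)" if "u \<in> span (set zs)" for zs and u :: 'a
    using set_update_subset_insert[of zs i u] that
    by (intro span_minimal subspace_span) (auto intro: span_base)
  have "span (set xs) = span (set ((xs[i := lincomb xs y])[i := xs ! i]))" by simp
  also have "\<dots> \<subseteq> span (set (xs[i := lincomb xs y]))"
    using lincomb_update_inverse[of i xs y, OF i y] by (intro sub) (metis lincomb_span)
  finally show ?thesis using sub[of "lincomb xs y" xs] lincomb_span by blast
qed

section \<open>Reversibility of the reformulation steps and the exchange lemma\<close>

definition rotate_sdp :: "'n::finite sqmat \<Rightarrow> 'n sdp \<Rightarrow> 'n sdp" where
  "rotate_sdp S P = \<lparr>equations = map (\<lambda>(A, b). (congr S A, b)) (equations P), objective = congr S (objective P)\<rparr>"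

lemma rotate_rotate: "rotate_sdp S (rotate_sdp T P) = rotate_sdp (S ** T) P"
  unfolding rotate_sdp_def by (simp add: congr_congr split_beta)

lemma rotate_one: "rotate_sdp (mat 1) P = P"
  unfolding rotate_sdp_def by simp

lemma transpose_inverse: "S' ** S = mat 1 \<Longrightarrow> transpose S ** transpose S' = mat 1"
  for S S' :: "'n::finite sqmat"
  by (simp add: matrix_transpose_mul[symmetric])

lemma reform_rotate:
  assumes "S ** S' = mat 1" shows "reform_step P (rotate_sdp S P)"
proof -
  have "S' ** S = mat 1" using assms by (simp add: matrix_left_right_inverse)
  then have "transpose S ** transpose S' = mat 1 \<and> transpose S' ** transpose S = mat 1"
    using assms by (simp add: transpose_inverse)
  then have "invertible (transpose S)" unfolding invertible_def by blast
  from reform_step.rotate[OF this, of P] show ?thesis unfolding rotate_sdp_def congr_def by simp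
qed

text \<open>The construction goes from the given program to an output of the algorithm, whereas the
  claim asks for the opposite direction.\<close>

lemma reform_step_reverse: "reform_step P Q \<Longrightarrow> reform_step Q P"
proof (induction rule: reform_step.induct)
  case (rotate T P)
  then obtain T' where T': "T ** T' = mat 1" "T' ** T = mat 1" unfolding invertible_def by blast
  then have inv: "transpose T' ** transpose T = mat 1"
    by (simp add: transpose_inverse)
  have eq: "\<lparr>equations = map (\<lambda>(A, b). (transpose T ** A ** T, b)) (equations P),
            objective = transpose T ** objective P ** T\<rparr> = rotate_sdp (transpose T) P"
    unfolding rotate_sdp_def congr_def by simp
  have "reform_step (rotate_sdp (transpose T) P) (rotate_sdp (transpose T') (rotate_sdp (transpose T) P))"
    by (rule reform_rotate[OF inv])
  then show ?case unfolding eq rotate_rotate inv rotate_one .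
next
  case (exchange i P j)
  let ?xs = "equations P"
  let ?Q = "P\<lparr>equations := ?xs[i := ?xs ! j, j := ?xs ! i]\<rparr>"
  have "reform_step ?Q (?Q\<lparr>equations := (equations ?Q)[i := equations ?Q ! j, j := equations ?Q ! i]\<rparr>)"
    using exchange by (intro reform_step.exchange) simp_all
  moreover have "(equations ?Q)[i := equations ?Q ! j, j := equations ?Q ! i] = ?xs"
    using exchange by (intro nth_equalityI) (auto simp: nth_list_update)
  ultimately show ?case by simp
next
  case (combine i P y)
  let ?xs = "equations P"
  let ?Q = "P\<lparr>equations := ?xs[i := (comb_lhs P y, comb_rhs P y)]\<rparr>"
  let ?z = "\<lambda>t. if t = i then 1 / y i else - y t / y i"
  have "reform_step ?Q (?Q\<lparr>equations := (equations ?Q)[i := (comb_lhs ?Q ?z, comb_rhs ?Q ?z)]\<rparr>)"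
    using combine by (intro reform_step.combine) simp_all
  moreover have "(comb_lhs ?Q ?z, comb_rhs ?Q ?z) = ?xs ! i"
    unfolding comb_eq_lincomb using lincomb_update_inverse[of i ?xs y, OF combine] by simp
  ultimately show ?case by simp
qed

lemma reform_steps_reverse: "reform_step\<^sup>*\<^sup>* P Q \<Longrightarrow> reform_step\<^sup>*\<^sup>* Q P"
  by (induction rule: rtranclp_induct) (auto intro: reform_step_reverse converse_rtranclp_into_rtranclp)

text \<open>Steinitz exchange: the next equation of \<open>Bs\<close> must involve some equation
  behind the prefix, since otherwise its matrix would be spanned by the matrices of the prefix. That
  equation is replaced and then swapped into place.\<close>

lemma reform_prefix:
  fixes P :: "'n::finite sdp"
  assumes "set Bs \<subseteq> span (set (equations P))"
    and "\<And>j. j < length Bs \<Longrightarrow> fst (Bs ! j) \<notin> span (fst ` set (take j Bs))"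
  shows "\<exists>P'. reform_step\<^sup>*\<^sup>* P P' \<and> take (length Bs) (equations P') = Bs \<and> objective P' = objective P \<and>
    length (equations P') = length (equations P) \<and> span (set (equations P')) = span (set (equations P))"
  using assms
proof (induction Bs rule: rev_induct)
  case Nil
  show ?case by (intro exI[of _ P]) simp
next
  case (snoc B Bs)
  let ?n = "length Bs"
  have "fst (Bs ! j) \<notin> span (fst ` set (take j Bs))" if "j < ?n" for j
    using snoc.prems(2)[of j] that by (simp add: nth_append)
  then obtain P' where P': "reform_step\<^sup>*\<^sup>* P P'" "take ?n (equations P') = Bs" "objective P' = objective P"
    "length (equations P') = length (equations P)" "span (set (equations P')) = span (set (equations P))"
    using snoc.IH snoc.prems(1) by auto
  let ?xs = "equations P'"
  have "B \<in> span (set ?xs)" using snoc.prems(1) P'(5) by simp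
  then obtain y where B: "B = lincomb ?xs y" using lincomb_span by blast
  have "\<exists>i<length ?xs. ?n \<le> i \<and> y i \<noteq> 0"
  proof (rule ccontr)
    assume "\<not> (\<exists>i<length ?xs. ?n \<le> i \<and> y i \<noteq> 0)"
    then have z: "y i = 0 \<or> i < ?n" if "i < length ?xs" for i using that by (meson not_less)
    have "y i *\<^sub>R fst (?xs ! i) \<in> span (fst ` set Bs)" if i: "i < length ?xs" for i
    proof (cases "i < ?n")
      case True
      then have "?xs ! i = Bs ! i" using P'(2) by (metis nth_take)
      then show ?thesis using True by (intro span_scale span_base) auto
    next
      case False then show ?thesis using z[OF i] by (simp add: span_zero)
    qed
    then have "fst B \<in> span (fst ` set Bs)"
      unfolding B lincomb_def fst_sum fst_scaleR by (intro span_sum) auto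
    then show False using snoc.prems(2)[of ?n] by simp
  qed
  then obtain i where i: "i < length ?xs" "?n \<le> i" "y i \<noteq> 0" by blast
  let ?P1 = "P'\<lparr>equations := ?xs[i := (comb_lhs P' y, comb_rhs P' y)]\<rparr>"
  have s1: "reform_step P' ?P1" using i by (intro reform_step.combine)
  have e1: "equations ?P1 = ?xs[i := B]" unfolding comb_eq_lincomb B by simp
  let ?ys = "equations ?P1"
  let ?P2 = "?P1\<lparr>equations := ?ys[?n := ?ys ! i, i := ?ys ! ?n]\<rparr>"
  have s2: "reform_step ?P1 ?P2" using i by (intro reform_step.exchange) (simp_all add: e1)
  have e2: "equations ?P2 = ?xs[i := B, ?n := ?xs[i := B] ! i, i := ?xs[i := B] ! ?n]" using e1 by simp
  have "take (Suc ?n) (equations ?P2) = Bs @ [B]"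
    unfolding e2 using i P'(2) by (subst take_Suc_conv_app_nth) (auto simp: nth_list_update)
  moreover have "set (?xs[i := B, ?n := ?xs[i := B] ! i, i := ?xs[i := B] ! ?n]) = set (?xs[i := B])"
    using i by (intro set_swap) simp_all
  then have "span (set (equations ?P2)) = span (set (equations P))"
    unfolding e2 using span_update[of i ?xs y, OF i(1,3)] P'(5) B by simp
  moreover have "reform_step\<^sup>*\<^sup>* P ?P2" using P'(1) s1 s2 by simp
  moreover have "length (equations ?P2) = length (equations P)" using e2 P'(4) by simp
  ultimately show ?case using P'(3) by (intro exI[of _ ?P2]) simp
qed

section \<open>Standard form\<close>

lemma rotate_is_sdp: "is_sdp P \<Longrightarrow> is_sdp (rotate_sdp S P)"
  unfolding is_sdp_def rotate_sdp_def by (auto simp: sym_mat_congr)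

lemma rotate_simps:
  "length (equations (rotate_sdp S P)) = length (equations P)"
  "i < length (equations P) \<Longrightarrow> equations (rotate_sdp S P) ! i = (congr S (fst (equations P ! i)), snd (equations P ! i))"
  "objective (rotate_sdp S P) = congr S (objective P)"
  unfolding rotate_sdp_def by (simp_all add: split_beta)

lemma rotate_comb: "comb_lhs (rotate_sdp S P) y = congr S (comb_lhs P y)" "comb_rhs (rotate_sdp S P) y = comb_rhs P y"
  unfolding comb_lhs_def comb_rhs_def rotate_simps(1)
  by (simp_all add: rotate_simps(2) linear_sum[OF linear_congr] linear_cmul[OF linear_congr])

lemma inner_congr_congr: "S' ** S = mat 1 \<Longrightarrow> congr S A \<bullet> congr (transpose S') X = A \<bullet> X"
  unfolding inner_congr by (simp add: congr_inverse transpose_inverse)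

text \<open>Primal points move by the transposed inverse, which keeps their inner products with the
  constraint matrices; dual slacks move like the data.\<close>

lemma rotate_feasible_P:
  assumes "is_sdp P" "S' ** S = mat 1" "feasible_P P X"
  shows "feasible_P (rotate_sdp S P) (congr (transpose S') X)"
  using assms(3) unfolding feasible_P_iff[OF assms(1)] feasible_P_iff[OF rotate_is_sdp[OF assms(1)]]
  by (simp add: rotate_simps psd_congr inner_congr_congr[OF assms(2)])

lemma rotate_feasible_D: "feasible_D P Z \<Longrightarrow> feasible_D (rotate_sdp S P) (congr S Z)"
  unfolding feasible_D_def dual_feasible_def rotate_comb rotate_simps linear_diff[OF linear_congr, symmetric]
  using psd_congr by blast

text \<open>The last two conditions take the place of maximal rank: every optimal solution is
  supported where the diagonal one is. In this form the information can be passed to facial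
  reduction.\<close>

definition standard_form :: "'n::finite set \<Rightarrow> 'n set \<Rightarrow> 'n sdp \<Rightarrow> 'n sqmat \<Rightarrow> 'n sqmat \<Rightarrow> bool" where
  "standard_form U L P X0 Z0 \<longleftrightarrow> is_sdp P \<and> diag_pos L X0 \<and> diag_pos U Z0 \<and> feasible_P P X0 \<and> feasible_D P Z0 \<and>
     slater_P P \<and> slater_D P \<and>
     (\<forall>X. feasible_P P X \<longrightarrow> X \<bullet> Z0 = 0 \<longrightarrow> supported_on X L) \<and>
     (\<forall>Z. feasible_D P Z \<longrightarrow> X0 \<bullet> Z = 0 \<longrightarrow> supported_on Z U)"

lemma rotate_slater:
  assumes "is_sdp P" "S ** S' = mat 1" "S' ** S = mat 1" "slater_P P" "slater_D P"
  shows "slater_P (rotate_sdp S P)" "slater_D (rotate_sdp S P)"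
proof -
  obtain X where "feasible_P P X" "pos_def X" using assms(4) unfolding slater_P_def by blast
  then show "slater_P (rotate_sdp S P)" unfolding slater_P_def
    using rotate_feasible_P[OF assms(1,3), of X] pos_def_congr[OF _ transpose_inverse[OF assms(3)], of X]
    by (intro exI[of _ "congr (transpose S') X"]) simp
  obtain Z where "feasible_D P Z" "pos_def Z" using assms(5) unfolding slater_D_def by blast
  then show "slater_D (rotate_sdp S P)" unfolding slater_D_def
    using rotate_feasible_D[of P Z S] pos_def_congr[OF _ assms(3), of Z] by (intro exI[of _ "congr S Z"]) simp
qed

text \<open>A rotation that mixes only indices outside \<open>U\<close> and \<open>L\<close> fixes
  every matrix supported on \<open>U\<close> or on \<open>L\<close>, in particular \<open>X0\<close>
  and \<open>Z0\<close>; the support conditions are pulled back with the inverse rotation.\<close>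

lemma standard_form_rotate:
  assumes sf: "standard_form U L P X0 Z0" and inv: "S ** S' = mat 1" "S' ** S = mat 1"
    and io: "identity_off M S" "identity_off M S'" and d: "U \<inter> M = {}" "L \<inter> M = {}"
  shows "standard_form U L (rotate_sdp S P) X0 Z0"
proof -
  have sdp: "is_sdp P" and X0: "diag_pos L X0" and Z0: "diag_pos U Z0"
    and fX: "feasible_P P X0" and fZ: "feasible_D P Z0"
    and sl: "slater_P P" "slater_D P"
    and FP: "\<And>X. feasible_P P X \<Longrightarrow> X \<bullet> Z0 = 0 \<Longrightarrow> supported_on X L"
    and FD: "\<And>Z. feasible_D P Z \<Longrightarrow> X0 \<bullet> Z = 0 \<Longrightarrow> supported_on Z U"
    using sf unfolding standard_form_def by auto
  note tio = identity_off_transpose[OF io(1)] identity_off_transpose[OF io(2)]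
  have sX: "supported_on X0 L" and sZ: "supported_on Z0 U" using X0 Z0 diag_pos_iff by blast+
  have X0': "congr (transpose S') X0 = X0" by (rule congr_supported_off[OF tio(2) sX d(2)])
  have Z0': "congr S Z0 = Z0" by (rule congr_supported_off[OF io(1) sZ d(1)])
  have cancel: "rotate_sdp S' (rotate_sdp S P) = P" by (simp add: rotate_rotate inv rotate_one)
  note sdp' = rotate_is_sdp[OF sdp, of S]
  have "supported_on X L" if X: "feasible_P (rotate_sdp S P) X" "X \<bullet> Z0 = 0" for X
  proof -
    have "feasible_P P (congr (transpose S) X)"
      using rotate_feasible_P[OF sdp' inv(1) X(1)] unfolding cancel .
    moreover have "congr (transpose S) X \<bullet> Z0 = 0"
      using X(2) unfolding inner_congr by (simp add: Z0')
    ultimately have s: "supported_on (congr (transpose S) X) L" by (rule FP)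
    have "X = congr (transpose S') (congr (transpose S) X)"
      using transpose_inverse[OF inv(1)] by (simp add: congr_inverse)
    also have "\<dots> = congr (transpose S) X" by (rule congr_supported_off[OF tio(2) s d(2)])
    finally show ?thesis using s by simp
  qed
  moreover have "supported_on Z U" if Z: "feasible_D (rotate_sdp S P) Z" "X0 \<bullet> Z = 0" for Z
  proof -
    have "feasible_D P (congr S' Z)" using rotate_feasible_D[OF Z(1), of S'] unfolding cancel .
    moreover have "congr S' Z \<bullet> X0 = 0"
      using Z(2) unfolding inner_congr by (simp add: X0' inner_commute)
    ultimately have s: "supported_on (congr S' Z) U" using FD by (metis inner_commute)
    have "Z = congr S (congr S' Z)" using inv(1) by (simp add: congr_inverse)
    also have "\<dots> = congr S' Z" by (rule congr_supported_off[OF io(1) s d(1)])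
    finally show ?thesis using s by simp
  qed
  ultimately show ?thesis unfolding standard_form_def
    using sdp' X0 Z0 rotate_feasible_P[OF sdp inv(2) fX] rotate_feasible_D[OF fZ, of S]
      rotate_slater[OF sdp inv sl] by (simp add: X0' Z0')
qed

section \<open>Moving a pair of maximum rank solutions into the diagonal corners\<close>

lemma rank_congr_le: "rank (congr S M) \<le> rank M"
  unfolding congr_def using rank_mul_le_left rank_mul_le_right order_trans by blast

text \<open>The kernel of \<open>X + X0\<close> lies in that of \<open>X0\<close>, the vectors
  vanishing on \<open>L\<close>; the rank bound makes the two equal. So the sum annihilates the unit
  vectors outside \<open>L\<close>, and both nonnegative diagonals are zero there.\<close>

lemma psd_rank_supported:
  fixes X :: "'n::finite sqmat"
  assumes X: "psd X" and X0: "diag_pos L X0" and r: "rank (X + X0) \<le> card L"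
  shows "supported_on X L"
proof (rule psd_supported[OF X])
  fix a assume a: "a \<notin> L"
  let ?M = "X + X0"
  have pX0: "psd X0" using X0 by (rule diag_pos_psd)
  have M: "psd ?M" using X pX0 by (rule psd_add)
  have symM: "sym_mat ?M" using M unfolding psd_def by blast
  let ?K = "{y. ?M *v y = 0}" and ?V = "{x::real^'n. \<forall>i. i \<notin> - L \<longrightarrow> x $ i = 0}"
  have "?K \<subseteq> ?V"
  proof
    fix y assume "y \<in> ?K"
    then have "y \<bullet> (?M *v y) = 0" by simp
    then have "y \<bullet> (X *v y) + y \<bullet> (X0 *v y) = 0"
      by (simp add: matrix_vector_mult_add_rdistrib inner_add_right)
    moreover have "0 \<le> y \<bullet> (X *v y)" "0 \<le> y \<bullet> (X0 *v y)" using X pX0 unfolding psd_def by auto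
    ultimately have "X0 *v y = 0" using psd_quadratic_zero[OF pX0] by auto
    moreover have "(X0 *v y) $ i = X0 $ i $ i * y $ i" for i
    proof -
      have "X0 $ i $ j * y $ j = (if j = i then X0 $ i $ i * y $ i else 0)" for j
        using X0 unfolding diag_pos_def by auto
      then have "(\<Sum>j\<in>UNIV. X0 $ i $ j * y $ j) = (\<Sum>j\<in>UNIV. if j = i then X0 $ i $ i * y $ i else 0)"
        by (intro sum.cong refl)
      then show ?thesis unfolding matrix_vector_mult_def by simp
    qed
    ultimately have "X0 $ i $ i * y $ i = 0" for i by (metis zero_index)
    moreover have "X0 $ i $ i \<noteq> 0" if "i \<in> L" for i using X0 that unfolding diag_pos_def by (metis less_irrefl)
    ultimately show "y \<in> ?V" by auto
  qed
  moreover have "subspace ?K"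
    unfolding subspace_def by (simp add: matrix_vector_right_distrib matrix_vector_mult_scaleR)
  moreover have "subspace ?V" by (auto simp: subspace_def)
  moreover have "dim ?V \<le> dim ?K"
  proof -
    have "{y \<in> UNIV. \<forall>x\<in>range ((*v) ?M). orthogonal x y} = ?K"
    proof -
      have "(\<forall>x\<in>range ((*v) ?M). orthogonal x y) \<longleftrightarrow> (\<forall>x. x \<bullet> (?M *v y) = 0)" for y
        unfolding orthogonal_def using sym_bilinear[OF symM] by (auto simp: inner_commute)
      moreover have "(\<forall>x. x \<bullet> (?M *v y) = 0) \<longleftrightarrow> ?M *v y = 0" for y
        by (metis inner_eq_zero_iff inner_zero_right)
      ultimately show ?thesis by simp
    qed
    moreover have "subspace (range ((*v) ?M))"
      by (rule linear_subspace_image[OF matrix_vector_mul_linear subspace_UNIV])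
    ultimately have "dim ?K + rank ?M = CARD('n)"
      using dim_subspace_orthogonal_to_vectors[of "range ((*v) ?M)" UNIV] unfolding rank_dim_range
      by (simp add: subspace_UNIV)
    moreover have "card (- L) = CARD('n) - card L" by (simp add: Compl_eq_Diff_UNIV card_Diff_subset)
    ultimately show ?thesis using r unfolding dim_vectors_supported by linarith
  qed
  ultimately have "?K = ?V" by (intro subspace_dim_equal)
  moreover have "axis a 1 \<in> ?V" using a by (auto simp: axis_nth_if)
  ultimately have "?M *v axis a 1 = 0" by blast
  then have "?M $ a $ a = 0" unfolding axis_bilinear[symmetric] by simp
  then have "X $ a $ a + X0 $ a $ a = 0" by simp
  then show "X $ a $ a = 0" using psd_diag[OF X, of a] psd_diag[OF pX0, of a] by linarith
qed

text \<open>After \<open>Z\<close> is diagonalized, orthogonality confines the rotated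
  \<open>X\<close> to the indices where \<open>Z\<close> vanishes; a second rotation on those
  indices diagonalizes \<open>X\<close> without touching \<open>Z\<close>.\<close>

lemma psd_pair_diagonalization:
  fixes X Z :: "'n::finite sqmat"
  assumes X: "psd X" and Z: "psd Z" and XZ: "X \<bullet> Z = 0"
  shows "\<exists>V B0 B1. orthogonal_matrix V \<and> B0 \<inter> B1 = {} \<and> diag_pos B1 (congr V X) \<and> diag_pos B0 (congr V Z)"
proof -
  obtain V1 where V1: "orthogonal_matrix V1"
    and ip: "Z \<bullet> X = (\<Sum>a\<in>UNIV. congr V1 Z $ a $ a * congr V1 X $ a $ a)"
    and dZ: "\<And>a b. a \<noteq> b \<Longrightarrow> congr V1 Z $ a $ b = 0"
    by (rule psd_inner_via_diagonal[OF Z X]) (rule that)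
  let ?Z = "congr V1 Z" and ?X = "congr V1 X"
  have pZ: "psd ?Z" and pX: "psd ?X" using X Z psd_congr by blast+
  define B0 where "B0 = {a. ?Z $ a $ a \<noteq> 0}"
  have dpZ: "diag_pos B0 ?Z"
    unfolding diag_pos_def B0_def
    by (intro allI, rename_tac a b, case_tac "a = b") (use dZ psd_diag[OF pZ] in \<open>auto simp: less_le\<close>)
  have "\<forall>a\<in>UNIV. ?Z $ a $ a * ?X $ a $ a = 0"
    using ip XZ psd_diag[OF pZ] psd_diag[OF pX]
    by (subst sum_nonneg_eq_0_iff[symmetric]) (auto simp: inner_commute)
  then have "?X $ a $ a = 0" if "a \<in> B0" for a using that unfolding B0_def by auto
  then have sX: "supported_on ?X (- B0)" by (intro psd_supported[OF pX]) auto
  have symX: "sym_mat ?X" using pX unfolding psd_def by blast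
  obtain V2 where V2: "orthogonal_matrix V2" "identity_off (- B0) V2"
    and dX: "\<And>a b. a \<in> - B0 \<Longrightarrow> b \<in> - B0 \<Longrightarrow> a \<noteq> b \<Longrightarrow> congr V2 ?X $ a $ b = 0"
    by (rule orthogonal_matrix_diagonalizes[OF symX, of "- B0"]) (rule that)
  have "congr V2 ?Z = ?Z"
    using dpZ diag_pos_iff by (intro congr_supported_off[OF V2(2)]) auto
  moreover have sX2: "supported_on (congr V2 ?X) (- B0)" by (rule congr_supported[OF V2(2) sX]) simp
  define B1 where "B1 = {a. congr V2 ?X $ a $ a \<noteq> 0}"
  have "congr V2 ?X $ a $ b = 0" if "a \<noteq> b" for a b
    using dX[OF _ _ that] sX2 unfolding supported_on_def by blast
  then have "diag_pos B1 (congr V2 ?X)"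
    unfolding diag_pos_def B1_def
    by (intro allI, rename_tac a b, case_tac "a = b")
      (use psd_diag[OF psd_congr[OF pX], of V2] in \<open>auto simp: less_le\<close>)
  moreover have "B0 \<inter> B1 = {}" using sX2 unfolding B1_def supported_on_def by blast
  moreover have "orthogonal_matrix (V2 ** V1)" using V1 V2(1) by (simp add: orthogonal_matrix_mul)
  ultimately show ?thesis using dpZ
    by (intro exI[of _ "V2 ** V1"] exI[of _ B0] exI[of _ B1]) (simp add: congr_congr[symmetric])
qed

lemma exists_permutation:
  fixes A B A' B' :: "'n::finite set"
  assumes "A \<inter> B = {}" "A' \<inter> B' = {}" "card A = card A'" "card B = card B'"
  shows "\<exists>\<pi>. bij \<pi> \<and> (\<forall>a. \<pi> a \<in> A' \<longleftrightarrow> a \<in> A) \<and> (\<forall>a. \<pi> a \<in> B' \<longleftrightarrow> a \<in> B)"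
proof -
  obtain f where f: "bij_betw f A A'" using finite_same_card_bij[OF finite finite assms(3)] by blast
  obtain g where g: "bij_betw g B B'" using finite_same_card_bij[OF finite finite assms(4)] by blast
  have "card (- (A \<union> B)) = card (- (A' \<union> B'))"
    using assms by (simp add: Compl_eq_Diff_UNIV card_Diff_subset card_Un_disjoint)
  then obtain h where h: "bij_betw h (- (A \<union> B)) (- (A' \<union> B'))" using finite_same_card_bij[OF finite finite] by blast
  let ?g = "\<lambda>x. if x \<in> A then f x else g x"
  let ?\<pi> = "\<lambda>x. if x \<in> A \<union> B then ?g x else h x"
  have "bij_betw ?g (A \<union> B) (A' \<union> B')" by (rule bij_betw_disjoint_Un[OF f g assms(1,2)])
  then have "bij_betw ?\<pi> ((A \<union> B) \<union> - (A \<union> B)) ((A' \<union> B') \<union> - (A' \<union> B'))"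
    by (rule bij_betw_disjoint_Un[OF _ h]) auto
  then have "bij ?\<pi>" by (simp only: Compl_partition)
  moreover have "?\<pi> a \<in> A' \<longleftrightarrow> a \<in> A" "?\<pi> a \<in> B' \<longleftrightarrow> a \<in> B" for a
    using bij_betwE[OF f] bij_betwE[OF g] bij_betwE[OF h] assms(1,2) by (cases "a \<in> A"; cases "a \<in> B"; force)+
  ultimately show ?thesis by (intro exI[of _ ?\<pi>]) blast
qed

lemma exists_standard_form:
  fixes P :: "'n::{finite,linorder} sdp"
  assumes sdp: "is_sdp P" and sc: "fails_strict_complementarity P" and sl: "slater_P P" "slater_D P"
  shows "\<exists>S S' r s X0 Z0. S ** S' = mat 1 \<and> S' ** S = mat 1 \<and> r + s < CARD('n) \<and>
    standard_form (upper_left s) (lower_right r) (rotate_sdp S P) X0 Z0"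
proof -
  obtain X1 Z1 where pair: "optimal_pair P X1 Z1" and mP: "max_rank_optimal_P P X1" and mD: "max_rank_optimal_D P Z1"
    and rk: "rank X1 + rank Z1 < CARD('n)" using sc unfolding fails_strict_complementarity_def by blast
  have fX1: "feasible_P P X1" and fZ1: "feasible_D P Z1" and "mat_inner X1 Z1 = 0"
    using pair unfolding optimal_pair_def by auto
  then obtain y where y: "dual_feasible P y" "Z1 = objective P - comb_lhs P y" unfolding feasible_D_def by blast
  have pX: "psd X1" and pZ: "psd Z1" using fX1 y unfolding feasible_P_def dual_feasible_def by auto
  then have XZ: "X1 \<bullet> Z1 = 0" using \<open>mat_inner X1 Z1 = 0\<close> by (simp add: mat_inner_psd)
  note optP = optimal_P_iff[OF sdp fX1 y XZ] and optD = optimal_D_iff[OF sdp fX1 y XZ]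
  obtain V B0 B1 where V: "orthogonal_matrix V" and B: "B0 \<inter> B1 = {}"
    and dX: "diag_pos B1 (congr V X1)" and dZ: "diag_pos B0 (congr V Z1)"
    using psd_pair_diagonalization[OF pX pZ XZ] by blast
  define r where "r = card B1"
  define s where "s = card B0"
  have "card (B0 \<union> B1) = s + r" using B unfolding r_def s_def by (simp add: card_Un_disjoint)
  moreover have "card (B0 \<union> B1) \<le> CARD('n)" by (rule card_mono) auto
  ultimately have le: "r \<le> CARD('n)" "s \<le> CARD('n)" "r + s \<le> CARD('n)" by auto
  let ?L = "lower_right r :: 'n set" and ?U = "upper_left s :: 'n set"
  obtain \<pi> where \<pi>: "bij \<pi>" "\<And>a. \<pi> a \<in> B0 \<longleftrightarrow> a \<in> ?U" "\<And>a. \<pi> a \<in> B1 \<longleftrightarrow> a \<in> ?L"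
    using exists_permutation[OF upper_left_lower_right_disjoint[OF le(3)] B] card_upper_left[OF le(2)]
      card_lower_right[OF le(1)] unfolding r_def s_def by metis
  \<comment> \<open>The permutation matrix of \<open>\<pi>\<close>; it moves the two supports into
    the lower right and upper left corners.\<close>
  define W :: "'n sqmat" where "W = (\<chi> a b. if b = \<pi> a then 1 else 0)"
  have inj\<pi>: "\<pi> a = \<pi> b \<longleftrightarrow> a = b" for a b using bij_is_inj[OF \<pi>(1)] by (simp add: inj_eq)
  have "(W ** transpose W) $ a $ b = (mat 1 :: 'n sqmat) $ a $ b" for a b
  proof -
    have "(W ** transpose W) $ a $ b = (\<Sum>c\<in>UNIV. if c = \<pi> a then (if a = b then 1 else 0) else 0)"
      unfolding matrix_matrix_mult_def transpose_def W_def vec_lambda_beta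
      by (intro sum.cong refl) (auto simp: inj\<pi>)
    then show ?thesis by (simp add: mat_def)
  qed
  then have "W ** transpose W = mat 1" by (simp add: vec_eq_iff)
  then have W: "orthogonal_matrix W" by (simp add: orthogonal_matrix_def matrix_left_right_inverse)
  have cp: "congr W M $ a $ b = M $ (\<pi> a) $ (\<pi> b)" for M a b
  proof -
    have "(\<Sum>d\<in>UNIV. W $ a $ c * M $ c $ d * W $ b $ d) = (if c = \<pi> a then M $ (\<pi> a) $ (\<pi> b) else 0)" for c
      by (simp add: W_def if_distrib cong: if_cong)
    then show ?thesis unfolding congr_nth by simp
  qed
  define S where "S = W ** V"
  define S' where "S' = transpose S"
  have "orthogonal_matrix S" unfolding S_def using W V by (rule orthogonal_matrix_mul)
  then have inv: "S ** S' = mat 1" "S' ** S = mat 1" unfolding S'_def by (simp_all add: orthogonal_matrix_inverse)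
  have tS': "transpose S' = S" unfolding S'_def by simp
  define X0 where "X0 = congr S X1"
  define Z0 where "Z0 = congr S Z1"
  have perm: "diag_pos R (congr W M)" if M: "diag_pos B M" and R: "\<And>a. \<pi> a \<in> B \<longleftrightarrow> a \<in> R" for R B M
    unfolding diag_pos_def cp
  proof (intro allI)
    fix a b
    have "if \<pi> a = \<pi> b \<and> \<pi> a \<in> B then 0 < M $ \<pi> a $ \<pi> b else M $ \<pi> a $ \<pi> b = 0"
      using M unfolding diag_pos_def by blast
    then show "if a = b \<and> a \<in> R then 0 < M $ \<pi> a $ \<pi> b else M $ \<pi> a $ \<pi> b = 0"
      unfolding inj\<pi> R .
  qed
  have X0: "diag_pos ?L X0" and Z0: "diag_pos ?U Z0"
    unfolding X0_def Z0_def S_def congr_congr[symmetric]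
    by (rule perm[OF dX \<pi>(3)], rule perm[OF dZ \<pi>(2)])
  have X1_le: "rank X1 \<le> card ?L" and r_le: "r \<le> rank X1"
    using rank_congr_le[of S' X0] rank_congr_le[of S X1] rank_diag_pos[OF X0] card_lower_right[OF le(1)]
    unfolding X0_def by (simp_all add: congr_inverse inv)
  have Z1_le: "rank Z1 \<le> card ?U" and s_le: "s \<le> rank Z1"
    using rank_congr_le[of S' Z0] rank_congr_le[of S Z1] rank_diag_pos[OF Z0] card_upper_left[OF le(2)]
    unfolding Z0_def by (simp_all add: congr_inverse inv)
  let ?P = "rotate_sdp S P"
  have sdp': "is_sdp ?P" using sdp by (rule rotate_is_sdp)
  have cancel: "rotate_sdp S' ?P = P" by (simp add: rotate_rotate inv rotate_one)
  have fX0: "feasible_P ?P X0" using rotate_feasible_P[OF sdp inv(2) fX1] unfolding X0_def tS' .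
  have fZ0: "feasible_D ?P Z0" using rotate_feasible_D[OF fZ1] unfolding Z0_def .
  have X0Z0: "X0 \<bullet> Z0 = 0"
    using inner_congr_congr[OF inv(2), of X1 Z1] XZ unfolding X0_def Z0_def tS' by simp
  have FP: "supported_on X ?L" if X: "feasible_P ?P X" "X \<bullet> Z0 = 0" for X
  proof -
    \<comment> \<open>The midpoint with \<open>X0\<close> is again optimal, so its rank is bounded
      by that of \<open>X1\<close>; the rank lemma then applies to the two halves.\<close>
    let ?M = "(1/2) *\<^sub>R X + (1/2) *\<^sub>R X0"
    have psX: "psd X" using X(1) unfolding feasible_P_def by blast
    have "psd ?M" using psX diag_pos_psd[OF X0] by (intro psd_add psd_scaleR) auto
    then have "feasible_P ?P ?M" using X(1) fX0 unfolding feasible_P_iff[OF sdp'] by (simp add: inner_add_right)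
    then have "feasible_P P (congr S' ?M)"
      using rotate_feasible_P[OF sdp' inv(1)] cancel by (simp add: S'_def)
    moreover have "?M \<bullet> Z0 = 0" using X(2) X0Z0 by (simp add: inner_add_left)
    then have "congr S' ?M \<bullet> Z1 = 0" unfolding inner_congr tS' Z0_def .
    ultimately have "optimal_P P (congr S' ?M)" unfolding optP by blast
    then have "rank (congr S' ?M) \<le> card ?L" using mP X1_le unfolding max_rank_optimal_P_def by force
    moreover have "?M = congr S (congr S' ?M)" using inv(1) by (simp only: congr_inverse)
    ultimately have "rank ?M \<le> card ?L" using rank_congr_le[of S "congr S' ?M"] by simp
    moreover have "psd ((1/2) *\<^sub>R X)" using psX by (rule psd_scaleR) simp
    moreover have "diag_pos ?L ((1/2) *\<^sub>R X0)" using X0 unfolding diag_pos_def by simp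
    ultimately have "supported_on ((1/2) *\<^sub>R X) ?L" using psd_rank_supported by blast
    then show ?thesis unfolding supported_on_def by simp
  qed
  have FD: "supported_on Z ?U" if Z: "feasible_D ?P Z" "X0 \<bullet> Z = 0" for Z
  proof -
    let ?M = "(1/2) *\<^sub>R Z + (1/2) *\<^sub>R Z0"
    have psZ: "psd Z" using Z(1) unfolding feasible_D_def dual_feasible_def by blast
    have psM: "psd ?M" using psZ diag_pos_psd[OF Z0] by (intro psd_add psd_scaleR) auto
    obtain u v where u: "Z = objective ?P - comb_lhs ?P u" and v: "Z0 = objective ?P - comb_lhs ?P v"
      using Z(1) fZ0 unfolding feasible_D_def by blast
    have "?M = objective ?P - comb_lhs ?P (\<lambda>i. (1/2) * u i + (1/2) * v i)"
    proof -
      have "comb_lhs ?P (\<lambda>i. (1/2) * u i + (1/2) * v i) = (1/2) *\<^sub>R comb_lhs ?P u + (1/2) *\<^sub>R comb_lhs ?P v"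
        unfolding comb_lhs_def by (simp add: scaleR_sum_right sum.distrib scaleR_add_left)
      moreover have "objective ?P = (1/2) *\<^sub>R objective ?P + (1/2) *\<^sub>R objective ?P"
        by (simp add: scaleR_add_left[symmetric])
      ultimately show ?thesis unfolding u v by (simp add: scaleR_diff_right)
    qed
    then have "feasible_D ?P ?M" using psM unfolding feasible_D_def dual_feasible_def by metis
    then have "feasible_D P (congr S' ?M)" using rotate_feasible_D[of ?P ?M S'] unfolding cancel by simp
    moreover have "?M \<bullet> X0 = 0" using Z(2) X0Z0 by (simp add: inner_commute[of _ X0] inner_add_right)
    then have "X1 \<bullet> congr S' ?M = 0" using inner_congr[of S' ?M X1] unfolding tS' X0_def by (metis inner_commute)
    ultimately have "optimal_D P (congr S' ?M)" unfolding optD by blast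
    then have "rank (congr S' ?M) \<le> card ?U" using mD Z1_le unfolding max_rank_optimal_D_def by force
    moreover have "?M = congr S (congr S' ?M)" using inv(1) by (simp only: congr_inverse)
    ultimately have "rank ?M \<le> card ?U" using rank_congr_le[of S "congr S' ?M"] by simp
    moreover have "psd ((1/2) *\<^sub>R Z)" using psZ by (rule psd_scaleR) simp
    moreover have "diag_pos ?U ((1/2) *\<^sub>R Z0)" using Z0 unfolding diag_pos_def by simp
    ultimately have "supported_on ((1/2) *\<^sub>R Z) ?U" using psd_rank_supported by blast
    then show ?thesis unfolding supported_on_def by simp
  qed
  have "standard_form ?U ?L ?P X0 Z0"
    unfolding standard_form_def using sdp' X0 Z0 fX0 fZ0 rotate_slater[OF sdp inv sl] FP FD by blast
  moreover have "r + s < CARD('n)" using rk r_le s_le by linarith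
  ultimately show ?thesis using inv by blast
qed

subsection \<open>Facial reduction of a program in standard form\<close>

text \<open>Combinations with right hand side \<open>0\<close> are orthogonal to all feasible
  points, in particular to the optimal ones. The first sequence is taken from here.\<close>

definition primal_space :: "'n::finite sdp \<Rightarrow> 'n sqmat set" where
  "primal_space P = {A. (A, 0) \<in> span (set (equations P))}"

text \<open>A dual feasible \<open>Z0\<close> stands in for the objective, from which it differs by
  a combination of the constraint matrices; members are then orthogonal to all dual slacks.\<close>

definition dual_space :: "'n::finite sdp \<Rightarrow> 'n sqmat \<Rightarrow> 'n sqmat set" where
  "dual_space P Z0 = {Y. sym_mat Y \<and> (\<forall>i<length (equations P). fst (equations P ! i) \<bullet> Y = 0) \<and> Z0 \<bullet> Y = 0}"

lemma mem_primal_space: "A \<in> primal_space P \<longleftrightarrow> (\<exists>y. A = comb_lhs P y \<and> comb_rhs P y = 0)"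
  unfolding primal_space_def mem_Collect_eq lincomb_span comb_eq_lincomb[symmetric] by auto

lemma subspace_primal_space: "subspace (primal_space P)"
proof (rule subspaceI)
  let ?S = "span (set (equations P))"
  show "0 \<in> primal_space P" using span_zero[of "set (equations P)"] by (simp add: primal_space_def zero_prod_def)
  fix A B assume "A \<in> primal_space P" "B \<in> primal_space P"
  then show "A + B \<in> primal_space P" using span_add[of "(A, 0)" _ "(B, 0)"] by (simp add: primal_space_def)
next
  fix A c assume "A \<in> primal_space P"
  then show "c *\<^sub>R A \<in> primal_space P" using span_scale[of "(A, 0)" _ c] by (simp add: primal_space_def)
qed

lemma subspace_dual_space: "subspace (dual_space P Z0)"
  unfolding subspace_def dual_space_def
  by (auto intro: sym_mat_intros simp: inner_add_right) (simp add: sym_mat_iff)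

lemma primal_space_rotate: "A \<in> primal_space P \<Longrightarrow> congr S A \<in> primal_space (rotate_sdp S P)"
  unfolding mem_primal_space rotate_comb by blast

lemma dual_space_rotate:
  assumes "S' ** S = mat 1" "congr S Z0 = Z0" "Y \<in> dual_space P Z0"
  shows "congr (transpose S') Y \<in> dual_space (rotate_sdp S P) Z0"
proof -
  have "Z0 \<bullet> congr (transpose S') Y = congr S Z0 \<bullet> congr (transpose S') Y" by (simp only: assms(2))
  also have "\<dots> = Z0 \<bullet> Y" by (rule inner_congr_congr[OF assms(1)])
  finally show ?thesis using assms(3) unfolding dual_space_def
    by (auto simp: rotate_simps inner_congr_congr[OF assms(1)] sym_mat_congr)
qed

lemma standard_form_sym: "standard_form U L P X0 Z0 \<Longrightarrow> A \<in> primal_space P \<Longrightarrow> sym_mat A"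
  unfolding mem_primal_space standard_form_def using sym_comb_lhs by blast

lemma primal_space_inner:
  "is_sdp P \<Longrightarrow> feasible_P P X \<Longrightarrow> A \<in> primal_space P \<Longrightarrow> A \<bullet> X = 0"
  unfolding mem_primal_space using comb_inner_feasible by metis

lemma standard_form_orthogonal:
  assumes "standard_form U L P X0 Z0" "U \<inter> L = {}"
  shows "X0 \<bullet> Z0 = 0"
  using assms unfolding standard_form_def diag_pos_iff
  by (intro supported_inner_zero[of Z0 U]) (auto simp: supported_on_def)

text \<open>With zero right hand sides, every dual slack would have the same inner product with
  \<open>X0\<close> as \<open>Z0\<close> has, namely zero; a positive definite slack contradicts
  this because \<open>X0\<close> is nonzero.\<close>

lemma exists_rhs_nonzero:
  assumes sf: "standard_form U L P X0 Z0" and d: "U \<inter> L = {}" and L: "L \<noteq> {}"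
  shows "\<exists>j<length (equations P). snd (equations P ! j) \<noteq> 0"
proof (rule ccontr)
  assume "\<not> ?thesis"
  then have z: "comb_rhs P y = 0" for y unfolding comb_rhs_def by auto
  have sdp: "is_sdp P" and fX: "feasible_P P X0" and X0: "diag_pos L X0" and fZ: "feasible_D P Z0"
    using sf unfolding standard_form_def by auto
  obtain Z where Z: "feasible_D P Z" "pos_def Z" using sf unfolding standard_form_def slater_D_def by blast
  have in0: "Z' \<bullet> X0 = objective P \<bullet> X0" if "feasible_D P Z'" for Z'
    using that comb_inner_feasible[OF sdp fX] z unfolding feasible_D_def by (auto simp: inner_diff_left)
  obtain a where "a \<in> L" using L by blast
  then have "X0 $ a $ a \<noteq> 0" using X0 unfolding diag_pos_def by (metis less_irrefl)
  then have "X0 \<noteq> 0" by auto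
  then have "0 < Z \<bullet> X0" using pos_def_inner_pos[OF Z(2) diag_pos_psd[OF X0]] by blast
  then show False
    using in0[OF Z(1)] in0[OF fZ] standard_form_orthogonal[OF sf d] by (simp add: inner_commute)
qed

text \<open>A matrix in the cone spanned by the optimal solutions becomes feasible after adding a multiple
  of \<open>X0\<close> and rescaling.\<close>

lemma primal_cone_supported:
  assumes sf: "standard_form U L P X0 Z0" and d: "U \<inter> L = {}" and L: "L \<noteq> {}"
    and X: "psd X" "supported_on X (- U)" "\<forall>V\<in>primal_space P. V \<bullet> X = 0"
  shows "supported_on X L"
proof -
  have sdp: "is_sdp P" and fX: "feasible_P P X0" and X0: "diag_pos L X0" and Z0: "diag_pos U Z0"
    using sf unfolding standard_form_def by auto
  let ?e = "equations P"
  obtain j where j: "j < length ?e" "snd (?e ! j) \<noteq> 0" using exists_rhs_nonzero[OF sf d L] by blast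
  define \<mu> where "\<mu> = fst (?e ! j) \<bullet> X / snd (?e ! j)"
  \<comment> \<open>The combination \<open>b\<^sub>j A\<^sub>i - b\<^sub>i A\<^sub>j\<close> has
    right hand side \<open>0\<close>; orthogonality to it shows that \<open>X\<close> satisfies all
    equations up to one common factor \<open>\<mu>\<close>.\<close>
  have AX: "fst (?e ! i) \<bullet> X = \<mu> * snd (?e ! i)" if i: "i < length ?e" for i
  proof -
    let ?V = "snd (?e ! j) *\<^sub>R fst (?e ! i) - snd (?e ! i) *\<^sub>R fst (?e ! j)"
    have "snd (?e ! j) *\<^sub>R ?e ! i - snd (?e ! i) *\<^sub>R ?e ! j \<in> span (set ?e)"
      using i j by (intro span_diff span_scale span_base nth_mem)
    moreover have "snd (?e ! j) *\<^sub>R ?e ! i - snd (?e ! i) *\<^sub>R ?e ! j = (?V, 0)"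
      by (rule prod_eqI) simp_all
    ultimately have "?V \<bullet> X = 0" using X(3) unfolding primal_space_def by simp
    then have "snd (?e ! j) * (fst (?e ! i) \<bullet> X) = snd (?e ! i) * (fst (?e ! j) \<bullet> X)"
      by (simp add: inner_diff_left)
    then show ?thesis using j(2) unfolding \<mu>_def by (simp add: field_simps)
  qed
  \<comment> \<open>This makes \<open>\<mu> + c\<close> positive whatever the sign of
    \<open>\<mu>\<close>, so that dividing by it is possible and preserves semidefiniteness.\<close>
  define c where "c = \<bar>\<mu>\<bar> + 1"
  have c: "0 < c" "0 < \<mu> + c" unfolding c_def by auto
  let ?X = "(1 / (\<mu> + c)) *\<^sub>R (X + c *\<^sub>R X0)"
  have "psd ?X" using X(1) diag_pos_psd[OF X0] c by (intro psd_scaleR psd_add) auto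
  moreover have "fst (?e ! i) \<bullet> ?X = snd (?e ! i)" if i: "i < length ?e" for i
    using AX[OF i] fX i c unfolding feasible_P_iff[OF sdp]
    by (simp add: inner_add_right distrib_right[symmetric])
  ultimately have "feasible_P P ?X" unfolding feasible_P_iff[OF sdp] by blast
  moreover have "X \<bullet> Z0 = 0"
    using X(2) Z0 unfolding diag_pos_iff by (intro supported_inner_zero[of Z0 U]) (auto simp: supported_on_def)
  then have "?X \<bullet> Z0 = 0" using standard_form_orthogonal[OF sf d] by (simp add: inner_add_left)
  ultimately have s: "supported_on ?X L" using sf unfolding standard_form_def by blast
  show ?thesis
  proof (rule psd_supported[OF X(1)])
    fix a assume "a \<notin> L"
    then have "?X $ a $ a = 0" using s unfolding supported_on_def by blast
    then have "X $ a $ a + c * X0 $ a $ a = 0" using c by simp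
    moreover have "0 \<le> c * X0 $ a $ a" using c psd_diag[OF diag_pos_psd[OF X0], of a] by simp
    ultimately show "X $ a $ a = 0" using psd_diag[OF X(1), of a] by linarith
  qed
qed

text \<open>Orthogonality to \<open>dual_space\<close> puts \<open>Z\<close> into the span of
  \<open>Z0\<close> and the constraint matrices; adding a multiple of \<open>Z0\<close> and
  rescaling then yields a dual slack.\<close>

lemma dual_cone_supported:
  assumes sf: "standard_form U L P X0 Z0" and d: "U \<inter> L = {}"
    and Z: "psd Z" "supported_on Z (- L)" "\<forall>Y\<in>dual_space P Z0. Y \<bullet> Z = 0"
  shows "supported_on Z U"
proof -
  have sdp: "is_sdp P" and fZ: "feasible_D P Z0" and X0: "diag_pos L X0" and Z0: "diag_pos U Z0"
    using sf unfolding standard_form_def by auto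
  let ?e = "equations P"
  let ?W = "insert Z0 (set (map fst ?e))"
  have "span ?W \<subseteq> {M. sym_mat M}"
    using is_sdp_nth[OF sdp] diag_pos_sym[OF Z0]
    by (intro span_minimal subspace_sym_mat) (auto simp: in_set_conv_nth, metis fst_conv)
  \<comment> \<open>The component \<open>u\<close> orthogonal to the span is symmetric, hence in
    \<open>dual_space\<close>; it is therefore orthogonal to \<open>Z\<close> and so to
    itself.\<close>
  moreover obtain w u where w: "w \<in> span ?W" and u: "\<And>v. v \<in> span ?W \<Longrightarrow> orthogonal u v" and wu: "Z = w + u"
    using orthogonal_subspace_decomp_exists by blast
  ultimately have "sym_mat w" by blast
  then have "sym_mat (Z - w)" using Z(1) unfolding psd_def by (intro sym_mat_intros) simp_all
  then have "sym_mat u" using wu by simp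
  moreover have "fst (?e ! i) \<bullet> u = 0" if "i < length ?e" for i
    using u[OF span_base, of "fst (?e ! i)"] that by (auto simp: orthogonal_def inner_commute)
  moreover have "Z0 \<bullet> u = 0" using u[OF span_base, of Z0] by (simp add: orthogonal_def inner_commute)
  ultimately have "u \<bullet> Z = 0" using Z(3) unfolding dual_space_def by blast
  moreover have "u \<bullet> w = 0" using u[OF w] by (simp add: orthogonal_def)
  ultimately have "u = 0" using wu by (simp add: inner_add_right)
  then have "Z \<in> span ?W" using w wu by simp
  then obtain \<mu> where "Z - \<mu> *\<^sub>R Z0 \<in> span (set (map fst ?e))" unfolding span_insert by blast
  then obtain y where "Z - \<mu> *\<^sub>R Z0 = lincomb (map fst ?e) y" using lincomb_span by blast
  then have Zy: "Z = \<mu> *\<^sub>R Z0 + comb_lhs P y"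
    unfolding lincomb_def comb_lhs_def by (simp add: algebra_simps)
  obtain y0 where y0: "Z0 = objective P - comb_lhs P y0" using fZ unfolding feasible_D_def by blast
  define c where "c = \<bar>\<mu>\<bar> + 1"
  have c: "0 < c" "0 < \<mu> + c" unfolding c_def by auto
  let ?t = "1 / (\<mu> + c)"
  let ?Z = "?t *\<^sub>R (Z + c *\<^sub>R Z0)"
  have ps: "psd ?Z" using Z(1) diag_pos_psd[OF Z0] c by (intro psd_scaleR psd_add) auto
  have "?Z = ?t *\<^sub>R ((\<mu> + c) *\<^sub>R Z0) + ?t *\<^sub>R comb_lhs P y"
    unfolding Zy by (simp add: scaleR_add_left scaleR_add_right)
  also have "?t *\<^sub>R ((\<mu> + c) *\<^sub>R Z0) = Z0" using c by simp
  also have "Z0 + ?t *\<^sub>R comb_lhs P y = objective P - comb_lhs P (\<lambda>i. y0 i - ?t * y i)"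
    unfolding y0 comb_lhs_def by (simp add: scaleR_sum_right sum_subtractf scaleR_diff_left)
  finally have "feasible_D P ?Z" using ps unfolding feasible_D_def dual_feasible_def by metis
  moreover have "X0 \<bullet> Z = 0"
    using Z(2) X0 unfolding diag_pos_iff
    by (subst inner_commute, intro supported_inner_zero[of X0 L]) (auto simp: supported_on_def)
  then have "X0 \<bullet> ?Z = 0" using standard_form_orthogonal[OF sf d] by (simp add: inner_add_right)
  ultimately have s: "supported_on ?Z U" using sf unfolding standard_form_def by blast
  show ?thesis
  proof (rule psd_supported[OF Z(1)])
    fix a assume "a \<notin> U"
    then have "?Z $ a $ a = 0" using s unfolding supported_on_def by blast
    then have "Z $ a $ a + c * Z0 $ a $ a = 0" using c by simp
    moreover have "0 \<le> c * Z0 $ a $ a" using c psd_diag[OF diag_pos_psd[OF Z0], of a] by simp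
    ultimately show "Z $ a $ a = 0" using psd_diag[OF Z(1), of a] by linarith
  qed
qed

text \<open>If \<open>U\<close> were empty, then \<open>Z0 = 0\<close>, so every feasible
  \<open>X\<close> would be optimal and supported on \<open>L\<close>; a positive definite one is
  not, as some index lies outside. The other case is dual.\<close>

lemma standard_form_nonempty:
  assumes sf: "standard_form U L P X0 Z0" and M: "U \<union> L \<noteq> UNIV"
  shows "U \<noteq> {}" "L \<noteq> {}"
proof -
  obtain a where a: "a \<notin> U" "a \<notin> L" using M by blast
  obtain X where X: "feasible_P P X" "pos_def X" using sf unfolding standard_form_def slater_P_def by blast
  obtain Z where Z: "feasible_D P Z" "pos_def Z" using sf unfolding standard_form_def slater_D_def by blast
  have diag: "diag_pos L X0" "diag_pos U Z0" using sf unfolding standard_form_def by auto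
  show "U \<noteq> {}"
  proof
    assume "U = {}"
    then have "Z0 = 0" using diag(2) by (simp add: diag_pos_def vec_eq_iff)
    then have "supported_on X L" using sf X unfolding standard_form_def by simp
    then have "X $ a $ a = 0" using a unfolding supported_on_def by blast
    then show False using pos_def_diag[OF X(2), of a] by simp
  qed
  show "L \<noteq> {}"
  proof
    assume "L = {}"
    then have "X0 = 0" using diag(1) by (simp add: diag_pos_def vec_eq_iff)
    then have "supported_on Z U" using sf Z unfolding standard_form_def by simp
    then have "Z $ a $ a = 0" using a unfolding supported_on_def by blast
    then show False using pos_def_diag[OF Z(2), of a] by simp
  qed
qed

subsection \<open>Reaching a program in standard form\<close>

definition level_function :: "'n::finite set \<Rightarrow> 'n set \<Rightarrow> nat \<Rightarrow> ('n \<Rightarrow> nat) \<Rightarrow> bool" where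
  "level_function U L k p \<longleftrightarrow> (\<forall>a. p a = 0 \<longleftrightarrow> a \<in> U) \<and> (\<forall>a. p a = Suc k \<longleftrightarrow> a \<in> L) \<and>
     (\<forall>a. p a \<le> Suc k) \<and> (\<forall>i\<in>{1..k}. \<exists>a. p a = i)"

lemma level_function_bounds:
  assumes p: "level_function U L k p" and M: "U \<union> L \<noteq> UNIV"
  shows "k \<in> {1..card (- (U \<union> L))}"
proof -
  obtain a where a: "a \<notin> U" "a \<notin> L" using M by blast
  then have "p a \<noteq> 0" "p a \<noteq> Suc k" "p a \<le> Suc k" using p unfolding level_function_def by auto
  then have "1 \<le> k" by linarith
  have "{1..k} \<subseteq> p ` (- (U \<union> L))"
  proof
    fix i assume i: "i \<in> {1..k}"
    then obtain b where b: "p b = i" using p unfolding level_function_def by blast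
    then have "p b \<noteq> 0" "p b \<noteq> Suc k" using i by auto
    then have "b \<notin> U" "b \<notin> L" using p unfolding level_function_def by auto
    then show "i \<in> p ` (- (U \<union> L))" using b by blast
  qed
  then have "card {1..k} \<le> card (p ` (- (U \<union> L)))" by (intro card_mono) auto
  also have "\<dots> \<le> card (- (U \<union> L))" by (rule card_image_le) simp
  finally show ?thesis using \<open>1 \<le> k\<close> by simp
qed

lemma level_function_onto:
  assumes "level_function U L k p" "U \<noteq> {}" "i \<le> k"
  shows "\<exists>a. p a = i"
proof (cases "i = 0")
  case True then show ?thesis using assms unfolding level_function_def by blast
next
  case False then show ?thesis using assms unfolding level_function_def by auto
qed

lemma mat_inner_commute: "mat_inner S T = mat_inner T S"
  unfolding mat_inner_def by (rule trace_mul_sym)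

text \<open>The initial state of a run is arbitrary, so \<open>\<sigma>\<close> may contain the
  final data from the start. Every step then leads from \<open>\<sigma>\<close> to itself, as the
  equations to be enforced already hold.\<close>

lemma possible_output_standard_form:
  fixes P :: "'n::{finite,linorder} sdp"
  assumes sf: "standard_form (upper_left s) (lower_right r) P X0 Z0" and rs: "r + s < CARD('n)"
    and m: "length (equations P) = m" and k: "k < m"
    and X: "feasible_P P X" "pos_def X" and Z: "feasible_D P Z" "pos_def Z"
    and p: "level_function (upper_left s) (lower_right r) k p"
    and q: "level_function (lower_right r) (upper_left s) l q"
    and A: "\<And>i. i \<in> {1..k} \<Longrightarrow> level_normal p i (fst (equations P ! (i - 1)))"
    and AZ: "fst (equations P ! k) = Z - Z0"
    and Y: "\<And>j. j \<in> {1..l} \<Longrightarrow> Y j \<in> dual_space P Z0 \<and> level_normal q j (Y j)"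
  shows "\<exists>\<sigma>. possible_output m \<sigma> \<and> output_sdp m \<sigma> = P"
proof -
  let ?L = "lower_right r :: 'n set" and ?U = "upper_left s :: 'n set" and ?e = "equations P"
  have le: "r \<le> CARD('n)" "s \<le> CARD('n)" "r + s \<le> CARD('n)" using rs by auto
  note dis = upper_left_lower_right_disjoint[OF le(3)]
  have cU: "card (?U \<union> ?L) = s + r"
    using card_Un_disjoint[OF _ _ dis] card_lower_right[OF le(1)] card_upper_left[OF le(2)] by simp
  then have M: "?U \<union> ?L \<noteq> UNIV" "?L \<union> ?U \<noteq> UNIV" using rs by (metis add.commute less_irrefl, metis Un_commute add.commute less_irrefl)
  have cM: "card (- (?U \<union> ?L)) = CARD('n) - r - s" "card (- (?L \<union> ?U)) = CARD('n) - r - s"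
    using cU by (simp_all add: Compl_eq_Diff_UNIV card_Diff_subset Un_commute)
  have ne: "?U \<noteq> {}" "?L \<noteq> {}" using standard_form_nonempty[OF sf M(1)] by auto
  have "r \<noteq> 0" "s \<noteq> 0"
    using ne card_lower_right[OF le(1)] card_upper_left[OF le(2)] by (auto simp: card_eq_0_iff)
  have kl: "k \<in> {1..CARD('n) - r - s}" "l \<in> {1..CARD('n) - r - s}"
    using level_function_bounds[OF p M(1)] level_function_bounds[OF q M(2)] unfolding cM by auto
  have sdp: "is_sdp P" and X0: "diag_pos ?L X0" and Z0: "diag_pos ?U Z0"
    and fX0: "feasible_P P X0" and fZ0: "feasible_D P Z0" using sf unfolding standard_form_def by auto
  obtain y where y: "Z0 = objective P - comb_lhs P y" using fZ0 unfolding feasible_D_def by blast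
  define \<sigma> :: "'n alg_state" where "\<sigma> = \<lparr>size_r = r, size_s = s, len_A = k, len_Y = l, Xbar = X, Zbar = Z,
    Xstar = X0, Zstar = Z0, Amat = (\<lambda>i. fst (?e ! (i - 1))), Ymat = Y, Pset = (\<lambda>i. {a. p a = i}),
    Qset = (\<lambda>j. {a. q a = j}), bvec = (\<lambda>i. snd (?e ! (i - 1))), Cmat = objective P\<rparr>"
  have sel: "size_r \<sigma> = r" "size_s \<sigma> = s" "len_A \<sigma> = k" "len_Y \<sigma> = l" "Xbar \<sigma> = X" "Zbar \<sigma> = Z"
    "Xstar \<sigma> = X0" "Zstar \<sigma> = Z0" "Amat \<sigma> = (\<lambda>i. fst (?e ! (i - 1)))" "Ymat \<sigma> = Y"
    "Pset \<sigma> = (\<lambda>i. {a. p a = i})" "Qset \<sigma> = (\<lambda>j. {a. q a = j})" "bvec \<sigma> = (\<lambda>i. snd (?e ! (i - 1)))"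
    "Cmat \<sigma> = objective P" unfolding \<sigma>_def by simp_all
  have symA: "sym_mat (Amat \<sigma> i)" if "i \<in> {1..m}" for i
    unfolding sel using that m by (intro is_sdp_nth[OF sdp]) auto
  have symY: "sym_mat (Y j)" if "j \<in> {1..l}" for j using Y[OF that] unfolding dual_space_def by blast
  have AX: "mat_inner (Amat \<sigma> i) (Delta_X \<sigma>) = 0" if i: "i \<in> {1..m}" for i
  proof -
    have "Amat \<sigma> i \<bullet> X = snd (?e ! (i - 1))" "Amat \<sigma> i \<bullet> X0 = snd (?e ! (i - 1))"
    proof -
      have "i - 1 < length ?e" using i m by auto
      then show "Amat \<sigma> i \<bullet> X = snd (?e ! (i - 1))" "Amat \<sigma> i \<bullet> X0 = snd (?e ! (i - 1))"
        using X(1) fX0 unfolding feasible_P_iff[OF sdp] sel by blast+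
    qed
    then show ?thesis using symA[OF i] unfolding Delta_X_def sel
      by (simp add: mat_inner_eq_inner' inner_diff_right)
  qed
  have AY: "mat_inner (Amat \<sigma> i) (Y j) = 0" if i: "i \<in> {1..m}" and j: "j \<in> {1..l}" for i j
  proof -
    have "i - 1 < length ?e" using i m by auto
    then have "Amat \<sigma> i \<bullet> Y j = 0" using Y[OF j] unfolding dual_space_def sel by blast
    then show ?thesis using symA[OF i] by (simp add: mat_inner_eq_inner')
  qed
  have Ak: "Amat \<sigma> (k + 1) = Delta_Z \<sigma>" using AZ unfolding Delta_Z_def sel by simp
  have YZ: "mat_inner (Y j) (Delta_Z \<sigma>) = 0" if j: "j \<in> {1..l}" for j
    using AY[of "k + 1" j] j k Ak mat_inner_commute[of "Y j"] by simp
  have s1: "alg_step m (Start, \<sigma>) (Done1, \<sigma>)"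
    using alg_step.step1[of r s k l m X Z \<sigma>] \<open>r \<noteq> 0\<close> \<open>s \<noteq> 0\<close> rs kl k X(2) Z(2) by (simp add: \<sigma>_def)
  have XZ: "mat_inner (Xbar \<sigma> - Xstar \<sigma>) (Zbar \<sigma> - Zstar \<sigma>) = 0"
    using AX[of "k + 1"] k Ak mat_inner_commute[of "Delta_X \<sigma>"] unfolding Delta_X_def Delta_Z_def by simp
  have "alg_step m (Done1, \<sigma>) (Done2, \<sigma>\<lparr>Xstar := Xstar \<sigma>, Zstar := Zstar \<sigma>\<rparr>)"
    using X0 Z0 XZ unfolding diag_pos_iff by (intro alg_step.step2) (simp_all add: sel)
  then have s2: "alg_step m (Done1, \<sigma>) (Done2, \<sigma>)" by (simp add: \<sigma>_def)
  have symZ: "sym_mat (Delta_Z \<sigma>)" using symA[of "k + 1"] k Ak by simp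
  have st: "stars_ok \<sigma>"
    unfolding stars_ok_def using X0 Z0 XZ symZ
    by (simp add: sel Delta_X_def Delta_Z_def mat_inner_eq_inner)
  have s3: "alg_step m (Done2, \<sigma>) (BaseEq 0, \<sigma>)"
  proof -
    have "alg_step m (Done2, \<sigma>) (BaseEq 0, \<sigma>\<lparr>Amat := Amat \<sigma>, Ymat := Y, Pset := (\<lambda>i. {a. p a = i}), Qset := (\<lambda>i. {a. q a = i})\<rparr>)"
    proof (rule step3_levels[OF st])
      show "p a = 0 \<longleftrightarrow> a \<in> upper_left (size_s \<sigma>)" "p a = Suc (len_A \<sigma>) \<longleftrightarrow> a \<in> lower_right (size_r \<sigma>)"
        "p a \<le> Suc (len_A \<sigma>)" for a using p unfolding level_function_def sel by auto
      show "q a = 0 \<longleftrightarrow> a \<in> lower_right (size_r \<sigma>)" "q a = Suc (len_Y \<sigma>) \<longleftrightarrow> a \<in> upper_left (size_s \<sigma>)"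
        "q a \<le> Suc (len_Y \<sigma>)" for a using q unfolding level_function_def sel by auto
      show "\<exists>a. p a = i" if "i \<le> len_A \<sigma>" for i using level_function_onto[OF p ne(1)] that unfolding sel by blast
      show "\<exists>a. q a = i" if "i \<le> len_Y \<sigma>" for i using level_function_onto[OF q ne(2)] that unfolding sel by blast
      show "sym_mat (Amat \<sigma> i) \<and> level_normal p i (Amat \<sigma> i)" if "i \<in> {1..len_A \<sigma>}" for i
        using symA[of i] A[of i] that k unfolding sel by auto
      show "sym_mat (Y j) \<and> level_normal q j (Y j)" if "j \<in> {1..len_Y \<sigma>}" for j
        using symY[of j] Y[of j] that unfolding sel by auto
    qed
    then show ?thesis by (simp add: \<sigma>_def)
  qed
  have "alg_step m (BaseEq (i - 1), \<sigma>) (BaseEq i, \<sigma>)" if i: "i \<in> {1..k}" for i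
  proof -
    have im: "i \<in> {1..m}" using i k by auto
    have "alg_step m (BaseEq (i - 1), \<sigma>) (BaseEq i, \<sigma>\<lparr>Amat := (Amat \<sigma>)(i := Amat \<sigma> i), Ymat := Ymat \<sigma>\<rparr>)"
    proof (rule alg_step.base_equations)
      show "i \<in> {1..len_A \<sigma>}" using i by (simp add: sel)
      show "adjusts_block (Amat \<sigma> i) (Amat \<sigma> i) (Pset \<sigma> (i - 1)) (Qset \<sigma> 0)"
        by (rule adjusts_block_refl[OF symA[OF im]])
      show "\<forall>j\<in>{1..len_Y \<sigma>}. adjusts_block (Ymat \<sigma> j) (Ymat \<sigma> j) (Pset \<sigma> (i - 1)) (Qset \<sigma> 0)"
        using symY adjusts_block_refl unfolding sel by blast
      show "\<forall>j\<in>{1..len_Y \<sigma>}. mat_inner (Amat \<sigma> i) (Ymat \<sigma> j) = 0"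
        using AY[OF im] unfolding sel(4,10) by blast
    qed
    then show ?thesis unfolding fun_upd_triv by (simp add: \<sigma>_def)
  qed
  then have base: "(alg_step m)\<^sup>*\<^sup>* (BaseEq 0, \<sigma>) (BaseEq i, \<sigma>)" if "i \<le> k" for i
    using that
  proof (induction i)
    case (Suc i)
    have "alg_step m (BaseEq (Suc i - 1), \<sigma>) (BaseEq (Suc i), \<sigma>)" using Suc.prems by (intro Suc.prems(1)) auto
    then show ?case using Suc by (auto intro: rtranclp.rtrancl_into_rtrancl)
  qed simp
  have s4: "alg_step m (BaseEq k, \<sigma>) (Done4, \<sigma>)"
  proof -
    have "alg_step m (BaseEq (len_A \<sigma>), \<sigma>) (Done4, \<sigma>\<lparr>Amat := Amat \<sigma>, Ymat := Ymat \<sigma>\<rparr>)"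
    proof (rule alg_step.step4b)
      show "\<forall>i\<in>{1..len_A \<sigma>}. adjusts_block (Amat \<sigma> i) (Amat \<sigma> i) (Pset \<sigma> 0) (Pset \<sigma> 0) \<and> mat_inner (Amat \<sigma> i) (Delta_X \<sigma>) = 0"
      proof (intro ballI conjI)
        fix i assume "i \<in> {1..len_A \<sigma>}"
        then have i: "i \<in> {1..m}" using k unfolding sel(3) by auto
        show "adjusts_block (Amat \<sigma> i) (Amat \<sigma> i) (Pset \<sigma> 0) (Pset \<sigma> 0)" by (rule adjusts_block_refl[OF symA[OF i]])
        show "mat_inner (Amat \<sigma> i) (Delta_X \<sigma>) = 0" by (rule AX[OF i])
      qed
      show "\<forall>j\<in>{1..len_Y \<sigma>}. adjusts_block (Ymat \<sigma> j) (Ymat \<sigma> j) (Qset \<sigma> 0) (Qset \<sigma> 0) \<and> mat_inner (Ymat \<sigma> j) (Delta_Z \<sigma>) = 0"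
        using YZ symY adjusts_block_refl unfolding sel(4,10) by blast
    qed
    then show ?thesis by (simp add: \<sigma>_def)
  qed
  have s5: "alg_step m (Done4, \<sigma>) (Done5, \<sigma>)"
  proof -
    have "alg_step m (Done4, \<sigma>) (Done5, \<sigma>\<lparr>Amat := Amat \<sigma>\<rparr>)"
    proof (rule alg_step.step5)
      show "Amat \<sigma> (len_A \<sigma> + 1) = Delta_Z \<sigma>" using Ak unfolding sel(3) .
      show "\<forall>i\<in>{len_A \<sigma> + 2..m}. sym_mat (Amat \<sigma> i) \<and> mat_inner (Amat \<sigma> i) (Delta_X \<sigma>) = 0 \<and>
              (\<forall>j\<in>{1..len_Y \<sigma>}. mat_inner (Amat \<sigma> i) (Ymat \<sigma> j) = 0)"
        using symA AX AY unfolding sel(3,4,10) by auto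
    qed simp
    then show ?thesis by (simp add: \<sigma>_def)
  qed
  have s6: "alg_step m (Done5, \<sigma>) (Finished, \<sigma>)"
  proof -
    have "alg_step m (Done5, \<sigma>) (Finished, \<sigma>\<lparr>bvec := bvec \<sigma>, Cmat := Cmat \<sigma>\<rparr>)"
    proof (rule alg_step.step6)
      show "\<forall>i\<in>{1..m}. bvec \<sigma> i = mat_inner (Amat \<sigma> i) (Xstar \<sigma>)"
      proof
        fix i assume i: "i \<in> {1..m}"
        have "Amat \<sigma> i \<bullet> X0 = snd (?e ! (i - 1))"
        proof -
          have "i - 1 < length ?e" using i m by auto
          then show ?thesis using fX0 unfolding feasible_P_iff[OF sdp] sel by blast
        qed
        then show "bvec \<sigma> i = mat_inner (Amat \<sigma> i) (Xstar \<sigma>)"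
          using symA[OF i] by (simp add: mat_inner_eq_inner' sel)
      qed
      have "comb_lhs P y = (\<Sum>i = 1..m. y (i - 1) *\<^sub>R Amat \<sigma> i)"
        unfolding comb_lhs_def m sel by (simp add: sum.atLeast1_atMost_eq)
      then show "Cmat \<sigma> = Zstar \<sigma> + (\<Sum>i = 1..m. y (i - 1) *\<^sub>R Amat \<sigma> i)" unfolding sel(8,14) y by simp
    qed
    then show ?thesis by (simp add: \<sigma>_def)
  qed
  have "(alg_step m)\<^sup>*\<^sup>* (Start, \<sigma>) (BaseEq 0, \<sigma>)" using s1 s2 s3 by (meson r_into_rtranclp rtranclp_trans)
  also have "(alg_step m)\<^sup>*\<^sup>* (BaseEq 0, \<sigma>) (BaseEq k, \<sigma>)" using base by blast
  also have "(alg_step m)\<^sup>*\<^sup>* (BaseEq k, \<sigma>) (Finished, \<sigma>)" using s4 s5 s6 by (meson r_into_rtranclp rtranclp_trans)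
  finally have "possible_output m \<sigma>" unfolding possible_output_def reachable_def by blast
  moreover have "map (\<lambda>i. (Amat \<sigma> i, bvec \<sigma> i)) [1..<Suc m] = ?e"
    unfolding sel using m by (intro nth_equalityI) (simp_all del: upt_Suc)
  then have "output_sdp m \<sigma> = P" unfolding output_sdp_def sel(14) by simp
  ultimately show ?thesis by blast
qed

section \<open>Normalized diagonal blocks and the leading equations\<close>

definition diagonal :: "('n::finite \<Rightarrow> real) \<Rightarrow> 'n sqmat" where
  "diagonal d = (\<chi> a b. if a = b then d a else 0)"

lemma congr_diagonal: "congr (diagonal d) M $ a $ b = d a * M $ a $ b * d b"
proof -
  have "(\<Sum>e\<in>UNIV. diagonal d $ a $ c * M $ c $ e * diagonal d $ b $ e) = (if c = a then d a * M $ a $ b * d b else 0)" for c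
    by (simp add: diagonal_def if_distrib cong: if_cong)
  then show ?thesis unfolding congr_nth by simp
qed

lemma diagonal_inverse: "(\<And>a. d a * e a = 1) \<Longrightarrow> diagonal d ** diagonal e = mat 1"
proof -
  assume de: "\<And>a. d a * e a = 1"
  have "(diagonal d ** diagonal e) $ a $ b = (mat 1 :: 'a sqmat) $ a $ b" for a b
  proof -
    have "(diagonal d ** diagonal e) $ a $ b = (\<Sum>c\<in>UNIV. if c = a then (if a = b then 1 else 0) else 0)"
      unfolding matrix_matrix_mult_def diagonal_def vec_lambda_beta
      by (intro sum.cong refl) (auto simp: de)
    then show ?thesis by (simp add: mat_def)
  qed
  then show ?thesis by (simp add: vec_eq_iff)
qed

text \<open>Each middle index belongs to exactly one level, so a single diagonal congruence
  normalizes all diagonal blocks at once. It leaves \<open>U\<close> and \<open>L\<close>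
  alone.\<close>

lemma exists_unit_normal_scaling:
  fixes A :: "nat \<Rightarrow> 'n::finite sqmat"
  assumes A: "\<And>i. i \<in> {1..k} \<Longrightarrow> level_normal p i (A i)" and p: "level_function U L k p"
  shows "\<exists>D D'. D ** D' = mat 1 \<and> D' ** D = mat 1 \<and> identity_off (- (U \<union> L)) D \<and> identity_off (- (U \<union> L)) D' \<and>
    (\<forall>i\<in>{1..k}. unit_normal p i (congr D (A i)))"
proof -
  have lev: "p a \<in> {1..k}" if "a \<notin> U" "a \<notin> L" for a
  proof -
    have "p a \<noteq> 0" "p a \<noteq> Suc k" "p a \<le> Suc k" using p that unfolding level_function_def by auto
    then show ?thesis by auto
  qed
  have mid: "a \<notin> U \<and> a \<notin> L" if "p a \<in> {1..k}" for a
  proof -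
    have "p a \<noteq> 0" "p a \<noteq> Suc k" using that by auto
    then show ?thesis using p unfolding level_function_def by auto
  qed
  have pos: "0 < A (p a) $ a $ a" if "a \<notin> U" "a \<notin> L" for a
    using A[OF lev[OF that]] unfolding level_normal_def by (metis order_refl)
  define d where "d a = (if a \<in> U \<union> L then 1 else 1 / sqrt (A (p a) $ a $ a))" for a
  define e where "e a = (if a \<in> U \<union> L then 1 else sqrt (A (p a) $ a $ a))" for a
  have de: "d a * e a = 1" "e a * d a = 1" for a
    using pos[of a] unfolding d_def e_def by (cases "a \<in> U \<union> L"; simp)+
  have "unit_normal p i (congr (diagonal d) (A i))" if i: "i \<in> {1..k}" for i
    unfolding unit_normal_def congr_diagonal
  proof (intro allI impI)
    fix a b assume ab: "i \<le> p a \<and> i \<le> p b"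
    then have n: "if a = b \<and> p a = i then 0 < A i $ a $ b else A i $ a $ b = 0"
      using A[OF i] unfolding level_normal_def by blast
    show "d a * A i $ a $ b * d b = (if a = b \<and> p a = i then 1 else 0)"
    proof (cases "a = b \<and> p a = i")
      case True
      then have ba: "b = a" and ip: "i = p a" by auto
      have "0 < A (p a) $ a $ a" "a \<notin> U \<union> L" using n mid[of a] i unfolding ba ip by auto
      then show ?thesis unfolding ba ip d_def by simp
    next
      case False
      then have "A i $ a $ b = 0" using n by presburger
      then show ?thesis using False by auto
    qed
  qed
  moreover have "identity_off (- (U \<union> L)) (diagonal d)" "identity_off (- (U \<union> L)) (diagonal e)"
    unfolding identity_off_def diagonal_def d_def e_def by auto
  ultimately show ?thesis using diagonal_inverse[of d e, OF de(1)] diagonal_inverse[of e d, OF de(2)] by blast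
qed

lemma unit_normal_imp_level_normal: "unit_normal p i A \<Longrightarrow> level_normal p i A"
  unfolding unit_normal_def level_normal_def by auto

text \<open>Two tests give independence: \<open>A (Suc j)\<close> has a diagonal entry
  \<open>1\<close> where all earlier matrices vanish, and \<open>Z - Z0\<close> has nonzero inner
  product with \<open>X0\<close>, to which all \<open>A i\<close> are orthogonal. Since these
  \<open>k + 1\<close> equations fit into the list, the bound on \<open>k\<close> demanded by step 1
  follows as well.\<close>

lemma reform_leading_equations:
  fixes P :: "'n::finite sdp"
  assumes sf: "standard_form U L P X0 Z0" and d: "U \<inter> L = {}" and L: "L \<noteq> {}"
    and p: "level_function U L k p"
    and A: "\<And>i. i \<in> {1..k} \<Longrightarrow> A i \<in> primal_space P \<and> unit_normal p i (A i)"
    and Z: "feasible_D P Z" "pos_def Z"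
  shows "\<exists>P'. reform_step\<^sup>*\<^sup>* P P' \<and> objective P' = objective P \<and> length (equations P') = length (equations P) \<and>
    span (set (equations P')) = span (set (equations P)) \<and> k < length (equations P) \<and>
    (\<forall>i\<in>{1..k}. fst (equations P' ! (i - 1)) = A i) \<and> fst (equations P' ! k) = Z - Z0"
proof -
  have sdp: "is_sdp P" and fX: "feasible_P P X0" and X0: "diag_pos L X0" and fZ: "feasible_D P Z0"
    using sf unfolding standard_form_def by auto
  obtain u v where u: "Z = objective P - comb_lhs P u" and v: "Z0 = objective P - comb_lhs P v"
    using Z(1) fZ unfolding feasible_D_def by blast
  let ?S = "span (set (equations P))"
  define \<beta> where "\<beta> = comb_rhs P v - comb_rhs P u"
  have "(comb_lhs P v, comb_rhs P v) - (comb_lhs P u, comb_rhs P u) \<in> ?S"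
    by (intro span_diff comb_span)
  then have ZS: "(Z - Z0, \<beta>) \<in> ?S" unfolding u v \<beta>_def by simp
  define Bs where "Bs = map (\<lambda>i. (A (Suc i), 0)) [0..<k] @ [(Z - Z0, \<beta>)]"
  have len: "length Bs = Suc k" unfolding Bs_def by simp
  have nth: "j < k \<Longrightarrow> Bs ! j = (A (Suc j), 0)" "Bs ! k = (Z - Z0, \<beta>)" for j
    unfolding Bs_def by (simp_all add: nth_append)
  have sub: "set Bs \<subseteq> ?S"
    using ZS A unfolding Bs_def primal_space_def by auto
  have fst_take: "fst ` set (take j Bs) \<subseteq> {A i | i. 1 \<le> i \<and> i \<le> j}" if "j \<le> k" for j
  proof
    fix M assume "M \<in> fst ` set (take j Bs)"
    then obtain i where "i < j" "M = fst (Bs ! i)" using that len by (auto simp: in_set_conv_nth)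
    then have "M = A (Suc i)" "1 \<le> Suc i" "Suc i \<le> j" using nth(1)[of i] that by auto
    then show "M \<in> {A i | i. 1 \<le> i \<and> i \<le> j}" by blast
  qed
  have indep: "fst (Bs ! j) \<notin> span (fst ` set (take j Bs))" if j: "j < length Bs" for j
  proof (cases "j < k")
    case True
    then obtain a where a: "p a = Suc j" using p unfolding level_function_def by fastforce
    have "A i $ a $ a = 0" if "1 \<le> i" "i \<le> j" for i
      using A[of i] that True a unfolding unit_normal_def by auto
    then have "span (fst ` set (take j Bs)) \<subseteq> {M. M $ a $ a = 0}"
      using fst_take[of j] True by (intro span_minimal) (auto simp: subspace_def)
    moreover have "A (Suc j) $ a $ a = 1" using A[of "Suc j"] True a unfolding unit_normal_def by auto
    ultimately show ?thesis using nth(1)[OF True] by auto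
  next
    case False
    then have jk: "j = k" using j len by simp
    have "A i \<bullet> X0 = 0" if "1 \<le> i" "i \<le> k" for i
      using A[of i] that primal_space_inner[OF sdp fX] by simp
    then have "span (fst ` set (take j Bs)) \<subseteq> {M. M \<bullet> X0 = 0}"
      using fst_take[of j] jk by (intro span_minimal) (auto simp: subspace_def inner_add_left)
    moreover obtain a where "a \<in> L" using L by blast
    then have "X0 $ a $ a \<noteq> 0" using X0 unfolding diag_pos_def by (metis less_irrefl)
    then have "X0 \<noteq> 0" by auto
    then have "0 < Z \<bullet> X0" using pos_def_inner_pos[OF Z(2) diag_pos_psd[OF X0]] by blast
    then have "(Z - Z0) \<bullet> X0 \<noteq> 0"
      using standard_form_orthogonal[OF sf d] by (simp add: inner_diff_left inner_commute[of Z0])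
    ultimately show ?thesis using nth(2) jk by auto
  qed
  obtain P' where P': "reform_step\<^sup>*\<^sup>* P P'" "take (length Bs) (equations P') = Bs" "objective P' = objective P"
    "length (equations P') = length (equations P)" "span (set (equations P')) = ?S"
    using reform_prefix[OF sub indep] by blast
  have "Suc k \<le> length (equations P')" using P'(2) len by (metis length_take min.cobounded1)
  have e: "equations P' ! j = Bs ! j" if "j < Suc k" for j using P'(2) len that by (metis nth_take)
  have "fst (equations P' ! (i - 1)) = A i" if "i \<in> {1..k}" for i
    using that e[of "i - 1"] nth(1)[of "i - 1"] by auto
  moreover have "fst (equations P' ! k) = Z - Z0" using e[of k] nth(2) by simp
  moreover have "k < length (equations P)" using \<open>Suc k \<le> length (equations P')\<close> P'(4) by simp
  ultimately show ?thesis using P' by blast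
qed

lemma standard_form_span:
  assumes sf: "standard_form U L P X0 Z0" and o: "objective P' = objective P"
    and sp: "span (set (equations P')) = span (set (equations P))"
  shows "standard_form U L P' X0 Z0" "dual_space P' Z0 = dual_space P Z0"
    "feasible_P P' X \<longleftrightarrow> feasible_P P X" "feasible_D P' Z \<longleftrightarrow> feasible_D P Z"
proof -
  have sdp: "is_sdp P" using sf unfolding standard_form_def by blast
  have "subspace {e :: 'a sqmat \<times> real. sym_mat (fst e)}"
    unfolding subspace_def by (auto intro: sym_mat_intros) (simp add: sym_mat_iff)
  then have "span (set (equations P)) \<subseteq> {e. sym_mat (fst e)}"
    using sdp unfolding is_sdp_def by (intro span_minimal) auto
  then have "set (equations P') \<subseteq> {e. sym_mat (fst e)}" using sp span_superset by blast
  then have sdp': "is_sdp P'" using sdp o unfolding is_sdp_def by auto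
  \<comment> \<open>The factor \<open>c = 1\<close> gives feasibility, \<open>c = 0\<close> gives
    membership in \<open>dual_space\<close>; both conditions thus depend only on the span of the
    equations.\<close>
  have all: "(\<forall>i<length (equations Q). fst (equations Q ! i) \<bullet> X = snd (equations Q ! i) * c) \<longleftrightarrow>
      span (set (equations Q)) \<subseteq> {e. fst e \<bullet> X = snd e * c}" for Q :: "'a sdp" and X c
  proof -
    have "subspace {e :: 'a sqmat \<times> real. fst e \<bullet> X = snd e * c}"
      unfolding subspace_def by (auto simp: inner_add_left algebra_simps)
    then have "span (set (equations Q)) \<subseteq> {e. fst e \<bullet> X = snd e * c} \<longleftrightarrow> set (equations Q) \<subseteq> {e. fst e \<bullet> X = snd e * c}"
      using span_minimal span_superset by blast
    moreover have "(\<forall>i<length (equations Q). fst (equations Q ! i) \<bullet> X = snd (equations Q ! i) * c) \<longleftrightarrow>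
        (\<forall>e\<in>set (equations Q). fst e \<bullet> X = snd e * c)" by (simp only: all_set_conv_all_nth)
    ultimately show ?thesis by blast
  qed
  have fP: "feasible_P P' X \<longleftrightarrow> feasible_P P X" for X
    unfolding feasible_P_iff[OF sdp] feasible_P_iff[OF sdp'] using all[of P' X 1] all[of P X 1] sp by simp
  have "\<exists>y'. comb_lhs P' y' = comb_lhs P y" for y
    using comb_span[of P y] span_comb[of "(comb_lhs P y, comb_rhs P y)" P'] sp by (metis Pair_inject)
  moreover have "\<exists>y'. comb_lhs P y' = comb_lhs P' y" for y
    using comb_span[of P' y] span_comb[of "(comb_lhs P' y, comb_rhs P' y)" P] sp by (metis Pair_inject)
  ultimately have fD: "feasible_D P' Z \<longleftrightarrow> feasible_D P Z" for Z
    unfolding feasible_D_def dual_feasible_def o by metis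
  show "dual_space P' Z0 = dual_space P Z0"
    unfolding dual_space_def using all[of P' _ 0] all[of P _ 0] sp by simp
  show "standard_form U L P' X0 Z0"
    using sf sdp' unfolding standard_form_def slater_P_def slater_D_def fP fD by blast
  show "feasible_P P' X \<longleftrightarrow> feasible_P P X" "feasible_D P' Z \<longleftrightarrow> feasible_D P Z" using fP fD by blast+
qed

lemma standard_form_output:
  fixes P :: "'n::{finite,linorder} sdp"
  assumes sf: "standard_form (upper_left s) (lower_right r) P X0 Z0" and rs: "r + s < CARD('n)"
  shows "\<exists>\<sigma>. possible_output (length (equations P)) \<sigma> \<and>
    reform_step\<^sup>*\<^sup>* P (output_sdp (length (equations P)) \<sigma>)"
proof -
  let ?L = "lower_right r :: 'n set" and ?U = "upper_left s :: 'n set"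
  let ?M = "- (?U \<union> ?L)"
  have le: "r \<le> CARD('n)" "s \<le> CARD('n)" "r + s \<le> CARD('n)" using rs by auto
  note dis = upper_left_lower_right_disjoint[OF le(3)]
  have "card (?U \<union> ?L) = s + r"
    using card_Un_disjoint[OF _ _ dis] card_lower_right[OF le(1)] card_upper_left[OF le(2)] by simp
  then have M: "?U \<union> ?L \<noteq> UNIV" using rs by (metis add.commute less_irrefl)
  have ne: "?U \<noteq> {}" "?L \<noteq> {}" using standard_form_nonempty[OF sf M] by auto
  have UM: "?U \<union> ?M = - ?L" "?L \<union> ?M = - ?U" "?U \<inter> ?M = {}" "?L \<inter> ?M = {}" using dis by auto
  have sdp: "is_sdp P" and X0: "diag_pos ?L X0" and Z0: "diag_pos ?U Z0" and fX: "feasible_P P X0"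
    using sf unfolding standard_form_def by auto

  have HA: "supported_on X ?L" if "psd X" "supported_on X (?L \<union> ?M)" "\<forall>V\<in>primal_space P. V \<bullet> X = 0" for X
    using primal_cone_supported[OF sf dis ne(2) that(1) _ that(3)] that(2) unfolding UM by blast
  \<comment> \<open>With a constant level function all middle indices form one level; there is no
    second sequence to protect yet, and any orthogonal rotation of the middle is admissible.\<close>
  have "\<exists>S S' k p A. level_change (\<lambda>_. 0) ?M S S' \<and> (\<forall>a. p a = 0 \<longleftrightarrow> a \<notin> ?L \<union> ?M) \<and>
      (\<forall>a. p a = Suc k \<longleftrightarrow> a \<in> ?L) \<and> (\<forall>a. p a \<le> Suc k) \<and> (\<forall>i\<in>{1..k}. \<exists>a. p a = i) \<and>
      (\<forall>i\<in>{1..k}. (\<exists>V\<in>primal_space P. A i = congr S V) \<and> level_normal p i (A i))"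
    by (rule facial_reduction[OF subspace_primal_space standard_form_sym[OF sf] UM(4) X0
          primal_space_inner[OF sdp fX] HA])
  then obtain S S' k p A where S: "level_change (\<lambda>_. 0) ?M S S'"
    and p0: "\<forall>a. p a = 0 \<longleftrightarrow> a \<notin> ?L \<union> ?M" "\<forall>a. p a = Suc k \<longleftrightarrow> a \<in> ?L" "\<forall>a. p a \<le> Suc k" "\<forall>i\<in>{1..k}. \<exists>a. p a = i"
    and A: "\<forall>i\<in>{1..k}. (\<exists>V\<in>primal_space P. A i = congr S V) \<and> level_normal p i (A i)"
    by (elim exE conjE) (rule that)
  have p: "level_function ?U ?L k p"
    unfolding level_function_def using p0 unfolding UM(2) by blast
  obtain D D' where D: "D ** D' = mat 1" "D' ** D = mat 1" "identity_off ?M D" "identity_off ?M D'"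
    and A1: "\<forall>i\<in>{1..k}. unit_normal p i (congr D (A i))"
    using exists_unit_normal_scaling[OF _ p, of A] A by blast
  have Sprops: "S ** S' = mat 1" "S' ** S = mat 1" "identity_off ?M S" "identity_off ?M S'"
    using S unfolding level_change_def by auto
  define P1 where "P1 = rotate_sdp D (rotate_sdp S P)"
  have sf1: "standard_form ?U ?L P1 X0 Z0"
    unfolding P1_def
    by (rule standard_form_rotate[OF standard_form_rotate[OF sf Sprops UM(3,4)] D UM(3,4)])
  have r1: "reform_step\<^sup>*\<^sup>* P P1"
    unfolding P1_def using reform_rotate[OF Sprops(1), of P] reform_rotate[OF D(1), of "rotate_sdp S P"]
    by (meson r_into_rtranclp rtranclp_trans)
  have A1P: "congr D (A i) \<in> primal_space P1" if i: "i \<in> {1..k}" for i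
  proof -
    obtain V where "V \<in> primal_space P" "A i = congr S V" using A i by blast
    then show ?thesis unfolding P1_def using primal_space_rotate by metis
  qed

  have symN: "sym_mat Y" "Y \<bullet> Z0 = 0" if "Y \<in> dual_space P1 Z0" for Y
    using that unfolding dual_space_def by (auto simp: inner_commute)
  have HY: "supported_on Z ?U" if "psd Z" "supported_on Z (?U \<union> ?M)" "\<forall>Y\<in>dual_space P1 Z0. Y \<bullet> Z = 0" for Z
    using dual_cone_supported[OF sf1 dis that(1) _ that(3)] that(2) unfolding UM by blast
  \<comment> \<open>This time the moves respect the levels \<open>p\<close> of the first structure,
    whose matrices have identity blocks after the scaling by \<open>D\<close>.\<close>
  have "\<exists>T T' l q Y. level_change p ?M T T' \<and> (\<forall>a. q a = 0 \<longleftrightarrow> a \<notin> ?U \<union> ?M) \<and>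
      (\<forall>a. q a = Suc l \<longleftrightarrow> a \<in> ?U) \<and> (\<forall>a. q a \<le> Suc l) \<and> (\<forall>i\<in>{1..l}. \<exists>a. q a = i) \<and>
      (\<forall>i\<in>{1..l}. (\<exists>V\<in>dual_space P1 Z0. Y i = congr T V) \<and> level_normal q i (Y i))"
    by (rule facial_reduction[OF subspace_dual_space symN(1) UM(3) Z0 symN(2) HY])
  then obtain T T' l q Y where T: "level_change p ?M T T'"
    and q0: "\<forall>a. q a = 0 \<longleftrightarrow> a \<notin> ?U \<union> ?M" "\<forall>a. q a = Suc l \<longleftrightarrow> a \<in> ?U" "\<forall>a. q a \<le> Suc l" "\<forall>i\<in>{1..l}. \<exists>a. q a = i"
    and Y: "\<forall>i\<in>{1..l}. (\<exists>V\<in>dual_space P1 Z0. Y i = congr T V) \<and> level_normal q i (Y i)"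
    by (elim exE conjE) (rule that)
  have q: "level_function ?L ?U l q"
    unfolding level_function_def using q0 unfolding UM(1) by blast
  \<comment> \<open>The \<open>Y\<close> side is moved by \<open>T\<close>, so the program has to be
    rotated by the transposed inverse of \<open>T\<close>.\<close>
  let ?R = "transpose T'" and ?R' = "transpose T"
  have Tprops: "T ** T' = mat 1" "T' ** T = mat 1" "identity_off ?M T" "identity_off ?M T'"
    and Tn: "\<And>i A. unit_normal p i A \<Longrightarrow> unit_normal p i (congr ?R A)"
    using T unfolding level_change_def by auto
  have R: "?R ** ?R' = mat 1" "?R' ** ?R = mat 1" "identity_off ?M ?R" "identity_off ?M ?R'"
    using Tprops by (simp_all add: transpose_inverse identity_off_transpose)
  define P2 where "P2 = rotate_sdp ?R P1"
  have sf2: "standard_form ?U ?L P2 X0 Z0"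
    unfolding P2_def by (rule standard_form_rotate[OF sf1 R UM(3,4)])
  have r2: "reform_step\<^sup>*\<^sup>* P1 P2" unfolding P2_def using reform_rotate[OF R(1), of P1] by blast
  define A2 where "A2 i = congr ?R (congr D (A i))" for i
  have A2: "A2 i \<in> primal_space P2 \<and> unit_normal p i (A2 i)" if "i \<in> {1..k}" for i
    using A1P[OF that] A1 that Tn primal_space_rotate unfolding A2_def P2_def by blast
  have Z0R: "congr ?R Z0 = Z0"
    using Z0 unfolding diag_pos_iff by (intro congr_supported_off[OF R(3) _ UM(3)]) blast
  have Y2: "Y i \<in> dual_space P2 Z0 \<and> level_normal q i (Y i)" if i: "i \<in> {1..l}" for i
  proof -
    obtain V where "V \<in> dual_space P1 Z0" "Y i = congr T V" using Y i by blast
    then have "Y i \<in> dual_space P2 Z0"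
      using dual_space_rotate[OF R(2) Z0R, of V P1] unfolding P2_def by simp
    then show ?thesis using Y i by blast
  qed

  obtain X where X: "feasible_P P2 X" "pos_def X" using sf2 unfolding standard_form_def slater_P_def by blast
  obtain Z where Z: "feasible_D P2 Z" "pos_def Z" using sf2 unfolding standard_form_def slater_D_def by blast
  obtain P3 where P3: "reform_step\<^sup>*\<^sup>* P2 P3" "objective P3 = objective P2"
    "length (equations P3) = length (equations P2)" "span (set (equations P3)) = span (set (equations P2))"
    "k < length (equations P2)" "\<forall>i\<in>{1..k}. fst (equations P3 ! (i - 1)) = A2 i" "fst (equations P3 ! k) = Z - Z0"
    using reform_leading_equations[OF sf2 dis ne(2) p A2 Z] by blast
  have lenP: "length (equations P2) = length (equations P)" unfolding P2_def P1_def by (simp add: rotate_simps)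
  note sp = standard_form_span[OF sf2 P3(2,4)]
  have "\<exists>\<sigma>. possible_output (length (equations P)) \<sigma> \<and> output_sdp (length (equations P)) \<sigma> = P3"
  proof (rule possible_output_standard_form[OF sp(1) rs _ _ _ X(2) _ Z(2) p q _ P3(7)])
    show "length (equations P3) = length (equations P)" using P3(3) lenP by simp
    show "k < length (equations P)" using P3(5) lenP by simp
    show "feasible_P P3 X" "feasible_D P3 Z" using X(1) Z(1) sp(3,4) by blast+
    show "level_normal p i (fst (equations P3 ! (i - 1)))" if "i \<in> {1..k}" for i
      using P3(6) A2[OF that] that unit_normal_imp_level_normal by metis
    show "Y j \<in> dual_space P3 Z0 \<and> level_normal q j (Y j)" if "j \<in> {1..l}" for j
      using Y2[OF that] unfolding sp(2) .
  qed
  moreover have "reform_step\<^sup>*\<^sup>* P P3" using r1 r2 P3(1) by (meson rtranclp_trans)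
  ultimately show ?thesis by blast
qed

lemma exists_reformulation:
  fixes P :: "'n::{finite,linorder} sdp"
  assumes "is_sdp P" "fails_strict_complementarity P" "slater_P P" "slater_D P"
  shows "\<exists>\<sigma>. possible_output (length (equations P)) \<sigma> \<and>
    reformulation_of P (output_sdp (length (equations P)) \<sigma>)"
proof -
  obtain S S' r s X0 Z0 where inv: "S ** S' = mat 1" and rs: "r + s < CARD('n)"
    and sf: "standard_form (upper_left s) (lower_right r) (rotate_sdp S P) X0 Z0"
    using exists_standard_form[OF assms] by blast
  obtain \<sigma> where \<sigma>: "possible_output (length (equations P)) \<sigma>"
    "reform_step\<^sup>*\<^sup>* (rotate_sdp S P) (output_sdp (length (equations P)) \<sigma>)"
    using standard_form_output[OF sf rs] unfolding rotate_simps(1) by blast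
  have "reform_step\<^sup>*\<^sup>* P (output_sdp (length (equations P)) \<sigma>)"
    using reform_rotate[OF inv] \<sigma>(2) by (rule converse_rtranclp_into_rtranclp)
  then show ?thesis using \<sigma>(1) reform_steps_reverse unfolding reformulation_of_def by blast
qed

theorem theorem3:
  fixes m :: nat
  assumes n: "3 \<le> CARD('n::{finite,linorder})" and m: "2 \<le> m"
  shows
    "(\<forall>c :: stage \<times> 'n alg_state. reachable m c \<longrightarrow> fst c \<noteq> Finished \<longrightarrow> (\<exists>c'. alg_step m c c')) \<and>
     (\<nexists>f :: nat \<Rightarrow> stage \<times> 'n alg_state.
        reachable m (f 0) \<and> (\<forall>t. alg_step m (f t) (f (Suc t)))) \<and>
     (\<forall>\<sigma> :: 'n alg_state. possible_output m \<sigma> \<longrightarrow>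
        (let P = output_sdp m \<sigma> in
           is_sdp P \<and>
           fails_strict_complementarity P \<and>
           max_rank_optimal_P P (Xstar \<sigma>) \<and>
           max_rank_optimal_D P (Zstar \<sigma>) \<and>
           pos_def (Xbar \<sigma>) \<and> feasible_P P (Xbar \<sigma>) \<and>
           pos_def (Zbar \<sigma>) \<and> feasible_D P (Zbar \<sigma>) \<and>
           slater_P P \<and> slater_D P \<and>
           (\<forall>i\<in>{1..len_A \<sigma>}. bvec \<sigma> i = 0) \<and>
           regular_fr (seq_A \<sigma>) \<and>
           reduced_face (seq_A \<sigma>) = psd_face (lower_right (size_r \<sigma>)) \<and>
           (\<forall>i\<in>{1..m}. \<forall>j\<in>{1..len_Y \<sigma>}. mat_inner (Amat \<sigma> i) (Ymat \<sigma> j) = 0) \<and>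
           (\<forall>j\<in>{1..len_Y \<sigma>}. mat_inner (Cmat \<sigma>) (Ymat \<sigma> j) = 0) \<and>
           regular_fr (seq_Y \<sigma>) \<and>
           reduced_face (seq_Y \<sigma>) = psd_face (upper_left (size_s \<sigma>)))) \<and>
     (\<forall>P :: 'n sdp.
        is_sdp P \<and> length (equations P) = m \<and> independent_constraints P \<and>
        fails_strict_complementarity P \<and> slater_P P \<and> slater_D P \<longrightarrow>
        (\<exists>\<sigma> :: 'n alg_state. possible_output m \<sigma> \<and> reformulation_of P (output_sdp m \<sigma>)))"
proof (intro conjI allI impI)
  fix P :: "'n sdp"
  assume P: "is_sdp P \<and> length (equations P) = m \<and> independent_constraints P \<and>
    fails_strict_complementarity P \<and> slater_P P \<and> slater_D P"
  then have "length (equations P) = m" by blast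
  then show "\<exists>\<sigma> :: 'n alg_state. possible_output m \<sigma> \<and> reformulation_of P (output_sdp m \<sigma>)"
    using exists_reformulation[of P] P by blast
qed (rule progress[OF n m] no_infinite_run output_correct; assumption)+

end
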